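(* Let $(\mathfrak{g},\bullet)$ be a (finite dimensional real) left symmetric algebra, $(M,\nabla)$ an affine manifold and $\rho:\mathfrak{g}\to\Gamma(TM)$ a linear map such that $\rho(u\bullet v)=\nabla_{\rho(u)}\rho(v)$ for all $u,v\in\mathfrak{g}$. Let $\Phi(\mathfrak{g})=\mathfrak{g}\times\mathfrak{g}$ and define $\rho^l:\Phi(\mathfrak{g})\to\Gamma(TTM)$ by $\rho^l(u,v)=\rho(u)^h+\rho(v)^v$. Let $r\in\mathfrak{g}\otimes\mathfrak{g}$ be symmetric with $[[r,r]]=0$ and let $R\in\Phi(\mathfrak{g})\otimes\Phi(\mathfrak{g})$ be given by $R((\alpha_1,\beta_1),(\alpha_2,\beta_2))=r(\alpha_1,\beta_2)-r(\alpha_2,\beta_1)$ for $\alpha_i,\beta_i\in\mathfrak{g}^*$. Then the bivector field on $TM$ associated to the symmetric bivector field $\rho(r)$ is $\rho^l(R)$, which is a Poisson tensor, and $(M,\nabla,\rho(r))$ is a contravariant pseudo-Hessian manifold.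
   Context: A left symmetric algebra is an algebra with $\mathrm{ass}(u,v,w)=\mathrm{ass}(v,u,w)$, where $\mathrm{ass}(u,v,w)=(u\bullet v)\bullet w-u\bullet(v\bullet w)$; its commutator $[u,v]=u\bullet v-v\bullet u$ is a Lie bracket. For symmetric $r$, with $\langle\beta,r_\#(\alpha)\rangle=r(\alpha,\beta)$, $[[r,r]](\alpha,\beta,\gamma):=\langle\gamma,r_\#(\mathrm{L}^*_{r_\#(\alpha)}\beta-\mathrm{L}^*_{r_\#(\beta)}\alpha)-[r_\#(\alpha),r_\#(\beta)]\rangle$, where $\langle\mathrm{L}^*_u\alpha,v\rangle=-\langle\alpha,u\bullet v\rangle$. If $r=\sum r_{i,j}e_i\otimes e_j$ then $\rho(r)=\sum r_{i,j}\rho(e_i)\otimes\rho(e_j)$; $\rho^l(R)$ is defined likewise. An affine manifold $(M,\nabla)$ is a manifold with a torsion-free connection of vanishing curvature. $(M,\nabla,h)$, with $h$ a symmetric bivector field, is a contravariant pseudo-Hessian manifold if $(\nabla_{h_\#(\alpha)}h)(\beta,\gamma)=(\nabla_{h_\#(\beta)}h)(\alpha,\gamma)$ for all 1-forms, where $\beta(h_\#(\alpha))=h(\alpha,\beta)$. On the tangent bundle $p:TM\to M$, $X^h$ and $X^v$ denote the horizontal (with respect to $\nabla$) and vertical lifts of a vector field $X$; for $\alpha\in\Omega^1(M)$, $\alpha^v(X^v)=\alpha(X)\circ p$, $\alpha^v(X^h)=0$, $\alpha^h(X^h)=\alpha(X)\circ p$, $\alpha^h(X^v)=0$. The bivector field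 $\Pi$ on $TM$ associated to a symmetric bivector field $h$ on $M$ is given by $\Pi(\alpha^v,\beta^v)=\Pi(\alpha^h,\beta^h)=0$ and $\Pi(\alpha^h,\beta^v)=-\Pi(\beta^v,\alpha^h)=h(\alpha,\beta)\circ p$. *)

theory Defs
  imports "HOL-Analysis.Analysis"
begin

section \<open>Smooth maps between normed spaces\<close>

text \<open>\<open>C\<^sup>k\<close> regularity on an open set \<open>S\<close>, by recursion on directional derivatives. For finite
  dimensional domains this is the usual notion.\<close>

primrec Ck_on :: "nat \<Rightarrow> 'a::real_normed_vector set \<Rightarrow> ('a \<Rightarrow> 'b::real_normed_vector) \<Rightarrow> bool" where
  "Ck_on 0 S f \<longleftrightarrow> continuous_on S f"
| "Ck_on (Suc k) S f \<longleftrightarrow> (\<forall>x\<in>S. f differentiable (at x)) \<and>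
     (\<forall>v. Ck_on k S (\<lambda>x. frechet_derivative f (at x) v))"

definition smooth_on :: "'a::real_normed_vector set \<Rightarrow> ('a \<Rightarrow> 'b::real_normed_vector) \<Rightarrow> bool" where
  "smooth_on S f \<longleftrightarrow> (\<forall>k. Ck_on k S f)"


section \<open>Smooth manifolds\<close>

text \<open>A manifold is given by an atlas \<open>A\<close>: a set of charts \<open>(U, \<phi>)\<close>, with \<open>U\<close> a subset of the
  ambient type \<open>'m\<close> and \<open>\<phi>\<close> mapping \<open>U\<close> bijectively to an open subset of the model space \<open>'e\<close>.
  The underlying set is the union of the chart domains, and the topology is the one induced by
  the charts. The tangent bundle, whose points form a proper subset of the type of pairs, is a
  manifold of the same kind.\<close>

type_synonym ('m, 'e) atlas = "('m set \<times> ('m \<Rightarrow> 'e)) set"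

definition points :: "('m, 'e) atlas \<Rightarrow> 'm set" where
  "points A = \<Union> (fst ` A)"

definition smooth_atlas :: "('m, 'e::euclidean_space) atlas \<Rightarrow> bool" where
  "smooth_atlas A \<longleftrightarrow>
     (\<forall>(U, \<phi>)\<in>A. inj_on \<phi> U \<and> open (\<phi> ` U)) \<and>
     (\<forall>(U, \<phi>)\<in>A. \<forall>(V, \<psi>)\<in>A.
        open (\<phi> ` (U \<inter> V)) \<and> smooth_on (\<phi> ` (U \<inter> V)) (\<psi> \<circ> inv_into U \<phi>))"

definition atlas_topology :: "('m, 'e::euclidean_space) atlas \<Rightarrow> 'm topology" where
  "atlas_topology A = topology_generated_by {U \<inter> \<phi> -` W | U \<phi> W. (U, \<phi>) \<in> A \<and> open W}"

definition smooth_manifold :: "('m, 'e::euclidean_space) atlas \<Rightarrow> bool" where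
  "smooth_manifold A \<longleftrightarrow> smooth_atlas A \<and>
     Hausdorff_space (atlas_topology A) \<and> second_countable (atlas_topology A)"

text \<open>Functions that are smooth on a neighbourhood of \<open>p\<close> (with arbitrary values elsewhere).\<close>

definition smooth_near :: "('m, 'e::euclidean_space) atlas \<Rightarrow> 'm \<Rightarrow> ('m \<Rightarrow> real) set" where
  "smooth_near A p = {f. \<exists>(U, \<phi>)\<in>A. p \<in> U \<and>
     (\<exists>W. open W \<and> \<phi> p \<in> W \<and> W \<subseteq> \<phi> ` U \<and> smooth_on W (f \<circ> inv_into U \<phi>))}"

definition smooth_fun :: "('m, 'e::euclidean_space) atlas \<Rightarrow> ('m \<Rightarrow> real) \<Rightarrow> bool" where
  "smooth_fun A f \<longleftrightarrow> (\<forall>p\<in>points A. f \<in> smooth_near A p)"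


section \<open>Tangent vectors, vector fields, forms, contravariant 2-tensors\<close>

text \<open>A tangent vector at \<open>p\<close> is a directional derivative operator \<open>\<Sum>\<^sub>i w\<^sub>i \<partial>/\<partial>x\<^sub>i\<close> at \<open>p\<close> in some chart,
  acting on functions smooth near \<open>p\<close>. It takes the value 0 on all other HOL functions, so that
  two tangent vectors are equal as HOL functions iff they agree on germs.\<close>

type_synonym 'm tvec = "('m \<Rightarrow> real) \<Rightarrow> real"

definition chart_tvec ::
  "('m, 'e::euclidean_space) atlas \<Rightarrow> 'm set \<times> ('m \<Rightarrow> 'e) \<Rightarrow> 'm \<Rightarrow> 'e \<Rightarrow> 'm tvec" where
  "chart_tvec A c p w = (\<lambda>f. if f \<in> smooth_near A p
     then frechet_derivative (f \<circ> inv_into (fst c) (snd c)) (at (snd c p)) w else 0)"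

definition tangent_space :: "('m, 'e::euclidean_space) atlas \<Rightarrow> 'm \<Rightarrow> 'm tvec set" where
  "tangent_space A p = {chart_tvec A c p w | c w. c \<in> A \<and> p \<in> fst c}"

text \<open>Covectors are linear functionals on the tangent space, extended by 0 to the ambient type.\<close>

type_synonym 'm cov = "'m tvec \<Rightarrow> real"

definition cotangent_space :: "('m, 'e::euclidean_space) atlas \<Rightarrow> 'm \<Rightarrow> 'm cov set" where
  "cotangent_space A p = {a. (\<forall>v. v \<notin> tangent_space A p \<longrightarrow> a v = 0) \<and>
     (\<forall>v\<in>tangent_space A p. \<forall>w\<in>tangent_space A p. \<forall>s t.
        a (\<lambda>f. s * v f + t * w f) = s * a v + t * a w)}"

text \<open>Smooth vector fields, that is, smooth sections of the tangent bundle. They are made zero off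
  the manifold, so that equality of sections is equality of HOL functions.\<close>

type_synonym 'm vfield = "'m \<Rightarrow> 'm tvec"

definition vector_field :: "('m, 'e::euclidean_space) atlas \<Rightarrow> 'm vfield \<Rightarrow> bool" where
  "vector_field A X \<longleftrightarrow>
     (\<forall>p\<in>points A. X p \<in> tangent_space A p \<and>
        (\<forall>f\<in>smooth_near A p. (\<lambda>q. X q f) \<in> smooth_near A p)) \<and>
     (\<forall>p. p \<notin> points A \<longrightarrow> X p = (\<lambda>_. 0))"

definition vf_add :: "'m vfield \<Rightarrow> 'm vfield \<Rightarrow> 'm vfield" where
  "vf_add X Y = (\<lambda>p f. X p f + Y p f)"

definition vf_diff :: "'m vfield \<Rightarrow> 'm vfield \<Rightarrow> 'm vfield" where
  "vf_diff X Y = (\<lambda>p f. X p f - Y p f)"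

definition vf_mult :: "('m \<Rightarrow> real) \<Rightarrow> 'm vfield \<Rightarrow> 'm vfield" where
  "vf_mult g X = (\<lambda>p f. g p * X p f)"

definition lie_bracket :: "('m, 'e::euclidean_space) atlas \<Rightarrow> 'm vfield \<Rightarrow> 'm vfield \<Rightarrow> 'm vfield" where
  "lie_bracket A X Y = (\<lambda>p f. if f \<in> smooth_near A p
     then X p (\<lambda>q. Y q f) - Y p (\<lambda>q. X q f) else 0)"

type_synonym 'm form = "'m \<Rightarrow> 'm cov"

definition one_form :: "('m, 'e::euclidean_space) atlas \<Rightarrow> 'm form \<Rightarrow> bool" where
  "one_form A \<alpha> \<longleftrightarrow> (\<forall>p\<in>points A. \<alpha> p \<in> cotangent_space A p) \<and>
     (\<forall>X. vector_field A X \<longrightarrow> smooth_fun A (\<lambda>p. \<alpha> p (X p)))"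

definition differential :: "('m, 'e::euclidean_space) atlas \<Rightarrow> ('m \<Rightarrow> real) \<Rightarrow> 'm form" where
  "differential A f = (\<lambda>p v. if v \<in> tangent_space A p then v f else 0)"

text \<open>Smooth contravariant 2-tensor fields, as bilinear forms on the cotangent spaces.\<close>

type_synonym 'm tensor2 = "'m \<Rightarrow> 'm cov \<Rightarrow> 'm cov \<Rightarrow> real"

definition tensor2_field :: "('m, 'e::euclidean_space) atlas \<Rightarrow> 'm tensor2 \<Rightarrow> bool" where
  "tensor2_field A h \<longleftrightarrow>
     (\<forall>p\<in>points A. \<forall>a\<in>cotangent_space A p. \<forall>b\<in>cotangent_space A p. \<forall>c\<in>cotangent_space A p. \<forall>s t.
        h p (\<lambda>v. s * a v + t * b v) c = s * h p a c + t * h p b c \<and>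
        h p c (\<lambda>v. s * a v + t * b v) = s * h p c a + t * h p c b) \<and>
     (\<forall>\<alpha> \<beta>. one_form A \<alpha> \<longrightarrow> one_form A \<beta> \<longrightarrow> smooth_fun A (\<lambda>p. h p (\<alpha> p) (\<beta> p)))"

definition symmetric_bivector_field :: "('m, 'e::euclidean_space) atlas \<Rightarrow> 'm tensor2 \<Rightarrow> bool" where
  "symmetric_bivector_field A h \<longleftrightarrow> tensor2_field A h \<and>
     (\<forall>p\<in>points A. \<forall>a\<in>cotangent_space A p. \<forall>b\<in>cotangent_space A p. h p a b = h p b a)"

definition bivector_field :: "('m, 'e::euclidean_space) atlas \<Rightarrow> 'm tensor2 \<Rightarrow> bool" where
  "bivector_field A P \<longleftrightarrow> tensor2_field A P \<and>
     (\<forall>p\<in>points A. \<forall>a\<in>cotangent_space A p. \<forall>b\<in>cotangent_space A p. P p a b = - P p b a)"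

text \<open>A Poisson tensor is a bivector field whose bracket \<open>{f, g} = P(df, dg)\<close> on smooth functions
  satisfies the Jacobi identity.\<close>

definition poisson_bracket :: "('m, 'e::euclidean_space) atlas \<Rightarrow> 'm tensor2 \<Rightarrow>
    ('m \<Rightarrow> real) \<Rightarrow> ('m \<Rightarrow> real) \<Rightarrow> 'm \<Rightarrow> real" where
  "poisson_bracket A P f g = (\<lambda>p. P p (differential A f p) (differential A g p))"

definition poisson_tensor :: "('m, 'e::euclidean_space) atlas \<Rightarrow> 'm tensor2 \<Rightarrow> bool" where
  "poisson_tensor A P \<longleftrightarrow> bivector_field A P \<and>
     (\<forall>f g k. smooth_fun A f \<longrightarrow> smooth_fun A g \<longrightarrow> smooth_fun A k \<longrightarrow> (\<forall>p\<in>points A.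
        poisson_bracket A P f (poisson_bracket A P g k) p +
        poisson_bracket A P g (poisson_bracket A P k f) p +
        poisson_bracket A P k (poisson_bracket A P f g) p = 0))"


section \<open>Affine manifolds and contravariant pseudo-Hessian structures\<close>

type_synonym 'm conn = "'m vfield \<Rightarrow> 'm vfield \<Rightarrow> 'm vfield"

text \<open>\<open>D X Y\<close> is \<open>\<nabla>\<^sub>X Y\<close>; only its values on smooth vector fields matter.\<close>

definition connection :: "('m, 'e::euclidean_space) atlas \<Rightarrow> 'm conn \<Rightarrow> bool" where
  "connection A D \<longleftrightarrow>
     (\<forall>X Y. vector_field A X \<longrightarrow> vector_field A Y \<longrightarrow> vector_field A (D X Y)) \<and>
     (\<forall>X Y Z. vector_field A X \<longrightarrow> vector_field A Y \<longrightarrow> vector_field A Z \<longrightarrow>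
        D (vf_add X Y) Z = vf_add (D X Z) (D Y Z) \<and>
        D X (vf_add Y Z) = vf_add (D X Y) (D X Z)) \<and>
     (\<forall>f X Y. smooth_fun A f \<longrightarrow> vector_field A X \<longrightarrow> vector_field A Y \<longrightarrow>
        D (vf_mult f X) Y = vf_mult f (D X Y) \<and>
        D X (vf_mult f Y) = vf_add (vf_mult (\<lambda>p. X p f) Y) (vf_mult f (D X Y)))"

definition torsion_free :: "('m, 'e::euclidean_space) atlas \<Rightarrow> 'm conn \<Rightarrow> bool" where
  "torsion_free A D \<longleftrightarrow> (\<forall>X Y. vector_field A X \<longrightarrow> vector_field A Y \<longrightarrow>
     vf_diff (D X Y) (D Y X) = lie_bracket A X Y)"

definition flat :: "('m, 'e::euclidean_space) atlas \<Rightarrow> 'm conn \<Rightarrow> bool" where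
  "flat A D \<longleftrightarrow> (\<forall>X Y Z. vector_field A X \<longrightarrow> vector_field A Y \<longrightarrow> vector_field A Z \<longrightarrow>
     vf_diff (D X (D Y Z)) (D Y (D X Z)) = D (lie_bracket A X Y) Z)"

definition affine_manifold :: "('m, 'e::euclidean_space) atlas \<Rightarrow> 'm conn \<Rightarrow> bool" where
  "affine_manifold A D \<longleftrightarrow>
     smooth_manifold A \<and> connection A D \<and> torsion_free A D \<and> flat A D"

text \<open>\<open>h\<^sub>#(\<alpha>)\<close>, determined by \<open>\<beta>(h\<^sub>#(\<alpha>)) = h(\<alpha>, \<beta>)\<close>.\<close>

definition sharp :: "('m, 'e::euclidean_space) atlas \<Rightarrow> 'm tensor2 \<Rightarrow> 'm form \<Rightarrow> 'm vfield" where
  "sharp A h \<alpha> = (\<lambda>p. if p \<in> points A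
     then (THE v. v \<in> tangent_space A p \<and> (\<forall>b\<in>cotangent_space A p. b v = h p (\<alpha> p) b))
     else (\<lambda>_. 0))"

text \<open>\<open>(\<nabla>\<^sub>X \<alpha>)(Y) = X(\<alpha>(Y)) - \<alpha>(\<nabla>\<^sub>X Y)\<close> for all vector fields \<open>Y\<close>.\<close>

definition nabla_form :: "('m, 'e::euclidean_space) atlas \<Rightarrow> 'm conn \<Rightarrow> 'm vfield \<Rightarrow> 'm form \<Rightarrow> 'm form" where
  "nabla_form A D X \<alpha> = (\<lambda>p. THE a. a \<in> cotangent_space A p \<and>
     (\<forall>Y. vector_field A Y \<longrightarrow> a (Y p) = X p (\<lambda>q. \<alpha> q (Y q)) - \<alpha> p (D X Y p)))"

text \<open>The function \<open>(\<nabla>\<^sub>X h)(\<beta>, \<gamma>) = X(h(\<beta>, \<gamma>)) - h(\<nabla>\<^sub>X \<beta>, \<gamma>) - h(\<beta>, \<nabla>\<^sub>X \<gamma>)\<close>.\<close>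

definition nabla_tensor2 :: "('m, 'e::euclidean_space) atlas \<Rightarrow> 'm conn \<Rightarrow> 'm vfield \<Rightarrow> 'm tensor2 \<Rightarrow>
    'm form \<Rightarrow> 'm form \<Rightarrow> 'm \<Rightarrow> real" where
  "nabla_tensor2 A D X h \<beta> \<gamma> = (\<lambda>p. X p (\<lambda>q. h q (\<beta> q) (\<gamma> q))
     - h p (nabla_form A D X \<beta> p) (\<gamma> p) - h p (\<beta> p) (nabla_form A D X \<gamma> p))"

definition contravariant_pseudo_hessian ::
    "('m, 'e::euclidean_space) atlas \<Rightarrow> 'm conn \<Rightarrow> 'm tensor2 \<Rightarrow> bool" where
  "contravariant_pseudo_hessian A D h \<longleftrightarrow>
     affine_manifold A D \<and> symmetric_bivector_field A h \<and>
     (\<forall>\<alpha> \<beta> \<gamma>. one_form A \<alpha> \<longrightarrow> one_form A \<beta> \<longrightarrow> one_form A \<gamma> \<longrightarrow> (\<forall>p\<in>points A.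
        nabla_tensor2 A D (sharp A h \<alpha>) h \<beta> \<gamma> p = nabla_tensor2 A D (sharp A h \<beta>) h \<alpha> \<gamma> p))"


section \<open>The tangent bundle, lifts, and the associated bivector field\<close>

text \<open>The chart \<open>(U, \<phi>)\<close> induces the chart \<open>(p, v) \<mapsto> (\<phi>(p), d\<phi>(v))\<close> over \<open>U\<close>; the components of
  \<open>d\<phi>(v)\<close> are the values of \<open>v\<close> on the coordinate functions.\<close>

definition tangent_bundle ::
    "('m, 'e::euclidean_space) atlas \<Rightarrow> ('m \<times> 'm tvec, 'e \<times> 'e) atlas" where
  "tangent_bundle A = (\<lambda>(U, \<phi>).
     (Sigma U (tangent_space A),
      \<lambda>(p, v). (\<phi> p, \<Sum>b\<in>Basis. v (\<lambda>q. \<phi> q \<bullet> b) *\<^sub>R b))) ` A"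

text \<open>The tangent map of \<open>F\<close> into the manifold \<open>B\<close>, applied to a tangent vector \<open>v\<close> at \<open>p\<close>.\<close>

definition tangent_map :: "('n, 'e::euclidean_space) atlas \<Rightarrow> ('m \<Rightarrow> 'n) \<Rightarrow> 'm \<Rightarrow> 'm tvec \<Rightarrow> 'n tvec" where
  "tangent_map B F p v = (\<lambda>f. if f \<in> smooth_near B (F p) then v (f \<circ> F) else 0)"

text \<open>The vertical lift of \<open>X\<close> at \<open>z = (p, v)\<close> is the velocity at \<open>t = 0\<close> of \<open>t \<mapsto> (p, v + t X\<^sub>p)\<close>.\<close>

definition vlift :: "('m, 'e::euclidean_space) atlas \<Rightarrow> 'm vfield \<Rightarrow> ('m \<times> 'm tvec) vfield" where
  "vlift A X = (\<lambda>(p, v) F.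
     if (p, v) \<in> points (tangent_bundle A) \<and> F \<in> smooth_near (tangent_bundle A) (p, v)
     then deriv (\<lambda>t. F (p, \<lambda>f. v f + t * X p f)) 0 else 0)"

text \<open>A vector at \<open>z = (p, v)\<close> is horizontal if it is the image of some \<open>Y\<^sub>p\<close> under a section \<open>\<sigma>\<close> with
  \<open>\<sigma>(p) = v\<close> that is infinitesimally parallel in that direction: \<open>(\<nabla>\<^sub>Y \<sigma>)(p) = 0\<close>.\<close>

definition horizontal_space :: "('m, 'e::euclidean_space) atlas \<Rightarrow> 'm conn \<Rightarrow>
    'm \<times> 'm tvec \<Rightarrow> ('m \<times> 'm tvec) tvec set" where
  "horizontal_space A D z =
     {tangent_map (tangent_bundle A) (\<lambda>q. (q, \<sigma> q)) (fst z) (Y (fst z)) | Y \<sigma>.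
        vector_field A Y \<and> vector_field A \<sigma> \<and> \<sigma> (fst z) = snd z \<and> D Y \<sigma> (fst z) = (\<lambda>_. 0)}"

definition hlift :: "('m, 'e::euclidean_space) atlas \<Rightarrow> 'm conn \<Rightarrow> 'm vfield \<Rightarrow> ('m \<times> 'm tvec) vfield" where
  "hlift A D X = (\<lambda>z. if z \<in> points (tangent_bundle A)
     then (THE w. w \<in> horizontal_space A D z \<and> tangent_map A fst z w = X (fst z))
     else (\<lambda>_. 0))"

definition vlift_form :: "('m, 'e::euclidean_space) atlas \<Rightarrow> 'm conn \<Rightarrow> 'm form \<Rightarrow> ('m \<times> 'm tvec) form" where
  "vlift_form A D \<alpha> = (\<lambda>z. THE a. a \<in> cotangent_space (tangent_bundle A) z \<and>
     (\<forall>X. vector_field A X \<longrightarrow> a (vlift A X z) = \<alpha> (fst z) (X (fst z)) \<and> a (hlift A D X z) = 0))"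

definition hlift_form :: "('m, 'e::euclidean_space) atlas \<Rightarrow> 'm conn \<Rightarrow> 'm form \<Rightarrow> ('m \<times> 'm tvec) form" where
  "hlift_form A D \<alpha> = (\<lambda>z. THE a. a \<in> cotangent_space (tangent_bundle A) z \<and>
     (\<forall>X. vector_field A X \<longrightarrow> a (hlift A D X z) = \<alpha> (fst z) (X (fst z)) \<and> a (vlift A X z) = 0))"

text \<open>\<open>P\<close> is the bivector field on the tangent bundle associated to \<open>h\<close>. As the lifted forms span
  each cotangent space, \<open>P\<close> is determined on covectors by these conditions.\<close>

definition associated_bivector :: "('m, 'e::euclidean_space) atlas \<Rightarrow> 'm conn \<Rightarrow> 'm tensor2 \<Rightarrow>
    ('m \<times> 'm tvec) tensor2 \<Rightarrow> bool" where
  "associated_bivector A D h P \<longleftrightarrow> bivector_field (tangent_bundle A) P \<and>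
     (\<forall>\<alpha> \<beta>. one_form A \<alpha> \<longrightarrow> one_form A \<beta> \<longrightarrow> (\<forall>z\<in>points (tangent_bundle A).
        P z (vlift_form A D \<alpha> z) (vlift_form A D \<beta> z) = 0 \<and>
        P z (hlift_form A D \<alpha> z) (hlift_form A D \<beta> z) = 0 \<and>
        P z (hlift_form A D \<alpha> z) (vlift_form A D \<beta> z) = h (fst z) (\<alpha> (fst z)) (\<beta> (fst z)) \<and>
        P z (vlift_form A D \<beta> z) (hlift_form A D \<alpha> z) = - h (fst z) (\<alpha> (fst z)) (\<beta> (fst z))))"


section \<open>Left symmetric algebras and symmetric 2-tensors\<close>

definition left_symmetric_algebra :: "('g::real_vector \<Rightarrow> 'g \<Rightarrow> 'g) \<Rightarrow> bool" where
  "left_symmetric_algebra m \<longleftrightarrow> bilinear m \<and>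
     (\<forall>u v w. m (m u v) w - m u (m v w) = m (m v u) w - m v (m u w))"

text \<open>An element of \<open>\<gg> \<otimes> \<gg>\<close> is represented by the bilinear form it defines on the dual space
  \<open>\<gg>\<^sup>*\<close>, whose elements are the linear functionals on \<open>\<gg>\<close>; values of the form on other HOL
  functions are irrelevant.\<close>

type_synonym 'g dual_form = "('g \<Rightarrow> real) \<Rightarrow> ('g \<Rightarrow> real) \<Rightarrow> real"

definition symmetric_tensor :: "'g::real_vector dual_form \<Rightarrow> bool" where
  "symmetric_tensor r \<longleftrightarrow>
     (\<forall>\<alpha> \<beta> \<gamma> s t. linear \<alpha> \<longrightarrow> linear \<beta> \<longrightarrow> linear \<gamma> \<longrightarrow>
        r (\<lambda>u. s * \<alpha> u + t * \<beta> u) \<gamma> = s * r \<alpha> \<gamma> + t * r \<beta> \<gamma>) \<and>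
     (\<forall>\<alpha> \<beta>. linear \<alpha> \<longrightarrow> linear \<beta> \<longrightarrow> r \<alpha> \<beta> = r \<beta> \<alpha>)"

text \<open>\<open>r\<^sub>#\<close>, determined by \<open>\<langle>\<beta>, r\<^sub>#(\<alpha>)\<rangle> = r(\<alpha>, \<beta>)\<close>.\<close>

definition tensor_sharp :: "'g::real_vector dual_form \<Rightarrow> ('g \<Rightarrow> real) \<Rightarrow> 'g" where
  "tensor_sharp r \<alpha> = (THE u. \<forall>\<beta>. linear \<beta> \<longrightarrow> \<beta> u = r \<alpha> \<beta>)"

definition left_coaction :: "('g::real_vector \<Rightarrow> 'g \<Rightarrow> 'g) \<Rightarrow> 'g \<Rightarrow> ('g \<Rightarrow> real) \<Rightarrow> ('g \<Rightarrow> real)" where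
  "left_coaction m u \<alpha> = (\<lambda>v. - \<alpha> (m u v))"

text \<open>The expression \<open>[[r, r]](\<alpha>, \<beta>, \<gamma>)\<close>.\<close>

definition tensor_bracket :: "('g::real_vector \<Rightarrow> 'g \<Rightarrow> 'g) \<Rightarrow> 'g dual_form \<Rightarrow>
    ('g \<Rightarrow> real) \<Rightarrow> ('g \<Rightarrow> real) \<Rightarrow> ('g \<Rightarrow> real) \<Rightarrow> real" where
  "tensor_bracket m r \<alpha> \<beta> \<gamma> =
     (let a = tensor_sharp r \<alpha>; b = tensor_sharp r \<beta> in
      \<gamma> (tensor_sharp r (\<lambda>v. left_coaction m a \<beta> v - left_coaction m b \<alpha> v) - (m a b - m b a)))"

text \<open>The restrictions of a functional on \<open>\<gg> \<times> \<gg>\<close> to the two factors are its components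
  \<open>(\<alpha>, \<beta>)\<close> in \<open>\<gg>\<^sup>* \<times> \<gg>\<^sup>*\<close>.\<close>

definition double_tensor :: "'g::real_vector dual_form \<Rightarrow> ('g \<times> 'g) dual_form" where
  "double_tensor r A1 A2 =
     r (\<lambda>u. A1 (u, 0)) (\<lambda>v. A2 (0, v)) - r (\<lambda>u. A2 (u, 0)) (\<lambda>v. A1 (0, v))"

text \<open>\<open>\<rho>(T) = \<Sum> T\<^sub>i\<^sub>j \<rho>(e\<^sub>i) \<otimes> \<rho>(e\<^sub>j)\<close>, where \<open>T\<^sub>i\<^sub>j = T(e\<^sub>i\<^sup>*, e\<^sub>j\<^sup>*)\<close>. The inner product only serves
  to name the dual basis: \<open>e\<^sub>i\<^sup>* = (\<lambda>u. u \<bullet> e\<^sub>i)\<close>.\<close>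

definition push_tensor :: "('g::euclidean_space \<Rightarrow> 'm vfield) \<Rightarrow> 'g dual_form \<Rightarrow> 'm tensor2" where
  "push_tensor \<rho> T = (\<lambda>p a b. \<Sum>i\<in>Basis. \<Sum>j\<in>Basis.
     T (\<lambda>u. u \<bullet> i) (\<lambda>u. u \<bullet> j) * (a (\<rho> i p) * b (\<rho> j p)))"

definition linear_into_fields ::
    "('m, 'e::euclidean_space) atlas \<Rightarrow> ('g::real_vector \<Rightarrow> 'm vfield) \<Rightarrow> bool" where
  "linear_into_fields A \<rho> \<longleftrightarrow> (\<forall>u. vector_field A (\<rho> u)) \<and>
     (\<forall>u v. \<rho> (u + v) = vf_add (\<rho> u) (\<rho> v)) \<and>
     (\<forall>c u. \<rho> (c *\<^sub>R u) = vf_mult (\<lambda>_. c) (\<rho> u))"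

definition lifted_map :: "('m, 'e::euclidean_space) atlas \<Rightarrow> 'm conn \<Rightarrow> ('g \<Rightarrow> 'm vfield) \<Rightarrow>
    'g \<times> 'g \<Rightarrow> ('m \<times> 'm tvec) vfield" where
  "lifted_map A D \<rho> = (\<lambda>(u, v). vf_add (hlift A D (\<rho> u)) (vlift A (\<rho> v)))"

end

theory Submission
  imports Defs
begin

text \<open>A tangent vector of \<open>TM\<close> at \<open>(p, v)\<close> is determined by its values on functions pulled back from \<open>M\<close>
  and on the fibrewise linear functions \<open>\<ell>\<^sub>f(q, u) = u f\<close>. If \<open>\<sigma>\<close> is a vector field with \<open>\<sigma>(p) = v\<close> and
  \<open>\<nabla>\<^sub>X \<sigma> = 0\<close> at \<open>p\<close>, then \<open>X\<^sup>h F (p, v) = X\<^sub>p(F \<circ> \<sigma>)\<close>; since \<open>\<nabla>\<close> is torsion-free this gives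
  \<open>X\<^sup>h \<ell>\<^sub>f (p, v) = v(X f) - (\<nabla>\<^sub>v X) f\<close>, without Christoffel symbols or affine coordinates. Flatness then yields
  \<open>[X\<^sup>h, Y\<^sup>h] = [X, Y]\<^sup>h\<close>, \<open>[X\<^sup>h, Y\<^sup>v] = (\<nabla>\<^sub>X Y)\<^sup>v\<close> and \<open>[X\<^sup>v, Y\<^sup>v] = 0\<close>.

  Fix a point \<open>z\<close> of \<open>TM\<close> and put \<open>a\<^sub>F(u) = \<rho>(u)\<^sup>h F\<close>, \<open>b\<^sub>F(u) = \<rho>(u)\<^sup>v F\<close> at \<open>z\<close>, \<open>x\<^sub>F = r\<^sub>#(a\<^sub>F)\<close> and
  \<open>y\<^sub>F = r\<^sub>#(b\<^sub>F)\<close>. Then \<open>{F, G} = \<rho>(x\<^sub>F)\<^sup>v G - \<rho>(y\<^sub>F)\<^sup>h G\<close> at \<open>z\<close>, and the commutators reduce the Jacobiator of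
  \<open>F, G, K\<close> to the cyclic sum of \<open>a\<^sub>K([y\<^sub>F, y\<^sub>G]) + b\<^sub>K(y\<^sub>G \<bullet> x\<^sub>F - y\<^sub>F \<bullet> x\<^sub>G)\<close>, which vanishes by \<open>[[r, r]] = 0\<close>.
  In the same way \<open>(\<nabla>\<^bsub>h\<^sub>#(\<alpha>)\<^esub> h)(\<beta>, \<gamma>) = b(x \<bullet> r\<^sub>#(c)) + c(x \<bullet> r\<^sub>#(b))\<close> with \<open>x = r\<^sub>#(a)\<close>, where \<open>a, b, c\<close> are
  \<open>\<alpha>, \<beta>, \<gamma>\<close> composed with \<open>\<rho>\<close>, and \<open>[[r, r]] = 0\<close> is its symmetry in \<open>\<alpha>, \<beta>\<close>.\<close>


section \<open>Calculus of smooth maps\<close>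

text \<open>Two features of the definitions shape the proof. A connection acts only on globally
  defined smooth fields, so its locality has to be derived: a cutoff \<open>\<kappa>\<close> equal
  to 1 near a point makes coordinates and coordinate fields global, and \<open>\<kappa>\<close>
  times a field becomes a global combination to which the axioms apply. And \<open>sharp\<close>,
  \<open>nabla_form\<close>, \<open>hlift\<close> and the lifted forms are definite descriptions, so
  each needs existence and uniqueness before anything can be computed with it.

  A section that is parallel along X at p serves only one outermost derivative: nothing is known of
  it nearby or along another field. In X^h (Y^h F) only the outer lift is therefore evaluated by
  restriction to \<sigma>; the inner one is evaluated by the closed formula, with \<sigma> itself as
  the extension of the vector.

  The coefficients of r are constants, so a derivative of a pushed-forward tensor falls only on
  fields and functions. Freezing the undifferentiated factors at one point turns both conclusions
  into identities for linear functionals on the algebra.\<close>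

lemma Ck_on_subset: "Ck_on k S f \<Longrightarrow> T \<subseteq> S \<Longrightarrow> Ck_on k T f"
  by (induction k arbitrary: f) (auto intro: continuous_on_subset)

lemma Ck_on_Suc_imp: "Ck_on (Suc k) S f \<Longrightarrow> Ck_on k S f"
proof (induction k arbitrary: f)
  case 0
  then show ?case
    by (auto intro!: continuous_at_imp_continuous_on differentiable_imp_continuous_within)
next
  case (Suc k)
  show ?case
    using Suc.IH Suc.prems by (metis Ck_on.simps(2))
qed

lemma frechet_derivative_at_eq: "(f has_derivative f') (at x) \<Longrightarrow> frechet_derivative f (at x) = f'"
  using frechet_derivative_at by metis

text \<open>Openness of \<open>S\<close> lets equality on \<open>S\<close> carry over to
  derivatives. The closure rules below compute a derivative by a formula and transfer its regularity
  through this rule.\<close>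

lemma Ck_on_cong:
  assumes "open S" and "\<And>x. x \<in> S \<Longrightarrow> f x = g x" and "Ck_on k S f"
  shows "Ck_on k S g"
  using assms(2,3)
proof (induction k arbitrary: f g)
  case 0
  then show ?case using continuous_on_cong[of S S f g] by simp
next
  case (Suc k)
  have der: "(g has_derivative frechet_derivative f (at x)) (at x)" if "x \<in> S" for x
    using has_derivative_transform_within_open[OF _ assms(1) that, of f _ UNIV g] Suc.prems that
    by (metis Ck_on.simps(2) frechet_derivative_works)
  have "Ck_on k S (\<lambda>x. frechet_derivative g (at x) v)" for v
    by (rule Suc.IH[of "\<lambda>x. frechet_derivative f (at x) v"])
      (use Suc.prems frechet_derivative_at_eq[OF der] in auto)
  then show ?case using der by (auto simp: differentiable_def)
qed

lemma Ck_on_const: "Ck_on k S (\<lambda>x. c)"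
  by (induction k arbitrary: c) auto

lemma Ck_on_bounded_linear_compose:
  assumes "bounded_linear L" "open S" "Ck_on k S f"
  shows "Ck_on k S (\<lambda>x. L (f x))"
  using assms(3)
proof (induction k arbitrary: f)
  case 0
  then show ?case using bounded_linear.continuous_on[OF assms(1)] by auto
next
  case (Suc k)
  have der: "((\<lambda>x. L (f x)) has_derivative (\<lambda>v. L (frechet_derivative f (at x) v))) (at x)"
    if "x \<in> S" for x
    using bounded_linear.has_derivative[OF assms(1)] Suc.prems that
    by (metis Ck_on.simps(2) frechet_derivative_works)
  have "Ck_on k S (\<lambda>x. frechet_derivative (\<lambda>x. L (f x)) (at x) v)" for v
    by (rule Ck_on_cong[OF assms(2), of "\<lambda>x. L (frechet_derivative f (at x) v)"])
      (use Suc frechet_derivative_at_eq[OF der] in auto)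
  then show ?case using der by (auto simp: differentiable_def)
qed

lemma Ck_on_bounded_linear: "bounded_linear L \<Longrightarrow> Ck_on k S L"
proof (cases k)
  case (Suc j)
  assume L: "bounded_linear L"
  then show ?thesis
    using frechet_derivative_at_eq[OF bounded_linear_imp_has_derivative[OF L]]
    by (auto simp: Suc Ck_on_const intro!: bounded_linear_imp_differentiable)
qed (use linear_continuous_on in auto)

lemma Ck_on_add:
  assumes "open S" "Ck_on k S f" "Ck_on k S g"
  shows "Ck_on k S (\<lambda>x. f x + g x)"
  using assms(2,3)
proof (induction k arbitrary: f g)
  case 0
  then show ?case by (auto intro: continuous_intros)
next
  case (Suc k)
  have der: "((\<lambda>x. f x + g x) has_derivative
      (\<lambda>v. frechet_derivative f (at x) v + frechet_derivative g (at x) v)) (at x)" if "x \<in> S" for x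
    using Suc.prems that by (intro has_derivative_add) (auto simp: frechet_derivative_works[symmetric])
  have "Ck_on k S (\<lambda>x. frechet_derivative (\<lambda>x. f x + g x) (at x) v)" for v
    by (rule Ck_on_cong[OF assms(1), of "\<lambda>x. frechet_derivative f (at x) v + frechet_derivative g (at x) v"])
      (use Suc frechet_derivative_at_eq[OF der] in auto)
  then show ?case using der by (auto simp: differentiable_def)
qed

lemma Ck_on_sum:
  assumes "open S" "\<And>i. i \<in> I \<Longrightarrow> Ck_on k S (f i)"
  shows "Ck_on k S (\<lambda>x. \<Sum>i\<in>I. f i x)"
proof (cases "finite I")
  case True
  then show ?thesis using assms(2)
    by (induction I) (auto intro!: Ck_on_const Ck_on_add assms(1))
qed (simp add: Ck_on_const)

lemma Ck_on_bilinear: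
  assumes b: "bounded_bilinear b" and S: "open S" and "Ck_on k S f" "Ck_on k S g"
  shows "Ck_on k S (\<lambda>x. b (f x) (g x))"
  using assms(3,4)
proof (induction k arbitrary: f g)
  case 0
  then show ?case using bounded_bilinear.continuous_on[OF b] by auto
next
  case (Suc k)
  have der: "((\<lambda>x. b (f x) (g x)) has_derivative
      (\<lambda>v. b (f x) (frechet_derivative g (at x) v) + b (frechet_derivative f (at x) v) (g x))) (at x)"
    if "x \<in> S" for x
    using Suc.prems that
    by (intro bounded_bilinear.FDERIV[OF b]) (auto simp: frechet_derivative_works[symmetric])
  have "Ck_on k S (\<lambda>x. frechet_derivative (\<lambda>x. b (f x) (g x)) (at x) v)" for v
  proof (rule Ck_on_cong[OF S])
    show "Ck_on k S (\<lambda>x. b (f x) (frechet_derivative g (at x) v)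
        + b (frechet_derivative f (at x) v) (g x))"
      using Suc.prems Ck_on_Suc_imp[OF Suc.prems(1)] Ck_on_Suc_imp[OF Suc.prems(2)]
      by (intro Ck_on_add[OF S] Suc.IH) auto
  qed (use frechet_derivative_at_eq[OF der] in auto)
  then show ?case using der by (auto simp: differentiable_def)
qed

lemma linear_expand_Basis:
  fixes L :: "'a::euclidean_space \<Rightarrow> 'b::real_vector"
  assumes "linear L"
  shows "L v = (\<Sum>b\<in>Basis. (v \<bullet> b) *\<^sub>R L b)"
proof -
  have "L v = L (\<Sum>b\<in>Basis. (v \<bullet> b) *\<^sub>R b)" by (simp add: euclidean_representation)
  also have "\<dots> = (\<Sum>b\<in>Basis. (v \<bullet> b) *\<^sub>R L b)"
    by (simp add: linear_sum[OF assms] linear_cmul[OF assms])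
  finally show ?thesis .
qed

text \<open>\<open>Ck_on\<close> controls derivatives of \<open>g\<close> only in fixed directions,
  while the chain rule produces the direction \<open>frechet_derivative f (at x) v\<close>, which
  moves with \<open>x\<close>. Expanding it in a basis of the middle space leaves finitely many
  products of a component and a derivative in a fixed direction, to which the induction hypothesis
  applies.\<close>

lemma Ck_on_compose:
  fixes f :: "'a::real_normed_vector \<Rightarrow> 'b::euclidean_space"
  assumes S: "open S" and "Ck_on k S f" "Ck_on k T g" and sub: "f ` S \<subseteq> T"
  shows "Ck_on k S (\<lambda>x. g (f x))"
  using assms(2,3)
proof (induction k arbitrary: g)
  case 0
  then show ?case using sub by (auto intro: continuous_on_compose2)
next
  case (Suc k)
  have df: "(f has_derivative frechet_derivative f (at x)) (at x)" if "x \<in> S" for x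
    using Suc.prems that by (auto simp: frechet_derivative_works[symmetric])
  have dg: "(g has_derivative frechet_derivative g (at (f x))) (at (f x))" if "x \<in> S" for x
    using Suc.prems that sub by (auto simp: frechet_derivative_works[symmetric])
  have der: "((\<lambda>x. g (f x)) has_derivative
      (\<lambda>v. \<Sum>b\<in>Basis. (frechet_derivative f (at x) v \<bullet> b) *\<^sub>R frechet_derivative g (at (f x)) b)) (at x)"
    if "x \<in> S" for x
  proof -
    have "((\<lambda>x. g (f x)) has_derivative
        (\<lambda>v. frechet_derivative g (at (f x)) (frechet_derivative f (at x) v))) (at x)"
      using has_derivative_compose[OF df dg] that by simp
    then show ?thesis
      by (subst (asm) linear_expand_Basis[OF has_derivative_linear[OF dg[OF that]]])
  qed
  have "Ck_on k S (\<lambda>x. frechet_derivative (\<lambda>x. g (f x)) (at x) v)" for v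
  proof (rule Ck_on_cong[OF S])
    show "Ck_on k S (\<lambda>x. \<Sum>b\<in>Basis.
        (frechet_derivative f (at x) v \<bullet> b) *\<^sub>R frechet_derivative g (at (f x)) b)"
    proof (intro Ck_on_sum[OF S] Ck_on_bilinear[OF bounded_bilinear_scaleR S])
      fix b :: 'b
      show "Ck_on k S (\<lambda>x. frechet_derivative f (at x) v \<bullet> b)"
        using Suc.prems by (intro Ck_on_bounded_linear_compose[OF bounded_linear_inner_left S]) auto
      show "Ck_on k S (\<lambda>x. frechet_derivative g (at (f x)) b)"
        using Suc.prems Ck_on_Suc_imp[OF Suc.prems(1)] by (intro Suc.IH) auto
    qed
  qed (use frechet_derivative_at_eq[OF der] in auto)
  then show ?case using der by (auto simp: differentiable_def)
qed

lemma Ck_on_local: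
  assumes "\<And>x. x \<in> S \<Longrightarrow> \<exists>W. open W \<and> x \<in> W \<and> Ck_on k W f"
  shows "Ck_on k S f"
  using assms
proof (induction k arbitrary: f)
  case 0
  show ?case
    unfolding Ck_on.simps
  proof (rule continuous_at_imp_continuous_on, rule ballI)
    fix x assume "x \<in> S"
    then obtain W where "open W" "x \<in> W" "continuous_on W f" using 0 by auto
    then show "isCont f x" by (simp add: continuous_on_eq_continuous_at)
  qed
next
  case (Suc k)
  have "f differentiable (at x)" if "x \<in> S" for x using Suc.prems[OF that] by auto
  moreover have "Ck_on k S (\<lambda>x. frechet_derivative f (at x) v)" for v
  proof (rule Suc.IH)
    fix x assume "x \<in> S"
    then show "\<exists>W. open W \<and> x \<in> W \<and> Ck_on k W (\<lambda>x. frechet_derivative f (at x) v)"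
      using Suc.prems by (metis Ck_on.simps(2))
  qed
  ultimately show ?case by simp
qed


section \<open>Smoothness at a point\<close>

text \<open>A condition on a whole neighbourhood, but an unspecified one: sums, products and
  composites then need no common domain to be carried along.\<close>

definition smooth_at :: "('a::real_normed_vector \<Rightarrow> 'b::real_normed_vector) \<Rightarrow> 'a \<Rightarrow> bool" where
  "smooth_at f x \<longleftrightarrow> (\<exists>W. open W \<and> x \<in> W \<and> smooth_on W f)"

lemma smooth_on_subset: "smooth_on S f \<Longrightarrow> T \<subseteq> S \<Longrightarrow> smooth_on T f"
  by (auto simp: smooth_on_def intro: Ck_on_subset)

lemma smooth_on_imp_smooth_at: "smooth_on S f \<Longrightarrow> open S \<Longrightarrow> x \<in> S \<Longrightarrow> smooth_at f x"
  by (auto simp: smooth_at_def)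

lemma smooth_onI: "(\<And>x. x \<in> S \<Longrightarrow> smooth_at f x) \<Longrightarrow> smooth_on S f"
  unfolding smooth_on_def
proof
  fix k assume *: "\<And>x. x \<in> S \<Longrightarrow> smooth_at f x"
  show "Ck_on k S f"
    by (rule Ck_on_local) (use * in \<open>auto simp: smooth_at_def smooth_on_def\<close>)
qed

lemma smooth_on_imp_Ck_on: "smooth_on S f \<Longrightarrow> Ck_on k S f"
  by (simp add: smooth_on_def)

lemma smooth_on_differentiable: "smooth_on S f \<Longrightarrow> x \<in> S \<Longrightarrow> f differentiable (at x)"
  using smooth_on_imp_Ck_on[of S f "Suc 0"] by simp

lemma smooth_on_frechet_derivative:
  "smooth_on S f \<Longrightarrow> smooth_on S (\<lambda>x. frechet_derivative f (at x) v)"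
proof -
  assume "smooth_on S f"
  then have "Ck_on (Suc k) S f" for k by (rule smooth_on_imp_Ck_on)
  then show ?thesis by (simp add: smooth_on_def)
qed

lemma smooth_at_cong:
  assumes "smooth_at f x" and "eventually (\<lambda>y. f y = g y) (nhds x)"
  shows "smooth_at g x"
proof -
  obtain W where W: "open W" "x \<in> W" "smooth_on W f" using assms(1) by (auto simp: smooth_at_def)
  obtain V where V: "open V" "x \<in> V" "\<And>y. y \<in> V \<Longrightarrow> f y = g y"
    using assms(2) by (auto simp: eventually_nhds)
  have "smooth_on (W \<inter> V) g"
    unfolding smooth_on_def
  proof
    fix k
    show "Ck_on k (W \<inter> V) g"
      by (rule Ck_on_cong[of _ f]) (use V W in \<open>auto simp: smooth_on_def intro: Ck_on_subset\<close>)
  qed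
  then show ?thesis using V W by (auto simp: smooth_at_def)
qed

lemma smooth_at_eventually:
  assumes "smooth_at f x"
  shows "eventually (smooth_at f) (nhds x)"
  using assms by (auto simp: smooth_at_def eventually_nhds)

lemma smooth_at_differentiable: "smooth_at f x \<Longrightarrow> f differentiable (at x)"
  by (auto simp: smooth_at_def intro: smooth_on_differentiable)

lemma smooth_at_has_derivative:
  "smooth_at f x \<Longrightarrow> (f has_derivative frechet_derivative f (at x)) (at x)"
  using smooth_at_differentiable frechet_derivative_works by blast

lemma smooth_at_isCont: "smooth_at f x \<Longrightarrow> isCont f x"
  by (simp add: differentiable_imp_continuous_within smooth_at_differentiable)

lemma smooth_at_frechet_derivative:
  "smooth_at f x \<Longrightarrow> smooth_at (\<lambda>x. frechet_derivative f (at x) v) x"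
  by (auto simp: smooth_at_def intro: smooth_on_frechet_derivative)

lemma smooth_at_const [simp, intro]: "smooth_at (\<lambda>x. c) x"
  unfolding smooth_at_def smooth_on_def using Ck_on_const by blast

lemma smooth_at_bounded_linear: "bounded_linear L \<Longrightarrow> smooth_at L x"
  unfolding smooth_at_def smooth_on_def using Ck_on_bounded_linear by blast

lemma smooth_at_bounded_linear_compose:
  assumes "bounded_linear L" "smooth_at f x"
  shows "smooth_at (\<lambda>x. L (f x)) x"
proof -
  obtain W where W: "open W" "x \<in> W" "smooth_on W f" using assms(2) by (auto simp: smooth_at_def)
  then have "smooth_on W (\<lambda>x. L (f x))"
    using Ck_on_bounded_linear_compose[OF assms(1) W(1)] by (simp add: smooth_on_def)
  then show ?thesis using W by (auto simp: smooth_at_def)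
qed

lemma smooth_at_bilinear:
  assumes "bounded_bilinear b" "smooth_at f x" "smooth_at g x"
  shows "smooth_at (\<lambda>x. b (f x) (g x)) x"
proof -
  obtain W where W: "open W" "x \<in> W" "smooth_on W f" using assms(2) by (auto simp: smooth_at_def)
  obtain V where V: "open V" "x \<in> V" "smooth_on V g" using assms(3) by (auto simp: smooth_at_def)
  have "smooth_on (W \<inter> V) (\<lambda>x. b (f x) (g x))"
    unfolding smooth_on_def using V W
    by (auto simp: smooth_on_def intro!: Ck_on_bilinear[OF assms(1)] intro: Ck_on_subset)
  then show ?thesis using V W by (auto simp: smooth_at_def)
qed

lemmas smooth_at_mult [intro] = smooth_at_bilinear[OF bounded_bilinear_mult]
lemmas smooth_at_scaleR [intro] = smooth_at_bilinear[OF bounded_bilinear_scaleR]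
lemmas smooth_at_inner [intro] = smooth_at_bilinear[OF bounded_bilinear_inner]

lemma smooth_at_add [intro]:
  assumes "smooth_at f x" "smooth_at g x"
  shows "smooth_at (\<lambda>x. f x + g x) x"
proof -
  obtain W where W: "open W" "x \<in> W" "smooth_on W f" using assms(1) by (auto simp: smooth_at_def)
  obtain V where V: "open V" "x \<in> V" "smooth_on V g" using assms(2) by (auto simp: smooth_at_def)
  have "smooth_on (W \<inter> V) (\<lambda>x. f x + g x)"
    unfolding smooth_on_def using V W
    by (auto simp: smooth_on_def intro!: Ck_on_add intro: Ck_on_subset)
  then show ?thesis using V W by (auto simp: smooth_at_def)
qed

lemma smooth_at_sum [intro]:
  assumes "\<And>i. i \<in> I \<Longrightarrow> smooth_at (f i) x"
  shows "smooth_at (\<lambda>x. \<Sum>i\<in>I. f i x) x"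
proof (cases "finite I")
  case True
  then show ?thesis using assms by (induction I) auto
qed simp

lemma smooth_at_ident [intro]: "smooth_at (\<lambda>x. x) x"
  by (rule smooth_at_bounded_linear) (rule bounded_linear_ident)

lemma smooth_at_minus [intro]: "smooth_at f x \<Longrightarrow> smooth_at (\<lambda>x. - f x) x"
  by (rule smooth_at_bounded_linear_compose[OF bounded_linear_minus[OF bounded_linear_ident]])

lemma smooth_at_diff [intro]: "smooth_at f x \<Longrightarrow> smooth_at g x \<Longrightarrow> smooth_at (\<lambda>x. f x - g x) x"
  using smooth_at_add[OF _ smooth_at_minus, of f x g] by simp

lemma smooth_at_Pair [intro]:
  assumes "smooth_at f x" "smooth_at g x"
  shows "smooth_at (\<lambda>x. (f x, g x)) x"
proof -
  have "smooth_at (\<lambda>x. (f x, 0) + (0, g x)) x"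
    by (intro smooth_at_add smooth_at_bounded_linear_compose[where L="\<lambda>a. (a, 0)"]
        smooth_at_bounded_linear_compose[where L="\<lambda>a. (0, a)"] assms
        bounded_linear_Pair bounded_linear_zero bounded_linear_ident)
  then show ?thesis by simp
qed

lemma smooth_at_compose:
  fixes f :: "'a::real_normed_vector \<Rightarrow> 'b::euclidean_space"
  assumes "smooth_at f x" "smooth_at g (f x)"
  shows "smooth_at (\<lambda>x. g (f x)) x"
proof -
  obtain W where W: "open W" "x \<in> W" "smooth_on W f" using assms(1) by (auto simp: smooth_at_def)
  obtain V where V: "open V" "f x \<in> V" "smooth_on V g" using assms(2) by (auto simp: smooth_at_def)
  have "continuous_on W f" using smooth_on_imp_Ck_on[OF W(3), of 0] by simp
  then have o: "open (W \<inter> f -` V)" using W V by (simp add: continuous_on_open_vimage Int_commute)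
  have "smooth_on (W \<inter> f -` V) (\<lambda>x. g (f x))"
    unfolding smooth_on_def
  proof
    fix k show "Ck_on k (W \<inter> f -` V) (\<lambda>x. g (f x))"
      by (rule Ck_on_compose[OF o, of _ _ V])
        (use V W in \<open>auto simp: smooth_on_def intro: Ck_on_subset\<close>)
  qed
  then show ?thesis using o W V by (auto simp: smooth_at_def)
qed

lemma smooth_at_fst: "smooth_at fst x"
  by (rule smooth_at_bounded_linear) (rule bounded_linear_fst)

lemma smooth_at_snd: "smooth_at snd x"
  by (rule smooth_at_bounded_linear) (rule bounded_linear_snd)

lemma frechet_derivative_compose_at:
  assumes "smooth_at f x" "smooth_at g (f x)"
  shows "frechet_derivative (\<lambda>x. g (f x)) (at x) v
    = frechet_derivative g (at (f x)) (frechet_derivative f (at x) v)"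
  using has_derivative_compose[OF smooth_at_has_derivative[OF assms(1)] smooth_at_has_derivative[OF assms(2)]]
  by (simp add: frechet_derivative_at_eq)

lemma frechet_derivative_cong:
  assumes "smooth_at f x" "eventually (\<lambda>y. f y = g y) (nhds x)"
  shows "frechet_derivative f (at x) = frechet_derivative g (at x)"
proof -
  obtain V where V: "open V" "x \<in> V" "\<And>y. y \<in> V \<Longrightarrow> f y = g y"
    using assms(2) by (auto simp: eventually_nhds)
  then show ?thesis
    by (intro frechet_derivative_transform_within_open[OF smooth_at_differentiable[OF assms(1)]])
qed


section \<open>Symmetry of second derivatives\<close>

lemma frechet_derivative_line:
  assumes "smooth_at f (y + t *\<^sub>R v)"
  shows "((\<lambda>t. f (y + t *\<^sub>R v)) has_real_derivative frechet_derivative f (at (y + t *\<^sub>R v)) v) (at t)"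
proof -
  have "((\<lambda>t. y + t *\<^sub>R v) has_derivative (\<lambda>s. s *\<^sub>R v)) (at t)"
    by (auto intro!: derivative_eq_intros)
  from has_derivative_compose[OF this smooth_at_has_derivative[OF assms]]
  have "((\<lambda>t. f (y + t *\<^sub>R v)) has_derivative
    (\<lambda>s. frechet_derivative f (at (y + t *\<^sub>R v)) (s *\<^sub>R v))) (at t)" .
  moreover have "frechet_derivative f (at (y + t *\<^sub>R v)) (s *\<^sub>R v)
      = frechet_derivative f (at (y + t *\<^sub>R v)) v * s" for s
    using linear_cmul[OF linear_frechet_derivative[OF smooth_at_differentiable[OF assms]]] by simp
  ultimately show ?thesis by (simp add: has_field_derivative_def)
qed

text \<open>The mean value theorem is applied twice: to the increment of \<open>f\<close> in
  direction \<open>w\<close>, as a function of the step along \<open>v\<close>, and then to the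
  resulting first derivative along \<open>w\<close>.\<close>

lemma second_difference_mvt:
  fixes f :: "'a::real_normed_vector \<Rightarrow> real"
  assumes "0 < h" and sm: "\<And>s t. 0 \<le> s \<Longrightarrow> s \<le> h \<Longrightarrow> 0 \<le> t \<Longrightarrow> t \<le> h \<Longrightarrow> smooth_at f (x + s *\<^sub>R v + t *\<^sub>R w)"
  obtains s t where "0 < s" "s < h" "0 < t" "t < h"
    "f (x + h *\<^sub>R v + h *\<^sub>R w) - f (x + h *\<^sub>R v) - f (x + h *\<^sub>R w) + f x
      = h * h * frechet_derivative (\<lambda>y. frechet_derivative f (at y) v) (at (x + s *\<^sub>R v + t *\<^sub>R w)) w"
proof -
  let ?D = "\<lambda>y. frechet_derivative f (at y) v"
  let ?u = "\<lambda>s. f (x + h *\<^sub>R w + s *\<^sub>R v) - f (x + s *\<^sub>R v)"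
  have "(?u has_real_derivative (?D (x + h *\<^sub>R w + s *\<^sub>R v) - ?D (x + s *\<^sub>R v))) (at s)"
    if "0 \<le> s" "s \<le> h" for s
    using sm[OF that, of h] sm[OF that, of 0] assms(1)
    by (intro derivative_intros frechet_derivative_line) (auto simp: algebra_simps)
  from MVT2[OF assms(1) this]
  obtain s where s: "0 < s" "s < h" "?u h - ?u 0 = h * (?D (x + h *\<^sub>R w + s *\<^sub>R v) - ?D (x + s *\<^sub>R v))"
    by auto
  let ?D2 = "\<lambda>y. frechet_derivative ?D (at y) w"
  have "((\<lambda>t. ?D (x + s *\<^sub>R v + t *\<^sub>R w)) has_real_derivative ?D2 (x + s *\<^sub>R v + t *\<^sub>R w)) (at t)"
    if "0 \<le> t" "t \<le> h" for t
    using sm[of s t] s that by (intro frechet_derivative_line smooth_at_frechet_derivative) auto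
  from MVT2[OF assms(1) this]
  obtain t where t: "0 < t" "t < h"
    "?D (x + s *\<^sub>R v + h *\<^sub>R w) - ?D (x + s *\<^sub>R v + 0 *\<^sub>R w) = (h - 0) * ?D2 (x + s *\<^sub>R v + t *\<^sub>R w)"
    by blast
  show ?thesis
    by (rule that[of s t]) (use s t in \<open>auto simp: algebra_simps\<close>)
qed

text \<open>The second difference over the parallelogram with sides \<open>h v\<close> and
  \<open>h w\<close> is symmetric in \<open>v\<close> and \<open>w\<close>. Divided by h^2 it is a
  value of either mixed derivative at a nearby point, and both are continuous at
  \<open>x\<close>.\<close>

lemma mixed_derivatives_commute:
  fixes f :: "'a::real_normed_vector \<Rightarrow> real"
  assumes "smooth_at f x"
  shows "frechet_derivative (\<lambda>y. frechet_derivative f (at y) v) (at x) w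
    = frechet_derivative (\<lambda>y. frechet_derivative f (at y) w) (at x) v"
proof -
  define G where "G = (\<lambda>v w y. frechet_derivative (\<lambda>y. frechet_derivative f (at y) v) (at y) w)"
  obtain r where r: "0 < r" "\<And>y. dist y x < r \<Longrightarrow> smooth_at f y"
    using smooth_at_eventually[OF assms] unfolding eventually_nhds_metric by auto
  have cont: "isCont (G v w) x" for v w
    unfolding G_def by (intro smooth_at_isCont smooth_at_frechet_derivative assms)
  have "\<bar>G v w x - G w v x\<bar> \<le> e" if "0 < e" for e
  proof -
    obtain d1 where d1: "0 < d1" "\<And>y. dist y x < d1 \<Longrightarrow> dist (G v w y) (G v w x) < e / 2"
      using cont[of v w, unfolded continuous_within_eps_delta] half_gt_zero[OF \<open>0 < e\<close>] by blast
    obtain d2 where d2: "0 < d2" "\<And>y. dist y x < d2 \<Longrightarrow> dist (G w v y) (G w v x) < e / 2"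
      using cont[of w v, unfolded continuous_within_eps_delta] half_gt_zero[OF \<open>0 < e\<close>] by blast
    define d where "d = Min {r, d1, d2}"
    have d: "0 < d" "d \<le> r" "d \<le> d1" "d \<le> d2" using r d1 d2 by (auto simp: d_def)
    \<comment> \<open>Small enough that the whole parallelogram stays within distance
      \<open>d\<close> of \<open>x\<close>; the summand 1 keeps the denominator positive when both
      vectors vanish.\<close>
    define h where "h = d / (2 * (norm v + norm w + 1))"
    have h: "0 < h" using d by (simp add: h_def add_nonneg_pos)
    have "h * (norm v + norm w + 1) = d / 2"
      using add_nonneg_pos[of "norm v + norm w" 1] by (simp add: h_def field_simps)
    then have hd: "h * norm v + h * norm w < d"
      using h d by (simp add: algebra_simps)
    have near: "dist (x + s *\<^sub>R v + t *\<^sub>R w) x < d" if "0 \<le> s" "s \<le> h" "0 \<le> t" "t \<le> h" for s t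
    proof -
      have "dist (x + s *\<^sub>R v + t *\<^sub>R w) x = norm (s *\<^sub>R v + t *\<^sub>R w)"
        by (simp add: dist_norm algebra_simps)
      also have "\<dots> \<le> s * norm v + t * norm w"
        using norm_triangle_ineq[of "s *\<^sub>R v" "t *\<^sub>R w"] that by simp
      also have "\<dots> \<le> h * norm v + h * norm w"
        using that by (intro add_mono mult_right_mono) auto
      finally show ?thesis using hd by simp
    qed
    obtain s t where st: "0 < s" "s < h" "0 < t" "t < h"
      "f (x + h *\<^sub>R v + h *\<^sub>R w) - f (x + h *\<^sub>R v) - f (x + h *\<^sub>R w) + f x
        = h * h * G v w (x + s *\<^sub>R v + t *\<^sub>R w)"
      unfolding G_def using h
    proof (rule second_difference_mvt)
      show "smooth_at f (x + s *\<^sub>R v + t *\<^sub>R w)" if "0 \<le> s" "s \<le> h" "0 \<le> t" "t \<le> h" for s t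
        using r(2) near[OF that] d by simp
    qed
    obtain s' t' where st': "0 < s'" "s' < h" "0 < t'" "t' < h"
      "f (x + h *\<^sub>R w + h *\<^sub>R v) - f (x + h *\<^sub>R w) - f (x + h *\<^sub>R v) + f x
        = h * h * G w v (x + s' *\<^sub>R w + t' *\<^sub>R v)"
      unfolding G_def using h
    proof (rule second_difference_mvt)
      show "smooth_at f (x + s *\<^sub>R w + t *\<^sub>R v)" if "0 \<le> s" "s \<le> h" "0 \<le> t" "t \<le> h" for s t
        using r(2) near[of t s] that d by (simp add: algebra_simps)
    qed
    have "h * h * G v w (x + s *\<^sub>R v + t *\<^sub>R w) = h * h * G w v (x + s' *\<^sub>R w + t' *\<^sub>R v)"
      using st(5) st'(5) by (simp add: algebra_simps)
    then have "G v w (x + s *\<^sub>R v + t *\<^sub>R w) = G w v (x + s' *\<^sub>R w + t' *\<^sub>R v)"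
      using h by simp
    moreover have "dist (G v w (x + s *\<^sub>R v + t *\<^sub>R w)) (G v w x) < e / 2"
      using d1(2) near[of s t] st d by simp
    moreover have "dist (G w v (x + s' *\<^sub>R w + t' *\<^sub>R v)) (G w v x) < e / 2"
      using d2(2) near[of t' s'] st' d by (simp add: algebra_simps)
    ultimately show ?thesis unfolding dist_real_def by linarith
  qed
  then have "\<bar>G v w x - G w v x\<bar> \<le> 0" by (rule dense_ge)
  then show ?thesis by (simp add: G_def)
qed


section \<open>A smooth cutoff function\<close>

text \<open>The class of functions \<open>p(1/t) exp(-1/t)\<close>, \<open>p\<close> a polynomial, extended by zero to \<open>t \<le> 0\<close>,
  is closed under differentiation.\<close>

definition flat_exp :: "real poly \<Rightarrow> real \<Rightarrow> real" where
  "flat_exp p t = (if 0 < t then poly p (1 / t) * exp (- (1 / t)) else 0)"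

lemma poly_times_exp_tendsto_0: "((\<lambda>x. poly p x * exp (- x)) \<longlongrightarrow> (0::real)) at_top"
proof -
  have "((\<lambda>x. \<Sum>i\<le>degree p. coeff p i * (x ^ i / exp x)) \<longlongrightarrow> (\<Sum>i\<le>degree p. coeff p i * 0)) at_top"
    by (intro tendsto_intros tendsto_power_div_exp_0)
  then show ?thesis
    by (simp add: poly_altdef sum_distrib_right exp_minus divide_inverse mult.assoc)
qed

lemma flat_exp_tendsto_0: "(flat_exp p \<longlongrightarrow> 0) (at 0)"
proof -
  have "((\<lambda>t. poly p (1 / t) * exp (- (1 / t))) \<longlongrightarrow> 0) (at_right 0)"
    using filterlim_compose[OF poly_times_exp_tendsto_0[of p] filterlim_inverse_at_top_right]
    by (simp add: inverse_eq_divide)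
  then have "(flat_exp p \<longlongrightarrow> 0) (at_right 0)"
    by (rule Lim_transform_eventually)
      (auto simp: flat_exp_def eventually_at_right_field intro!: exI[of _ 1])
  moreover have "(flat_exp p \<longlongrightarrow> 0) (at_left 0)"
    by (rule Lim_transform_eventually[OF tendsto_const])
      (auto simp: flat_exp_def eventually_at_left_field intro!: exI[of _ "-1"])
  ultimately show ?thesis by (simp add: filterlim_split_at)
qed

text \<open>With s = 1/t the derivative of p(s) exp(-s) in t is s^2 (p(s) - p'(s)) exp(-s), hence
  the factor \<open>[:0, 0, 1:]\<close>.\<close>

lemma flat_exp_has_derivative:
  "(flat_exp p has_real_derivative flat_exp ([:0, 0, 1:] * (p - pderiv p)) t) (at t)"
proof -
  consider "t < 0" | "t = 0" | "0 < t" by linarith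
  then show ?thesis
  proof cases
    case 1
    have "((\<lambda>_. 0) has_real_derivative 0) (at t)" by simp
    then have "(flat_exp p has_real_derivative 0) (at t)"
      by (rule has_field_derivative_transform_within_open[where S="{..<0}"]) (use 1 in \<open>auto simp: flat_exp_def\<close>)
    then show ?thesis using 1 by (simp add: flat_exp_def)
  next
    case 2
    \<comment> \<open>Multiplying \<open>p\<close> by the variable amounts to dividing by
      \<open>t\<close>, so away from 0 the difference quotient at 0 is again a function of this
      class and tends to 0.\<close>
    have "((\<lambda>h. flat_exp ([:0, 1:] * p) h) \<longlongrightarrow> 0) (at 0)" by (rule flat_exp_tendsto_0)
    then have "((\<lambda>h. (flat_exp p (0 + h) - flat_exp p 0) / h) \<longlongrightarrow> 0) (at 0)"
      by (rule Lim_transform_eventually) (auto simp: flat_exp_def eventually_at_filter intro!: always_eventually)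
    then show ?thesis using 2 by (simp add: DERIV_def flat_exp_def)
  next
    case 3
    have "((\<lambda>t. poly p (1 / t) * exp (- (1 / t))) has_real_derivative
        poly ([:0, 0, 1:] * (p - pderiv p)) (1 / t) * exp (- (1 / t))) (at t)"
      using 3 by (auto intro!: derivative_eq_intros DERIV_chain'[OF _ poly_DERIV] simp: field_simps power2_eq_square)
    then have "(flat_exp p has_real_derivative
        poly ([:0, 0, 1:] * (p - pderiv p)) (1 / t) * exp (- (1 / t))) (at t)"
      by (rule has_field_derivative_transform_within_open[where S="{0<..}"]) (use 3 in \<open>auto simp: flat_exp_def\<close>)
    then show ?thesis using 3 by (simp add: flat_exp_def)
  qed
qed

lemma Ck_on_flat_exp: "Ck_on k UNIV (flat_exp p)"
proof (induction k arbitrary: p)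
  case 0
  show ?case
    using DERIV_isCont[OF flat_exp_has_derivative] by (auto intro!: continuous_at_imp_continuous_on)
next
  case (Suc k)
  have der: "(flat_exp p has_derivative (*) (flat_exp ([:0, 0, 1:] * (p - pderiv p)) t)) (at t)" for t
    using flat_exp_has_derivative[of p t] by (simp only: has_field_derivative_def)
  have "Ck_on k UNIV (\<lambda>t. frechet_derivative (flat_exp p) (at t) v)" for v
    unfolding frechet_derivative_at_eq[OF der]
    by (rule Ck_on_bounded_linear_compose[OF bounded_linear_mult_left open_UNIV Suc.IH])
  then show ?case using der by (auto simp: differentiable_def)
qed

lemma smooth_at_flat_exp: "smooth_at (flat_exp p) t"
  by (rule smooth_on_imp_smooth_at[of UNIV]) (auto simp: smooth_on_def Ck_on_flat_exp)

text \<open>For positive \<open>d\<close> the inner \<open>flat_exp\<close> vanishes on the ball of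
  radius \<open>d\<close>, and it is at least its value at 1 once the squared distance is at least 2
  d^2. The outer argument is then 1 and at most 0 respectively, and dividing by
  \<open>flat_exp 1 1\<close> gives the plateau height 1.\<close>

definition cutoff :: "'a::euclidean_space \<Rightarrow> real \<Rightarrow> 'a \<Rightarrow> real" where
  "cutoff c d x = flat_exp 1 (1 - flat_exp 1 ((x - c) \<bullet> (x - c) / d\<^sup>2 - 1) / flat_exp 1 1) / flat_exp 1 1"

lemma smooth_at_cutoff: "smooth_at (cutoff c d) x"
proof -
  have 1: "smooth_at (\<lambda>x. flat_exp 1 ((x - c) \<bullet> (x - c) * (1 / d\<^sup>2) - 1)) x"
    by (rule smooth_at_compose[OF _ smooth_at_flat_exp]) (intro smooth_at_diff smooth_at_mult smooth_at_inner smooth_at_ident smooth_at_const)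
  have "smooth_at (\<lambda>x. flat_exp 1 (1 - flat_exp 1 ((x - c) \<bullet> (x - c) * (1 / d\<^sup>2) - 1) * (1 / flat_exp 1 1)) * (1 / flat_exp 1 1)) x"
    by (rule smooth_at_mult[OF smooth_at_compose[OF _ smooth_at_flat_exp]])
      (intro smooth_at_diff smooth_at_mult 1 smooth_at_const)+
  then show ?thesis by (simp add: cutoff_def[abs_def])
qed

lemma cutoff_eq_1:
  assumes "dist x c < d"
  shows "cutoff c d x = 1"
proof -
  have "(x - c) \<bullet> (x - c) \<le> d\<^sup>2"
    using assms power_mono[of "dist x c" d 2] by (simp add: dist_norm power2_norm_eq_inner)
  moreover have "0 < d" using assms by (meson le_less_trans zero_le_dist)
  ultimately have "(x - c) \<bullet> (x - c) / d\<^sup>2 - 1 \<le> 0" by (simp add: divide_le_eq)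
  then show ?thesis by (simp add: cutoff_def flat_exp_def)
qed

lemma cutoff_eq_0:
  assumes "2 * d \<le> dist x c" "0 < d"
  shows "cutoff c d x = 0"
proof -
  have "(2 * d)\<^sup>2 \<le> (x - c) \<bullet> (x - c)"
    using assms power_mono[of "2 * d" "dist x c" 2] by (simp add: dist_norm power2_norm_eq_inner)
  then have "1 \<le> (x - c) \<bullet> (x - c) / d\<^sup>2 - 1"
  proof -
    assume "(2 * d)\<^sup>2 \<le> (x - c) \<bullet> (x - c)"
    moreover have "(2 * d)\<^sup>2 = 4 * d\<^sup>2" by (simp add: power_mult_distrib)
    ultimately have "2 * d\<^sup>2 \<le> (x - c) \<bullet> (x - c)" using zero_le_power2[of d] by linarith
    then show ?thesis using assms(2) by (simp add: le_divide_eq)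
  qed
  then have "flat_exp 1 1 \<le> flat_exp 1 ((x - c) \<bullet> (x - c) / d\<^sup>2 - 1)"
    by (simp add: flat_exp_def field_simps)
  then have "1 - flat_exp 1 ((x - c) \<bullet> (x - c) / d\<^sup>2 - 1) / flat_exp 1 1 \<le> 0"
    by (simp add: flat_exp_def le_divide_eq)
  then show ?thesis by (simp add: cutoff_def flat_exp_def)
qed


lemma frechet_derivative_add_at:
  "smooth_at f x \<Longrightarrow> smooth_at g x \<Longrightarrow> frechet_derivative (\<lambda>x. f x + g x) (at x) v
    = frechet_derivative f (at x) v + frechet_derivative g (at x) v"
  by (simp add: frechet_derivative_at_eq[OF has_derivative_add[OF smooth_at_has_derivative smooth_at_has_derivative]])

lemma frechet_derivative_mult_at:
  fixes f g :: "'a::real_normed_vector \<Rightarrow> real"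
  shows "smooth_at f x \<Longrightarrow> smooth_at g x \<Longrightarrow> frechet_derivative (\<lambda>x. f x * g x) (at x) v
    = f x * frechet_derivative g (at x) v + frechet_derivative f (at x) v * g x"
  by (simp add: frechet_derivative_at_eq[OF has_derivative_mult[OF smooth_at_has_derivative smooth_at_has_derivative]])


section \<open>Functions and tangent vectors on a smooth atlas\<close>

locale atlas =
  fixes A :: "('m, 'e::euclidean_space) atlas"
  assumes smooth_atlas: "smooth_atlas A"
begin

abbreviation near :: "'m \<Rightarrow> 'm filter" where
  "near p \<equiv> nhdsin (atlas_topology A) p"

abbreviation sm :: "'m \<Rightarrow> ('m \<Rightarrow> real) set" where
  "sm p \<equiv> smooth_near A p"

abbreviation tangent :: "'m \<Rightarrow> 'm tvec set" where
  "tangent p \<equiv> tangent_space A p"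

lemma chart_inj: "(U, \<phi>) \<in> A \<Longrightarrow> inj_on \<phi> U"
  and chart_open: "(U, \<phi>) \<in> A \<Longrightarrow> open (\<phi> ` U)"
  using smooth_atlas by (auto simp: smooth_atlas_def)

lemma chart_points: "(U, \<phi>) \<in> A \<Longrightarrow> p \<in> U \<Longrightarrow> p \<in> points A"
  by (force simp: points_def)

lemma chart_inv [simp]: "(U, \<phi>) \<in> A \<Longrightarrow> p \<in> U \<Longrightarrow> inv_into U \<phi> (\<phi> p) = p"
  by (simp add: chart_inj)

lemma points_chart:
  assumes "p \<in> points A"
  obtains U \<phi> where "(U, \<phi>) \<in> A" "p \<in> U"
  using assms by (auto simp: points_def)

lemma overlap_open: "(U, \<phi>) \<in> A \<Longrightarrow> (V, \<psi>) \<in> A \<Longrightarrow> open (\<phi> ` (U \<inter> V))"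
  using smooth_atlas by (auto simp: smooth_atlas_def)

lemma overlap_smooth_on:
  "(U, \<phi>) \<in> A \<Longrightarrow> (V, \<psi>) \<in> A \<Longrightarrow> smooth_on (\<phi> ` (U \<inter> V)) (\<lambda>x. \<psi> (inv_into U \<phi> x))"
  using smooth_atlas unfolding smooth_atlas_def comp_def by blast

lemma transition_smooth_at:
  assumes "(U, \<phi>) \<in> A" "(V, \<psi>) \<in> A" "p \<in> U" "p \<in> V"
  shows "smooth_at (\<lambda>x. \<psi> (inv_into U \<phi> x)) (\<phi> p)"
  by (rule smooth_on_imp_smooth_at[OF overlap_smooth_on overlap_open, OF assms(1,2) assms(1,2)])
    (use assms in auto)

lemma topspace_atlas [simp]: "topspace (atlas_topology A) = points A"
  unfolding atlas_topology_def topology_generated_by_topspace points_def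
  by (auto simp: image_iff) (metis IntI UNIV_I fst_conv open_UNIV vimage_UNIV)

text \<open>The topology is generated by the charts, so only generating sets need testing, and the
  preimage of such a set is that of an open set under a transition map.\<close>

lemma continuous_map_chart_inv:
  assumes c: "(U, \<phi>) \<in> A"
  shows "continuous_map (top_of_set (\<phi> ` U)) (atlas_topology A) (inv_into U \<phi>)"
  unfolding atlas_topology_def
proof (rule continuous_on_generated_topo)
  fix B assume "B \<in> {V \<inter> \<psi> -` W | V \<psi> W. (V, \<psi>) \<in> A \<and> open W}"
  then obtain V \<psi> W where B: "B = V \<inter> \<psi> -` W" and d: "(V, \<psi>) \<in> A" and W: "open W" by auto
  have "inv_into U \<phi> -` B \<inter> \<phi> ` U = \<phi> ` (U \<inter> V) \<inter> (\<lambda>x. \<psi> (inv_into U \<phi> x)) -` W"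
    using c by (auto simp: B)
  moreover have "continuous_on (\<phi> ` (U \<inter> V)) (\<lambda>x. \<psi> (inv_into U \<phi> x))"
    using smooth_on_imp_Ck_on[OF overlap_smooth_on[OF c d], of 0] by simp
  ultimately have "open (inv_into U \<phi> -` B \<inter> \<phi> ` U)"
    using continuous_on_open_vimage[OF overlap_open[OF c d]] W by (metis inf_commute)
  then show "openin (top_of_set (\<phi> ` U)) (inv_into U \<phi> -` B \<inter> topspace (top_of_set (\<phi> ` U)))"
    by (auto intro: open_subset)
next
  show "inv_into U \<phi> ` topspace (top_of_set (\<phi> ` U)) \<subseteq> \<Union> {V \<inter> \<psi> -` W | V \<psi> W. (V, \<psi>) \<in> A \<and> open W}"
    using c open_UNIV by (auto simp: inv_into_into) blast
qed

lemma openin_chart: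
  "(U, \<phi>) \<in> A \<Longrightarrow> open W \<Longrightarrow> openin (atlas_topology A) (U \<inter> \<phi> -` W)"
  unfolding atlas_topology_def by (rule topology_generated_by_Basis) auto

text \<open>The bridge between germs on the manifold and germs in the model space; local statements
  are moved through it into a chart.\<close>

lemma eventually_near_chart:
  assumes c: "(U, \<phi>) \<in> A" "p \<in> U"
  shows "eventually P (near p) \<longleftrightarrow> eventually (\<lambda>x. P (inv_into U \<phi> x)) (nhds (\<phi> p))"
proof
  assume "eventually P (near p)"
  then obtain Q where Q: "openin (atlas_topology A) Q" "p \<in> Q" "\<And>x. x \<in> Q \<Longrightarrow> P x"
    using chart_points[OF c] by (auto simp: eventually_nhdsin)
  have "openin (top_of_set (\<phi> ` U)) {x \<in> \<phi> ` U. inv_into U \<phi> x \<in> Q}"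
    using openin_continuous_map_preimage[OF continuous_map_chart_inv[OF c(1)] Q(1)] by simp
  then have "open {x \<in> \<phi> ` U. inv_into U \<phi> x \<in> Q}"
    using chart_open[OF c(1)] by (simp add: openin_open_eq)
  then show "eventually (\<lambda>x. P (inv_into U \<phi> x)) (nhds (\<phi> p))"
    unfolding eventually_nhds using Q c by (intro exI[of _ "{x \<in> \<phi> ` U. inv_into U \<phi> x \<in> Q}"]) auto
next
  assume "eventually (\<lambda>x. P (inv_into U \<phi> x)) (nhds (\<phi> p))"
  then obtain W where W: "open W" "\<phi> p \<in> W" "\<And>x. x \<in> W \<Longrightarrow> P (inv_into U \<phi> x)"
    by (auto simp: eventually_nhds)
  have "\<forall>x \<in> U \<inter> \<phi> -` W. P x" using W(3) chart_inv[OF c(1)] by (metis IntE vimageE)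
  then show "eventually P (near p)"
    unfolding eventually_nhdsin using openin_chart[OF c(1) W(1)] W(2) c(2) by blast
qed

lemma eventually_nhds_chart:
  assumes c: "(U, \<phi>) \<in> A" "p \<in> U"
  shows "eventually (\<lambda>x. inv_into U \<phi> x \<in> U \<and> \<phi> (inv_into U \<phi> x) = x) (nhds (\<phi> p))"
  unfolding eventually_nhds using chart_open[OF c(1)] c(2)
  by (intro exI[of _ "\<phi> ` U"]) (auto simp: inv_into_into f_inv_into_f)

lemma eventually_near_dom: "(U, \<phi>) \<in> A \<Longrightarrow> p \<in> U \<Longrightarrow> eventually (\<lambda>q. q \<in> U) (near p)"
  using openin_chart[OF _ open_UNIV] by (auto simp: eventually_nhdsin)

lemma eventually_near_points: "eventually (\<lambda>q. q \<in> points A) (near p)"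
  using openin_topspace[of "atlas_topology A"] by (auto simp: eventually_nhdsin)

lemma eventually_near_self: "eventually P (near p) \<Longrightarrow> p \<in> points A \<Longrightarrow> P p"
  by (auto simp: eventually_nhdsin)

lemma eventually_eventually_near: "eventually P (near p) \<Longrightarrow> eventually (\<lambda>q. eventually P (near q)) (near p)"
  unfolding eventually_nhdsin by blast

text \<open>\<open>smooth_near\<close> asks for a single suitable chart; smoothness of the
  transition maps makes every chart at \<open>p\<close> equally good.\<close>

lemma sm_iff:
  assumes c: "(U, \<phi>) \<in> A" "p \<in> U"
  shows "f \<in> sm p \<longleftrightarrow> smooth_at (\<lambda>x. f (inv_into U \<phi> x)) (\<phi> p)"
proof
  assume "smooth_at (\<lambda>x. f (inv_into U \<phi> x)) (\<phi> p)"
  then obtain W where W: "open W" "\<phi> p \<in> W" "smooth_on W (\<lambda>x. f (inv_into U \<phi> x))"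
    by (auto simp: smooth_at_def)
  then show "f \<in> sm p"
    unfolding smooth_near_def comp_def using c chart_open[OF c(1)]
    by (auto intro!: bexI[of _ "(U, \<phi>)"] exI[of _ "W \<inter> \<phi> ` U"] intro: smooth_on_subset)
next
  assume "f \<in> sm p"
  then obtain V \<psi> W where d: "(V, \<psi>) \<in> A" "p \<in> V" and
    W: "open W" "\<psi> p \<in> W" "W \<subseteq> \<psi> ` V" "smooth_on W (\<lambda>x. f (inv_into V \<psi> x))"
    by (auto simp: smooth_near_def comp_def)
  have "smooth_at (\<lambda>x. f (inv_into V \<psi> (\<psi> (inv_into U \<phi> x)))) (\<phi> p)"
    by (rule smooth_at_compose[OF transition_smooth_at[OF c(1) d(1) c(2) d(2)]])
      (use c d W in \<open>auto intro: smooth_on_imp_smooth_at\<close>)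
  moreover have "eventually (\<lambda>x. f (inv_into V \<psi> (\<psi> (inv_into U \<phi> x))) = f (inv_into U \<phi> x)) (nhds (\<phi> p))"
    using eventually_near_dom[OF d, unfolded eventually_near_chart[OF c]]
    by eventually_elim (use d in simp)
  ultimately show "smooth_at (\<lambda>x. f (inv_into U \<phi> x)) (\<phi> p)" by (rule smooth_at_cong)
qed

lemma sm_points: "f \<in> sm p \<Longrightarrow> p \<in> points A"
  by (auto simp: smooth_near_def intro: chart_points)

lemma sm_eventually: "f \<in> sm p \<Longrightarrow> eventually (\<lambda>q. f \<in> sm q) (near p)"
proof -
  assume f: "f \<in> sm p"
  obtain U \<phi> where c: "(U, \<phi>) \<in> A" "p \<in> U" using sm_points[OF f] by (rule points_chart)
  have "eventually (\<lambda>x. smooth_at (\<lambda>x. f (inv_into U \<phi> x)) x) (nhds (\<phi> p))"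
    using f sm_iff[OF c] smooth_at_eventually by blast
  with eventually_nhds_chart[OF c] show ?thesis
    unfolding eventually_near_chart[OF c]
    by eventually_elim (use c(1) sm_iff in \<open>metis\<close>)
qed

lemma sm_cong:
  assumes "f \<in> sm p" and "eventually (\<lambda>q. f q = g q) (near p)"
  shows "g \<in> sm p"
proof -
  obtain U \<phi> where c: "(U, \<phi>) \<in> A" "p \<in> U" using sm_points[OF assms(1)] by (rule points_chart)
  show ?thesis
    using assms unfolding sm_iff[OF c] eventually_near_chart[OF c] by (rule smooth_at_cong)
qed

lemma sm_const [simp]: "p \<in> points A \<Longrightarrow> (\<lambda>q. k) \<in> sm p"
  by (erule points_chart) (simp add: sm_iff)

lemma sm_add: "f \<in> sm p \<Longrightarrow> g \<in> sm p \<Longrightarrow> (\<lambda>q. f q + g q) \<in> sm p"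
  by (frule sm_points, erule points_chart) (auto simp: sm_iff)

lemma sm_diff: "f \<in> sm p \<Longrightarrow> g \<in> sm p \<Longrightarrow> (\<lambda>q. f q - g q) \<in> sm p"
  by (frule sm_points, erule points_chart) (auto simp: sm_iff)

lemma sm_mult: "f \<in> sm p \<Longrightarrow> g \<in> sm p \<Longrightarrow> (\<lambda>q. f q * g q) \<in> sm p"
  by (frule sm_points, erule points_chart) (auto simp: sm_iff)

lemma sm_sum: "p \<in> points A \<Longrightarrow> (\<And>i. i \<in> I \<Longrightarrow> f i \<in> sm p) \<Longrightarrow> (\<lambda>q. \<Sum>i\<in>I. f i q) \<in> sm p"
  by (erule points_chart) (auto simp: sm_iff)

lemma sm_coord: "(U, \<phi>) \<in> A \<Longrightarrow> p \<in> U \<Longrightarrow> (\<lambda>q. \<phi> q \<bullet> b) \<in> sm p"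
  using transition_smooth_at[of U \<phi> U \<phi> p] by (auto simp: sm_iff)

section \<open>Tangent vectors in charts\<close>

lemma chart_tvec_eq:
  "f \<in> sm p \<Longrightarrow> chart_tvec A (U, \<phi>) p w f = frechet_derivative (\<lambda>x. f (inv_into U \<phi> x)) (at (\<phi> p)) w"
  by (simp add: chart_tvec_def comp_def)

lemma chart_tvec_outside: "f \<notin> sm p \<Longrightarrow> chart_tvec A c p w f = 0"
  by (simp add: chart_tvec_def)

lemma linear_chart_tvec:
  assumes c: "(U, \<phi>) \<in> A" "p \<in> U"
  shows "linear (\<lambda>w. chart_tvec A (U, \<phi>) p w f)"
proof (cases "f \<in> sm p")
  case True
  then show ?thesis
    using linear_frechet_derivative[OF smooth_at_differentiable] sm_iff[OF c]
    by (simp add: chart_tvec_eq[OF True])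
qed (simp add: chart_tvec_outside linear_iff)

text \<open>The chain rule for the transition map. It allows a tangent vector given in an unknown
  chart to be rewritten in a prescribed one.\<close>

lemma chart_tvec_change:
  assumes c: "(U, \<phi>) \<in> A" "p \<in> U" and d: "(V, \<psi>) \<in> A" "p \<in> V"
  shows "chart_tvec A (V, \<psi>) p w
    = chart_tvec A (U, \<phi>) p (frechet_derivative (\<lambda>x. \<phi> (inv_into V \<psi> x)) (at (\<psi> p)) w)"
proof
  fix f
  let ?\<tau> = "\<lambda>x. \<phi> (inv_into V \<psi> x)"
  show "chart_tvec A (V, \<psi>) p w f = chart_tvec A (U, \<phi>) p (frechet_derivative ?\<tau> (at (\<psi> p)) w) f"
  proof (cases "f \<in> sm p")
    case True
    have \<tau>: "smooth_at ?\<tau> (\<psi> p)" by (rule transition_smooth_at) (use c d in auto)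
    have e: "eventually (\<lambda>x. f (inv_into V \<psi> x) = f (inv_into U \<phi> (?\<tau> x))) (nhds (\<psi> p))"
      using eventually_near_dom[OF c, unfolded eventually_near_chart[OF d]]
      by eventually_elim (use c in simp)
    have "frechet_derivative (\<lambda>x. f (inv_into V \<psi> x)) (at (\<psi> p)) w
        = frechet_derivative (\<lambda>x. f (inv_into U \<phi> (?\<tau> x))) (at (\<psi> p)) w"
      using frechet_derivative_cong[OF _ e] True by (simp add: sm_iff[OF d])
    also have "\<dots> = frechet_derivative (\<lambda>y. f (inv_into U \<phi> y)) (at (\<phi> p)) (frechet_derivative ?\<tau> (at (\<psi> p)) w)"
      using frechet_derivative_compose_at[OF \<tau>, of "\<lambda>y. f (inv_into U \<phi> y)"] True sm_iff[OF c] d by simp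
    finally show ?thesis by (simp add: chart_tvec_eq[OF True])
  qed (simp add: chart_tvec_outside)
qed

lemma chart_tvec_in_tangent: "(U, \<phi>) \<in> A \<Longrightarrow> p \<in> U \<Longrightarrow> chart_tvec A (U, \<phi>) p w \<in> tangent p"
  unfolding tangent_space_def by fastforce

lemma tangent_chart:
  assumes c: "(U, \<phi>) \<in> A" "p \<in> U"
  shows "tangent p = range (chart_tvec A (U, \<phi>) p)"
  using chart_tvec_change[OF c] chart_tvec_in_tangent[OF c] unfolding tangent_space_def by fastforce

lemma tangentE:
  assumes "v \<in> tangent p" "(U, \<phi>) \<in> A" "p \<in> U"
  obtains w where "v = chart_tvec A (U, \<phi>) p w"
  using assms tangent_chart by blast

lemma tangent_points: "v \<in> tangent p \<Longrightarrow> p \<in> points A"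
  unfolding tangent_space_def using chart_points by force

lemma chart_tvec_coord:
  assumes c: "(U, \<phi>) \<in> A" "p \<in> U"
  shows "chart_tvec A (U, \<phi>) p w (\<lambda>q. \<phi> q \<bullet> b) = w \<bullet> b"
proof -
  have "smooth_at (\<lambda>x. \<phi> (inv_into U \<phi> x) \<bullet> b) (\<phi> p)"
    using sm_coord[OF c, of b] by (simp add: sm_iff[OF c])
  then have "frechet_derivative (\<lambda>x. \<phi> (inv_into U \<phi> x) \<bullet> b) (at (\<phi> p))
      = frechet_derivative (\<lambda>x. x \<bullet> b) (at (\<phi> p))"
    by (rule frechet_derivative_cong) (use eventually_nhds_chart[OF c] in \<open>auto elim: eventually_mono\<close>)
  also have "\<dots> = (\<lambda>x. x \<bullet> b)"
    by (rule frechet_derivative_at_eq[OF bounded_linear_imp_has_derivative[OF bounded_linear_inner_left]])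
  finally show ?thesis by (simp add: chart_tvec_eq[OF sm_coord[OF c]])
qed

lemma tangent_outside: "v \<in> tangent p \<Longrightarrow> f \<notin> sm p \<Longrightarrow> v f = 0"
  unfolding tangent_space_def using chart_tvec_outside by blast

text \<open>Equality near \<open>p\<close> also preserves membership in \<open>smooth_near\<close>,
  so the conventional value 0 on other functions is respected.\<close>

lemma tangent_cong:
  assumes "v \<in> tangent p" and "eventually (\<lambda>q. f q = g q) (near p)"
  shows "v f = v g"
proof -
  obtain U \<phi> where c: "(U, \<phi>) \<in> A" "p \<in> U" using tangent_points[OF assms(1)] by (rule points_chart)
  obtain w where v: "v = chart_tvec A (U, \<phi>) p w" using tangentE[OF assms(1) c] .
  have "f \<in> sm p \<longleftrightarrow> g \<in> sm p"
    using assms(2) sm_cong[of f p g] sm_cong[of g p f] by (auto elim: eventually_mono simp: eq_commute)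
  then show ?thesis
    using frechet_derivative_cong[of "\<lambda>x. f (inv_into U \<phi> x)" "\<phi> p" "\<lambda>x. g (inv_into U \<phi> x)"] assms(2)
    by (auto simp: v chart_tvec_def comp_def sm_iff[OF c] eventually_near_chart[OF c])
qed

lemma tangent_const: "v \<in> tangent p \<Longrightarrow> v (\<lambda>q. k) = 0"
  by (frule tangent_points, erule points_chart)
    (auto elim!: tangentE simp: chart_tvec_def comp_def)

lemma tangent_add:
  assumes "v \<in> tangent p" "f \<in> sm p" "g \<in> sm p"
  shows "v (\<lambda>q. f q + g q) = v f + v g"
proof -
  obtain U \<phi> where c: "(U, \<phi>) \<in> A" "p \<in> U" using tangent_points[OF assms(1)] by (rule points_chart)
  obtain w where v: "v = chart_tvec A (U, \<phi>) p w" using tangentE[OF assms(1) c] .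
  show ?thesis
    using assms(2,3)[unfolded sm_iff[OF c]]
    by (simp add: v chart_tvec_eq[OF assms(2)] chart_tvec_eq[OF assms(3)] chart_tvec_eq[OF sm_add[OF assms(2,3)]]
        frechet_derivative_add_at)
qed

lemma tangent_mult:
  assumes "v \<in> tangent p" "f \<in> sm p" "g \<in> sm p"
  shows "v (\<lambda>q. f q * g q) = f p * v g + v f * g p"
proof -
  obtain U \<phi> where c: "(U, \<phi>) \<in> A" "p \<in> U" using tangent_points[OF assms(1)] by (rule points_chart)
  obtain w where v: "v = chart_tvec A (U, \<phi>) p w" using tangentE[OF assms(1) c] .
  show ?thesis
    using assms(2,3)[unfolded sm_iff[OF c]] c
    by (simp add: v chart_tvec_eq[OF assms(2)] chart_tvec_eq[OF assms(3)] chart_tvec_eq[OF sm_mult[OF assms(2,3)]]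
        frechet_derivative_mult_at)
qed

lemma tangent_cmult: "v \<in> tangent p \<Longrightarrow> f \<in> sm p \<Longrightarrow> v (\<lambda>q. k * f q) = k * v f"
  using tangent_mult[of v p "\<lambda>q. k" f] tangent_const[of v p k] by (simp add: sm_points)

lemma tangent_diff:
  assumes "v \<in> tangent p" "f \<in> sm p" "g \<in> sm p"
  shows "v (\<lambda>q. f q - g q) = v f - v g"
  using tangent_add[OF assms(1) sm_diff[OF assms(2,3)] assms(3)] by simp

lemma tangent_sum:
  assumes "v \<in> tangent p" "\<And>i. i \<in> I \<Longrightarrow> f i \<in> sm p"
  shows "v (\<lambda>q. \<Sum>i\<in>I. f i q) = (\<Sum>i\<in>I. v (f i))"
proof (cases "finite I")
  case True
  then show ?thesis using assms(2)
  proof (induction I)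
    case (insert i I)
    then have "(\<lambda>q. \<Sum>i\<in>I. f i q) \<in> sm p"
      by (intro sm_sum tangent_points[OF assms(1)]) auto
    then show ?case using insert tangent_add[OF assms(1), of "f i" "\<lambda>q. \<Sum>i\<in>I. f i q"] by simp
  qed (simp add: tangent_const[OF assms(1)])
qed (simp add: tangent_const[OF assms(1)])

text \<open>The components of \<open>v\<close> in a chart are its values on the coordinate
  functions. Both sides are 0 off \<open>smooth_near\<close>, so the expansion holds for every
  \<open>f\<close>.\<close>

lemma tangent_expand:
  assumes "v \<in> tangent p" and c: "(U, \<phi>) \<in> A" "p \<in> U"
  shows "v f = (\<Sum>b\<in>Basis. v (\<lambda>q. \<phi> q \<bullet> b) * chart_tvec A (U, \<phi>) p b f)"
proof -
  obtain w where v: "v = chart_tvec A (U, \<phi>) p w" using tangentE[OF assms] .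
  show ?thesis
    unfolding v chart_tvec_coord[OF c]
    by (rule linear_expand_Basis[OF linear_chart_tvec[OF c], unfolded real_scaleR_def])
qed

lemma tangent_eqI:
  assumes "v \<in> tangent p" "w \<in> tangent p" and c: "(U, \<phi>) \<in> A" "p \<in> U"
    and "\<And>b. b \<in> Basis \<Longrightarrow> v (\<lambda>q. \<phi> q \<bullet> b) = w (\<lambda>q. \<phi> q \<bullet> b)"
  shows "v = w"
proof
  fix f
  have "v f = (\<Sum>b\<in>Basis. v (\<lambda>q. \<phi> q \<bullet> b) * chart_tvec A (U, \<phi>) p b f)"
    by (rule tangent_expand[OF assms(1) c])
  also have "\<dots> = (\<Sum>b\<in>Basis. w (\<lambda>q. \<phi> q \<bullet> b) * chart_tvec A (U, \<phi>) p b f)"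
    by (simp add: assms(5))
  also have "\<dots> = w f" by (rule tangent_expand[OF assms(2) c, symmetric])
  finally show "v f = w f" .
qed

lemma tangent_sumI:
  assumes "p \<in> points A" "\<And>i. i \<in> I \<Longrightarrow> v i \<in> tangent p"
  shows "(\<lambda>f. \<Sum>i\<in>I. s i * v i f) \<in> tangent p"
proof -
  obtain U \<phi> where c: "(U, \<phi>) \<in> A" "p \<in> U" using assms(1) by (rule points_chart)
  have "\<forall>i\<in>I. \<exists>w. v i = chart_tvec A (U, \<phi>) p w" using tangentE[OF assms(2) c] by metis
  then obtain w where w: "\<And>i. i \<in> I \<Longrightarrow> v i = chart_tvec A (U, \<phi>) p (w i)" by metis
  have "(\<lambda>f. \<Sum>i\<in>I. s i * v i f) = chart_tvec A (U, \<phi>) p (\<Sum>i\<in>I. s i *\<^sub>R w i)"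
    by (intro ext) (simp add: w linear_sum[OF linear_chart_tvec[OF c]] linear_cmul[OF linear_chart_tvec[OF c]])
  then show ?thesis using chart_tvec_in_tangent[OF c] by simp
qed

lemma tangent_zero: "p \<in> points A \<Longrightarrow> (\<lambda>f. 0) \<in> tangent p"
  using tangent_sumI[of p "{}"] by simp

lemma tangent_lincomb:
  assumes "v \<in> tangent p" "w \<in> tangent p"
  shows "(\<lambda>f. s * v f + t * w f) \<in> tangent p"
  using tangent_sumI[OF tangent_points[OF assms(1)], of "UNIV :: bool set" "\<lambda>i. if i then w else v" "\<lambda>i. if i then t else s"] assms
  by (simp add: UNIV_bool add.commute)

lemma tangent_scale: "v \<in> tangent p \<Longrightarrow> (\<lambda>f. s * v f) \<in> tangent p"
  using tangent_lincomb[of v p v s 0] by simp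

text \<open>Expresses iterated derivatives along coordinate fields by iterated derivatives in the
  chart, the form in which the symmetry of mixed derivatives applies.\<close>

lemma chart_tvec_sm:
  assumes c: "(U, \<phi>) \<in> A" "p \<in> U" and f: "f \<in> sm p"
  shows "(\<lambda>q. chart_tvec A (U, \<phi>) q w f) \<in> sm p"
    and "v \<in> tangent p \<Longrightarrow> v (\<lambda>q. chart_tvec A (U, \<phi>) q w f)
      = frechet_derivative (\<lambda>x. frechet_derivative (\<lambda>x. f (inv_into U \<phi> x)) (at x) w) (at (\<phi> p))
          (\<Sum>b\<in>Basis. v (\<lambda>q. \<phi> q \<bullet> b) *\<^sub>R b)"
proof -
  let ?F = "\<lambda>x. f (inv_into U \<phi> x)"
  let ?D = "\<lambda>x. frechet_derivative ?F (at x) w"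
  have F: "smooth_at ?F (\<phi> p)" using f sm_iff[OF c] by blast
  have e: "eventually (\<lambda>x. ?D x = chart_tvec A (U, \<phi>) (inv_into U \<phi> x) w f) (nhds (\<phi> p))"
    using eventually_nhds_chart[OF c] sm_eventually[OF f, unfolded eventually_near_chart[OF c]]
    by eventually_elim (simp add: chart_tvec_eq)
  have D: "smooth_at ?D (\<phi> p)" using F by (rule smooth_at_frechet_derivative)
  show *: "(\<lambda>q. chart_tvec A (U, \<phi>) q w f) \<in> sm p"
    unfolding sm_iff[OF c] using D e by (rule smooth_at_cong)
  show "v (\<lambda>q. chart_tvec A (U, \<phi>) q w f)
      = frechet_derivative ?D (at (\<phi> p)) (\<Sum>b\<in>Basis. v (\<lambda>q. \<phi> q \<bullet> b) *\<^sub>R b)" if tan: "v \<in> tangent p"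
  proof -
    obtain u where v: "v = chart_tvec A (U, \<phi>) p u" using tangentE[OF tan c] .
    show ?thesis
      using frechet_derivative_cong[OF D e]
      by (simp add: v chart_tvec_coord[OF c] chart_tvec_eq[OF *] euclidean_representation)
  qed
qed


section \<open>Vector fields, covectors and one-forms\<close>

lemma vector_field_tangent: "vector_field A X \<Longrightarrow> p \<in> points A \<Longrightarrow> X p \<in> tangent p"
  and vector_field_sm: "vector_field A X \<Longrightarrow> f \<in> sm p \<Longrightarrow> (\<lambda>q. X q f) \<in> sm p"
  and vector_field_outside: "vector_field A X \<Longrightarrow> p \<notin> points A \<Longrightarrow> X p = (\<lambda>_. 0)"
  using sm_points by (auto simp: vector_field_def)

text \<open>By the expansion of a tangent vector, smoothness against the coordinates of one chart at
  each point implies smoothness against all functions.\<close>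

lemma vector_fieldI:
  assumes tan: "\<And>p. p \<in> points A \<Longrightarrow> X p \<in> tangent p"
    and out: "\<And>p. p \<notin> points A \<Longrightarrow> X p = (\<lambda>_. 0)"
    and sm: "\<And>p. p \<in> points A \<Longrightarrow> \<exists>U \<phi>. (U, \<phi>) \<in> A \<and> p \<in> U \<and> (\<forall>b\<in>Basis. (\<lambda>q. X q (\<lambda>q. \<phi> q \<bullet> b)) \<in> sm p)"
  shows "vector_field A X"
  unfolding vector_field_def
proof (intro conjI ballI allI impI tan out)
  fix p f assume p: "p \<in> points A" and f: "f \<in> sm p"
  obtain U \<phi> where c: "(U, \<phi>) \<in> A" "p \<in> U" and s: "\<And>b. b \<in> Basis \<Longrightarrow> (\<lambda>q. X q (\<lambda>q. \<phi> q \<bullet> b)) \<in> sm p"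
    using sm[OF p] by auto
  have "(\<lambda>q. \<Sum>b\<in>Basis. X q (\<lambda>q. \<phi> q \<bullet> b) * chart_tvec A (U, \<phi>) q b f) \<in> sm p"
    by (intro sm_sum sm_mult s chart_tvec_sm c f p)
  moreover have "eventually (\<lambda>q. (\<Sum>b\<in>Basis. X q (\<lambda>q. \<phi> q \<bullet> b) * chart_tvec A (U, \<phi>) q b f) = X q f) (near p)"
    using eventually_near_dom[OF c]
    by eventually_elim (use tangent_expand[OF tan[OF chart_points[OF c(1)]] c(1)] in \<open>simp\<close>)
  ultimately show "(\<lambda>q. X q f) \<in> sm p" by (rule sm_cong)
qed

text \<open>The second-order terms of \<open>XY - YX\<close> cancel because mixed partial derivatives commute.\<close>

lemma lie_bracket_tangent:
  assumes X: "vector_field A X" and Y: "vector_field A Y" and p: "p \<in> points A"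
  shows "lie_bracket A X Y p \<in> tangent p"
proof -
  obtain U \<phi> where c: "(U, \<phi>) \<in> A" "p \<in> U" using p by (rule points_chart)
  let ?x = "\<lambda>b q. \<phi> q \<bullet> b"
  let ?d = "\<lambda>b q. chart_tvec A (U, \<phi>) q b"
  have second: "Z p (\<lambda>q. W q f) = (\<Sum>b\<in>Basis. Z p (\<lambda>q. W q (?x b)) * ?d b p f)
      + (\<Sum>a\<in>Basis. \<Sum>b\<in>Basis. W p (?x a) * (Z p (?x b) * ?d b p (\<lambda>q. ?d a q f)))"
    if Z: "vector_field A Z" and W: "vector_field A W" and f: "f \<in> sm p" for Z W f
  proof -
    have z: "Z p \<in> tangent p" using Z p by (rule vector_field_tangent)
    have "Z p (\<lambda>q. W q f) = Z p (\<lambda>q. \<Sum>b\<in>Basis. W q (?x b) * ?d b q f)"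
    proof (rule tangent_cong[OF z])
      show "eventually (\<lambda>q. W q f = (\<Sum>b\<in>Basis. W q (?x b) * ?d b q f)) (near p)"
        using eventually_near_dom[OF c]
        by eventually_elim
          (use tangent_expand[OF vector_field_tangent[OF W chart_points[OF c(1)]] c(1)] in simp)
    qed
    also have "\<dots> = (\<Sum>b\<in>Basis. W p (?x b) * Z p (\<lambda>q. ?d b q f) + Z p (\<lambda>q. W q (?x b)) * ?d b p f)"
      by (simp add: tangent_sum[OF z] tangent_mult[OF z] sm_mult vector_field_sm[OF W] sm_coord[OF c] chart_tvec_sm[OF c f])
    also have "\<dots> = (\<Sum>b\<in>Basis. Z p (\<lambda>q. W q (?x b)) * ?d b p f)
      + (\<Sum>a\<in>Basis. W p (?x a) * (\<Sum>b\<in>Basis. Z p (?x b) * ?d b p (\<lambda>q. ?d a q f)))"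
      by (simp add: sum.distrib tangent_expand[OF z c, of "\<lambda>q. ?d _ q f"])
    finally show ?thesis by (simp add: sum_distrib_left)
  qed
  have sym: "?d b p (\<lambda>q. ?d a q f) = ?d a p (\<lambda>q. ?d b q f)" if "f \<in> sm p" for a b f
    using mixed_derivatives_commute[of "\<lambda>x. f (inv_into U \<phi> x)" "\<phi> p" a b] that sm_iff[OF c]
    by (simp add: chart_tvec_sm(2)[OF c that chart_tvec_in_tangent[OF c]] chart_tvec_coord[OF c] euclidean_representation)
  let ?v = "\<lambda>f. \<Sum>b\<in>Basis. (X p (\<lambda>q. Y q (?x b)) - Y p (\<lambda>q. X q (?x b))) * ?d b p f"
  have "lie_bracket A X Y p f = ?v f" for f
  proof (cases "f \<in> sm p")
    case True
    have "(\<Sum>a\<in>Basis. \<Sum>b\<in>Basis. Y p (?x a) * (X p (?x b) * ?d b p (\<lambda>q. ?d a q f)))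
        = (\<Sum>b\<in>Basis. \<Sum>a\<in>Basis. X p (?x b) * (Y p (?x a) * ?d a p (\<lambda>q. ?d b q f)))"
      by (subst sum.swap) (simp add: sym[OF True] mult.left_commute)
    then show ?thesis
      using True by (simp add: lie_bracket_def second[OF X Y] second[OF Y X] left_diff_distrib sum_subtractf)
  qed (simp add: lie_bracket_def chart_tvec_outside)
  then have "lie_bracket A X Y p = ?v" by (rule ext)
  then show ?thesis
    using tangent_sumI[OF p, of Basis "\<lambda>b. ?d b p"] chart_tvec_in_tangent[OF c] by simp
qed

end


context atlas
begin

lemma smooth_fun_sm: "smooth_fun A f \<Longrightarrow> p \<in> points A \<Longrightarrow> f \<in> sm p"
  by (simp add: smooth_fun_def)

lemma vector_field_sum:
  assumes "\<And>b. b \<in> B \<Longrightarrow> smooth_fun A (g b)" "\<And>b. b \<in> B \<Longrightarrow> vector_field A (E b)"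
  shows "vector_field A (\<lambda>q f. \<Sum>b\<in>B. g b q * E b q f)"
  unfolding vector_field_def
proof (intro conjI ballI allI impI)
  fix p f assume p: "p \<in> points A"
  show "(\<lambda>f. \<Sum>b\<in>B. g b p * E b p f) \<in> tangent p"
    by (intro tangent_sumI vector_field_tangent assms p)
  show "(\<lambda>q. \<Sum>b\<in>B. g b q * E b q f) \<in> sm p" if "f \<in> sm p"
    by (rule sm_sum[OF p], rule sm_mult[OF smooth_fun_sm[OF assms(1) p] vector_field_sm[OF assms(2) that]])
next
  fix p assume "p \<notin> points A"
  then show "(\<lambda>f. \<Sum>b\<in>B. g b p * E b p f) = (\<lambda>_. 0)"
    by (intro ext sum.neutral ballI) (simp add: vector_field_outside[OF assms(2)])
qed

lemma smooth_fun_const: "smooth_fun A (\<lambda>q. k)"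
  by (simp add: smooth_fun_def)

lemma vector_field_mult: "smooth_fun A g \<Longrightarrow> vector_field A X \<Longrightarrow> vector_field A (vf_mult g X)"
  using vector_field_sum[of "{()}" "\<lambda>_. g" "\<lambda>_. X"] by (simp add: vf_mult_def)

lemma vector_field_add: "vector_field A X \<Longrightarrow> vector_field A Y \<Longrightarrow> vector_field A (vf_add X Y)"
  using vector_field_sum[of "UNIV :: bool set" "\<lambda>_ _. 1" "\<lambda>i. if i then Y else X"]
  by (simp add: UNIV_bool vf_add_def smooth_fun_const add.commute)

lemma vector_field_diff: "vector_field A X \<Longrightarrow> vector_field A Y \<Longrightarrow> vector_field A (vf_diff X Y)"
  using vector_field_add[of X "vf_mult (\<lambda>_. - 1) Y"] vector_field_mult[of "\<lambda>_. - 1" Y]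
  by (simp add: smooth_fun_const vf_add_def vf_mult_def vf_diff_def)

abbreviation cotangent :: "'m \<Rightarrow> 'm cov set" where
  "cotangent p \<equiv> cotangent_space A p"

lemma cotangent_lincomb:
  "a \<in> cotangent p \<Longrightarrow> v \<in> tangent p \<Longrightarrow> w \<in> tangent p \<Longrightarrow> a (\<lambda>f. s * v f + t * w f) = s * a v + t * a w"
  by (simp add: cotangent_space_def)

lemma cotangent_sum:
  assumes a: "a \<in> cotangent p" and p: "p \<in> points A" and "\<And>i. i \<in> I \<Longrightarrow> v i \<in> tangent p"
  shows "a (\<lambda>f. \<Sum>i\<in>I. s i * v i f) = (\<Sum>i\<in>I. s i * a (v i))"
proof -
  have 0: "a (\<lambda>f. 0) = 0"
    using cotangent_lincomb[OF a tangent_zero tangent_zero, of 0 0] p by simp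
  show ?thesis
  proof (cases "finite I")
    case True
    then show ?thesis using assms(3)
    proof (induction I)
      case (insert i I)
      then show ?case
        using cotangent_lincomb[OF a, of "v i" "\<lambda>f. \<Sum>i\<in>I. s i * v i f" "s i" 1] tangent_sumI[OF p, of I v s] by simp
    qed (simp add: 0)
  qed (simp add: 0)
qed

lemma cotangent_eqI:
  assumes "a \<in> cotangent p" "b \<in> cotangent p" "\<And>v. v \<in> tangent p \<Longrightarrow> a v = b v"
  shows "a = b"
proof
  fix v show "a v = b v"
    using assms by (cases "v \<in> tangent p") (auto simp: cotangent_space_def)
qed

lemma differential_cotangent: "f \<in> sm p \<Longrightarrow> differential A f p \<in> cotangent p"
  unfolding cotangent_space_def differential_def using tangent_lincomb by auto

lemma one_form_cotangent: "one_form A \<alpha> \<Longrightarrow> p \<in> points A \<Longrightarrow> \<alpha> p \<in> cotangent p"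
  and one_form_sm: "one_form A \<alpha> \<Longrightarrow> vector_field A X \<Longrightarrow> p \<in> points A \<Longrightarrow> (\<lambda>q. \<alpha> q (X q)) \<in> sm p"
  by (auto simp: one_form_def smooth_fun_def)

text \<open>Hausdorffness enters here: it makes compact subsets of a chart domain closed, so that a cutoff
  function extends by zero.\<close>

lemma bump:
  assumes H: "Hausdorff_space (atlas_topology A)" and p: "p \<in> points A" and P: "eventually P (near p)"
  obtains \<kappa> where "smooth_fun A \<kappa>" "eventually (\<lambda>q. \<kappa> q = 1) (near p)"
    "\<And>q. q \<in> points A \<Longrightarrow> P q \<or> eventually (\<lambda>q. \<kappa> q = 0) (near q)"
    "\<And>q. \<kappa> q \<noteq> 0 \<Longrightarrow> P q \<and> q \<in> points A"
proof -
  obtain U \<phi> where c: "(U, \<phi>) \<in> A" "p \<in> U" using p by (rule points_chart)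
  have "eventually (\<lambda>x. P (inv_into U \<phi> x) \<and> inv_into U \<phi> x \<in> U \<and> \<phi> (inv_into U \<phi> x) = x) (nhds (\<phi> p))"
    using P eventually_nhds_chart[OF c] by (simp add: eventually_near_chart[OF c] eventually_conj_iff)
  then obtain s where s: "0 < s" "\<And>x. dist x (\<phi> p) < s \<Longrightarrow> P (inv_into U \<phi> x) \<and> inv_into U \<phi> x \<in> U \<and> \<phi> (inv_into U \<phi> x) = x"
    unfolding eventually_nhds_metric by auto
  \<comment> \<open>A third of \<open>s\<close>, so that the closed ball of radius
    \<open>2 * d\<close>, outside which the cutoff vanishes, still lies in the chart and in the
    region where \<open>P\<close> holds.\<close>
  define d where "d = s / 3"
  have d: "0 < d" "2 * d < s" using s(1) by (auto simp: d_def)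
  define K where "K = inv_into U \<phi> ` cball (\<phi> p) (2 * d)"
  define \<kappa> where "\<kappa> = (\<lambda>q. if q \<in> U then cutoff (\<phi> p) d (\<phi> q) else 0)"
  have sub: "x \<in> \<phi> ` U" if "x \<in> cball (\<phi> p) (2 * d)" for x
    using s(2)[of x] d that by (metis dist_commute image_eqI le_less_trans mem_cball)
  have KP: "P q" "q \<in> U" if "q \<in> K" for q
    using that s(2) d by (auto simp: K_def dist_commute)
  have "compactin (top_of_set (\<phi> ` U)) (cball (\<phi> p) (2 * d))"
    using sub by (auto simp: compactin_subtopology)
  then have "compactin (atlas_topology A) K"
    unfolding K_def using continuous_map_chart_inv[OF c(1)] by (rule image_compactin)
  then have "closedin (atlas_topology A) K" using H by (rule compactin_imp_closedin[rotated])
  then have op: "openin (atlas_topology A) (points A - K)" by (simp add: closedin_def)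
  have \<kappa>0: "\<kappa> q = 0" if "q \<notin> K" for q
  proof (cases "q \<in> U")
    case True
    have "\<phi> q \<notin> cball (\<phi> p) (2 * d)"
      using that chart_inv[OF c(1) True] unfolding K_def by force
    then show ?thesis using d by (simp add: \<kappa>_def dist_commute cutoff_eq_0)
  qed (simp add: \<kappa>_def)
  \<comment> \<open>Openness of the complement of \<open>K\<close> upgrades vanishing off
    \<open>K\<close> to vanishing near each such point. This is what makes a product with
    \<open>\<kappa>\<close> smooth where the other factor is arbitrary.\<close>
  have out: "eventually (\<lambda>q. \<kappa> q = 0) (near q)" if "q \<in> points A" "q \<notin> K" for q
    unfolding eventually_nhdsin using op that \<kappa>0 by (intro disjI2 exI[of _ "points A - K"]) auto
  have "\<kappa> \<in> sm q" if q: "q \<in> points A" for q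
  proof (cases "q \<in> K")
    case True
    have qU: "q \<in> U" using KP True by simp
    show ?thesis
      unfolding sm_iff[OF c(1) qU]
    proof (rule smooth_at_cong[OF smooth_at_cutoff])
      show "eventually (\<lambda>x. cutoff (\<phi> p) d x = \<kappa> (inv_into U \<phi> x)) (nhds (\<phi> q))"
        using eventually_nhds_chart[OF c(1) qU] by eventually_elim (simp add: \<kappa>_def)
    qed
  next
    case False
    show ?thesis
      by (rule sm_cong[OF sm_const[OF q, of 0]]) (use out[OF q False] in \<open>auto elim: eventually_mono\<close>)
  qed
  then have "smooth_fun A \<kappa>" by (simp add: smooth_fun_def)
  moreover have "eventually (\<lambda>q. \<kappa> q = 1) (near p)"
  proof -
    have "eventually (\<lambda>x. dist x (\<phi> p) < d) (nhds (\<phi> p))"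
      using d(1) by (auto simp: eventually_nhds_metric)
    with eventually_nhds_chart[OF c] show ?thesis
      unfolding eventually_near_chart[OF c] by eventually_elim (simp add: \<kappa>_def cutoff_eq_1)
  qed
  moreover have "P q \<or> eventually (\<lambda>q. \<kappa> q = 0) (near q)" if "q \<in> points A" for q
    using KP out that by blast
  moreover have "P q \<and> q \<in> points A" if "\<kappa> q \<noteq> 0" for q
    using \<kappa>0 KP chart_points[OF c(1)] that by blast
  ultimately show ?thesis by (rule that)
qed

end


section \<open>Connections on an affine manifold are pointwise objects\<close>

locale affine = atlas A for A :: "('m, 'e::euclidean_space) atlas" +
  fixes D :: "'m conn"
  assumes affine: "affine_manifold A D"
begin

lemma hausdorff: "Hausdorff_space (atlas_topology A)"
  using affine by (simp add: affine_manifold_def smooth_manifold_def)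

text \<open>Needed because the Leibniz rule of a connection accepts only globally smooth
  coefficients. Multiplication by a cutoff that lives where \<open>f\<close> is smooth keeps the
  germ at \<open>p\<close>.\<close>

lemma extend_function:
  assumes "f \<in> sm p"
  obtains g where "smooth_fun A g" "eventually (\<lambda>q. g q = f q) (near p)"
proof -
  have p: "p \<in> points A" using assms by (rule sm_points)
  obtain \<kappa> where \<kappa>: "smooth_fun A \<kappa>" "eventually (\<lambda>q. \<kappa> q = 1) (near p)"
    "\<And>q. q \<in> points A \<Longrightarrow> f \<in> sm q \<or> eventually (\<lambda>q. \<kappa> q = 0) (near q)"
    using bump[OF hausdorff p sm_eventually[OF assms]] by metis
  have "(\<lambda>q. \<kappa> q * f q) \<in> sm q" if q: "q \<in> points A" for q
    using \<kappa>(3)[OF q]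
  proof
    assume "eventually (\<lambda>q. \<kappa> q = 0) (near q)"
    then show ?thesis by (intro sm_cong[OF sm_const[OF q, of 0]]) (auto elim: eventually_mono)
  qed (rule sm_mult[OF smooth_fun_sm[OF \<kappa>(1) q]])
  then show ?thesis
    using \<kappa>(2) by (intro that[of "\<lambda>q. \<kappa> q * f q"]) (auto simp: smooth_fun_def elim: eventually_mono)
qed

text \<open>Globally defined coordinates \<open>x\<close> and coordinate fields \<open>E\<close> near \<open>p\<close>, cut off by \<open>\<kappa>\<close>.\<close>

definition frame :: "'m \<Rightarrow> ('e \<Rightarrow> 'm \<Rightarrow> real) \<Rightarrow> ('e \<Rightarrow> 'm vfield) \<Rightarrow> ('m \<Rightarrow> real) \<Rightarrow> bool" where
  "frame p x E \<kappa> \<longleftrightarrow> smooth_fun A \<kappa> \<and> eventually (\<lambda>q. \<kappa> q = 1) (near p) \<and>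
     (\<forall>b. smooth_fun A (x b) \<and> vector_field A (E b)) \<and>
     (\<forall>q v f. v \<in> tangent q \<longrightarrow> \<kappa> q * v f = (\<Sum>b\<in>Basis. \<kappa> q * v (x b) * E b q f))"

text \<open>Two cutoffs are nested. \<open>\<eta>\<close> makes coordinates and coordinate fields
  global but distorts them where it varies; \<open>\<kappa>\<close> is nonzero only where
  \<open>\<eta>\<close> is 1 on a whole neighbourhood, so that there the cut-off coordinates have
  the derivatives of the true ones. Hence the expansion multiplied by \<open>\<kappa>\<close> is
  valid everywhere.\<close>

lemma frame_exists:
  assumes p: "p \<in> points A"
  obtains x E \<kappa> where "frame p x E \<kappa>"
proof -
  obtain U \<phi> where c: "(U, \<phi>) \<in> A" "p \<in> U" using p by (rule points_chart)
  obtain \<eta> where \<eta>: "smooth_fun A \<eta>" "eventually (\<lambda>q. \<eta> q = 1) (near p)"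
    "\<And>q. q \<in> points A \<Longrightarrow> q \<in> U \<or> eventually (\<lambda>q. \<eta> q = 0) (near q)"
    "\<And>q. \<eta> q \<noteq> 0 \<Longrightarrow> q \<in> U \<and> q \<in> points A"
    using bump[OF hausdorff p eventually_near_dom[OF c]] by metis
  have "eventually (\<lambda>q. eventually (\<lambda>q. \<eta> q = 1) (near q)) (near p)"
    using \<eta>(2) by (rule eventually_eventually_near)
  from bump[OF hausdorff p this]
  obtain \<kappa> where \<kappa>: "smooth_fun A \<kappa>" "eventually (\<lambda>q. \<kappa> q = 1) (near p)"
    "\<And>q. \<kappa> q \<noteq> 0 \<Longrightarrow> eventually (\<lambda>q. \<eta> q = 1) (near q) \<and> q \<in> points A"
    by metis
  define x where "x = (\<lambda>b q. \<eta> q * (\<phi> q \<bullet> b))"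
  define E where "E = (\<lambda>b q f. \<eta> q * chart_tvec A (U, \<phi>) q b f)"
  have loc: "(\<lambda>q. \<eta> q * h q) \<in> sm q" if q: "q \<in> points A" and h: "q \<in> U \<Longrightarrow> h \<in> sm q" for h q
    using \<eta>(3)[OF q]
  proof
    assume "eventually (\<lambda>q. \<eta> q = 0) (near q)"
    then show ?thesis by (intro sm_cong[OF sm_const[OF q, of 0]]) (auto elim: eventually_mono)
  qed (rule sm_mult[OF smooth_fun_sm[OF \<eta>(1) q] h])
  have "smooth_fun A (x b)" for b
    unfolding smooth_fun_def x_def by (intro ballI, rule loc, assumption, rule sm_coord[OF c(1)])
  moreover have "vector_field A (E b)" for b
    unfolding vector_field_def E_def
  proof (intro conjI ballI allI impI)
    fix q assume q: "q \<in> points A"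
    show "(\<lambda>f. \<eta> q * chart_tvec A (U, \<phi>) q b f) \<in> tangent q"
    proof (cases "\<eta> q = 0")
      case False
      then show ?thesis using \<eta>(4)[of q] by (intro tangent_scale chart_tvec_in_tangent c) auto
    qed (simp add: tangent_zero q)
    show "(\<lambda>q. \<eta> q * chart_tvec A (U, \<phi>) q b f) \<in> sm q" if "f \<in> sm q" for f
      by (rule loc[OF q], rule chart_tvec_sm(1)[OF c(1) _ that])
  qed (use \<eta>(4) in fastforce)
  moreover have "\<kappa> q * v f = (\<Sum>b\<in>Basis. \<kappa> q * v (x b) * E b q f)" if v: "v \<in> tangent q" for q v f
  proof (cases "\<kappa> q = 0")
    case False
    then have q: "eventually (\<lambda>q. \<eta> q = 1) (near q)" "q \<in> points A" using \<kappa>(3) by auto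
    have 1: "\<eta> q = 1" using eventually_near_self[OF q] .
    then have "q \<in> U" using \<eta>(4)[of q] by simp
    moreover have "v (x b) = v (\<lambda>q. \<phi> q \<bullet> b)" for b
      by (rule tangent_cong[OF v]) (use q(1) in \<open>auto simp: x_def elim: eventually_mono\<close>)
    ultimately show ?thesis
      by (subst tangent_expand[OF v c(1)]) (auto simp: E_def 1 sum_distrib_left mult.assoc)
  qed simp
  ultimately show ?thesis using \<kappa> that[of x E \<kappa>] by (auto simp: frame_def)
qed

context
  fixes p x E \<kappa>
  assumes p: "p \<in> points A" and frame: "frame p x E \<kappa>"
begin

lemma frame_cutoff: "smooth_fun A \<kappa>" "eventually (\<lambda>q. \<kappa> q = 1) (near p)" "\<kappa> p = 1"
  using frame eventually_near_self[OF _ p] by (auto simp: frame_def)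

lemma frame_coord: "smooth_fun A (x b)" and frame_field: "vector_field A (E b)"
  using frame by (auto simp: frame_def)

lemma frame_expand_cut: "v \<in> tangent q \<Longrightarrow> \<kappa> q * v f = (\<Sum>b\<in>Basis. \<kappa> q * v (x b) * E b q f)"
  using frame by (auto simp: frame_def)

lemma frame_expand: "v \<in> tangent p \<Longrightarrow> v = (\<lambda>f. \<Sum>b\<in>Basis. v (x b) * E b p f)"
proof
  fix f assume "v \<in> tangent p"
  from frame_expand_cut[OF this, of f] show "v f = (\<Sum>b\<in>Basis. v (x b) * E b p f)"
    by (simp add: frame_cutoff(3))
qed

lemma frame_expand_near: "eventually (\<lambda>q. \<forall>v\<in>tangent q. v = (\<lambda>f. \<Sum>b\<in>Basis. v (x b) * E b q f)) (near p)"
  using frame_cutoff(2)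
proof eventually_elim
  case (elim q)
  show ?case
  proof (intro ballI ext)
    fix v f assume "v \<in> tangent q"
    from frame_expand_cut[OF this, of f] show "v f = (\<Sum>b\<in>Basis. v (x b) * E b q f)"
      by (simp add: elim)
  qed
qed

text \<open>An identity between global fields, hence one to which the axioms of a connection can be
  applied.\<close>

lemma frame_expand_field:
  assumes "vector_field A X"
  shows "vf_mult \<kappa> X = (\<lambda>q f. \<Sum>b\<in>Basis. (\<kappa> q * X q (x b)) * E b q f)"
proof (intro ext)
  fix q f
  show "vf_mult \<kappa> X q f = (\<Sum>b\<in>Basis. (\<kappa> q * X q (x b)) * E b q f)"
  proof (cases "q \<in> points A")
    case True
    then show ?thesis
      using frame_expand_cut[OF vector_field_tangent[OF assms]] by (simp add: vf_mult_def)
  next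
    case False
    then show ?thesis using vector_field_outside[OF assms] by (simp add: vf_mult_def)
  qed
qed

end

lemma extend_tangent:
  assumes "v \<in> tangent p"
  obtains V where "vector_field A V" "V p = v"
proof -
  have p: "p \<in> points A" using assms by (rule tangent_points)
  obtain x E \<kappa> where fr: "frame p x E \<kappa>" using frame_exists[OF p] .
  show ?thesis
  proof (rule that)
    show "vector_field A (\<lambda>q f. \<Sum>b\<in>Basis. v (x b) * E b q f)"
      by (rule vector_field_sum) (auto simp: smooth_fun_const frame_field[OF p fr])
    show "(\<lambda>f. \<Sum>b\<in>Basis. v (x b) * E b p f) = v" by (rule frame_expand[OF p fr assms, symmetric])
  qed
qed

section \<open>Tensoriality and locality of the connection\<close>

lemma connection: "connection A D"
  using affine by (simp add: affine_manifold_def)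

lemma D_field: "vector_field A X \<Longrightarrow> vector_field A Y \<Longrightarrow> vector_field A (D X Y)"
  and D_add1: "vector_field A X \<Longrightarrow> vector_field A Y \<Longrightarrow> vector_field A Z \<Longrightarrow>
    D (vf_add X Y) Z = vf_add (D X Z) (D Y Z)"
  and D_add2: "vector_field A X \<Longrightarrow> vector_field A Y \<Longrightarrow> vector_field A Z \<Longrightarrow>
    D X (vf_add Y Z) = vf_add (D X Y) (D X Z)"
  and D_mult1: "smooth_fun A f \<Longrightarrow> vector_field A X \<Longrightarrow> vector_field A Y \<Longrightarrow>
    D (vf_mult f X) Y = vf_mult f (D X Y)"
  and D_mult2: "smooth_fun A f \<Longrightarrow> vector_field A X \<Longrightarrow> vector_field A Y \<Longrightarrow>
    D X (vf_mult f Y) = vf_add (vf_mult (\<lambda>p. X p f) Y) (vf_mult f (D X Y))"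
  using connection unfolding connection_def by blast+

lemma torsion:
  assumes "vector_field A X" "vector_field A Y"
  shows "lie_bracket A X Y = vf_diff (D X Y) (D Y X)"
  using affine assms by (auto simp: affine_manifold_def torsion_free_def)

lemma torsion_apply:
  "vector_field A X \<Longrightarrow> vector_field A Y \<Longrightarrow> f \<in> sm p \<Longrightarrow>
    X p (\<lambda>q. Y q f) = Y p (\<lambda>q. X q f) + D X Y p f - D Y X p f"
  using fun_cong[OF fun_cong[OF torsion[of X Y]], of p f] by (simp add: lie_bracket_def vf_diff_def)

lemma flat:
  "vector_field A X \<Longrightarrow> vector_field A Y \<Longrightarrow> vector_field A Z \<Longrightarrow>
    D X (D Y Z) p f = D Y (D X Z) p f + D (lie_bracket A X Y) Z p f"
proof -
  assume "vector_field A X" "vector_field A Y" "vector_field A Z"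
  then have "vf_diff (D X (D Y Z)) (D Y (D X Z)) = D (lie_bracket A X Y) Z"
    using affine by (simp add: affine_manifold_def flat_def)
  from fun_cong[OF fun_cong[OF this], of p f] show ?thesis by (simp add: vf_diff_def)
qed

lemma vector_field_zero: "vector_field A (\<lambda>_ _. 0)"
  using vector_field_sum[of "{}"] by simp

lemma D_zero:
  assumes "vector_field A X"
  shows "D (\<lambda>_ _. 0) X = (\<lambda>_ _. 0)" "D X (\<lambda>_ _. 0) = (\<lambda>_ _. 0)"
proof -
  have "vf_mult (\<lambda>_. 0) X = (\<lambda>_ _. 0)" by (simp add: vf_mult_def)
  then show "D (\<lambda>_ _. 0) X = (\<lambda>_ _. 0)"
    using D_mult1[OF smooth_fun_const[of 0] assms assms] by (simp add: vf_mult_def)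
  have "D X (\<lambda>_ _. 0) = vf_add (D X (\<lambda>_ _. 0)) (D X (\<lambda>_ _. 0))"
    using D_add2[OF assms vector_field_zero vector_field_zero] by (simp add: vf_add_def)
  then show "D X (\<lambda>_ _. 0) = (\<lambda>_ _. 0)"
    by (simp add: vf_add_def fun_eq_iff)
qed

lemma D_sum1:
  assumes "finite B" and Y: "vector_field A Y"
    and "\<And>b. b \<in> B \<Longrightarrow> smooth_fun A (g b)" "\<And>b. b \<in> B \<Longrightarrow> vector_field A (E b)"
  shows "D (\<lambda>q f. \<Sum>b\<in>B. g b q * E b q f) Y = (\<lambda>p f. \<Sum>b\<in>B. g b p * D (E b) Y p f)"
  using assms(1,3,4)
proof (induction B)
  case (insert b B)
  have "(\<lambda>q f. \<Sum>b\<in>insert b B. g b q * E b q f) = vf_add (vf_mult (g b) (E b)) (\<lambda>q f. \<Sum>b\<in>B. g b q * E b q f)"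
    using insert by (simp add: vf_add_def vf_mult_def)
  moreover have "vector_field A (\<lambda>q f. \<Sum>b\<in>B. g b q * E b q f)"
    using insert by (intro vector_field_sum) auto
  ultimately show ?case
    using insert by (simp add: D_add1[OF vector_field_mult] D_mult1 Y) (simp add: vf_add_def vf_mult_def)
qed (simp add: D_zero[OF Y])

lemma D_sum2:
  assumes "finite B" and X: "vector_field A X"
    and "\<And>b. b \<in> B \<Longrightarrow> smooth_fun A (g b)" "\<And>b. b \<in> B \<Longrightarrow> vector_field A (E b)"
  shows "D X (\<lambda>q f. \<Sum>b\<in>B. g b q * E b q f) = (\<lambda>p f. \<Sum>b\<in>B. X p (g b) * E b p f + g b p * D X (E b) p f)"
  using assms(1,3,4)
proof (induction B)
  case (insert b B)
  have "(\<lambda>q f. \<Sum>b\<in>insert b B. g b q * E b q f) = vf_add (vf_mult (g b) (E b)) (\<lambda>q f. \<Sum>b\<in>B. g b q * E b q f)"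
    using insert by (simp add: vf_add_def vf_mult_def)
  moreover have "vector_field A (\<lambda>q f. \<Sum>b\<in>B. g b q * E b q f)"
    using insert by (intro vector_field_sum) auto
  ultimately show ?case
    using insert by (simp add: D_add2[OF X vector_field_mult] D_mult2 X) (simp add: vf_add_def vf_mult_def)
qed (simp add: D_zero[OF X])

context
  fixes p x E \<kappa>
  assumes p: "p \<in> points A" and frame: "frame p x E \<kappa>"
begin

lemma smooth_fun_cut: "vector_field A X \<Longrightarrow> smooth_fun A (\<lambda>q. \<kappa> q * X q (x b))"
  using frame_cutoff[OF p frame] frame_coord[OF p frame]
  by (simp add: smooth_fun_def sm_mult vector_field_sm)

text \<open>Since \<open>\<kappa> p = 1\<close>, replacing \<open>X\<close> by
  \<open>\<kappa>\<close> times \<open>X\<close> does not change the value at \<open>p\<close>;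
  linearity over functions in the first argument then gives the sum.\<close>

lemma D_expand1:
  assumes X: "vector_field A X" and Y: "vector_field A Y"
  shows "D X Y p f = (\<Sum>b\<in>Basis. X p (x b) * D (E b) Y p f)"
proof -
  have "D X Y p f = D (vf_mult \<kappa> X) Y p f"
    using D_mult1[OF frame_cutoff(1)[OF p frame] X Y] frame_cutoff(3)[OF p frame] by (simp add: vf_mult_def)
  also have "\<dots> = (\<Sum>b\<in>Basis. \<kappa> p * X p (x b) * D (E b) Y p f)"
    unfolding frame_expand_field[OF p frame X]
    by (subst D_sum1) (auto simp: Y smooth_fun_cut[OF X] frame_field[OF p frame])
  finally show ?thesis by (simp add: frame_cutoff(3)[OF p frame])
qed

text \<open>Here the cutoff enters through the Leibniz rule as well; the extra term contains
  \<open>X p \<kappa>\<close>, which vanishes because \<open>\<kappa>\<close> is constant near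
  \<open>p\<close>.\<close>

lemma D_expand2:
  assumes X: "vector_field A X" and Y: "vector_field A Y"
  shows "D X Y p f = (\<Sum>b\<in>Basis. X p (\<lambda>q. Y q (x b)) * E b p f + Y p (x b) * D X (E b) p f)"
proof -
  note Xp = vector_field_tangent[OF X p]
  have 1: "X p \<kappa> = 0"
    using tangent_cong[OF Xp frame_cutoff(2)[OF p frame]] tangent_const[OF Xp] by simp
  have 2: "X p (\<lambda>q. \<kappa> q * Y q (x b)) = X p (\<lambda>q. Y q (x b))" for b
    by (rule tangent_cong[OF Xp]) (use frame_cutoff(2)[OF p frame] in \<open>auto elim: eventually_mono\<close>)
  have "D X Y p f = D X (vf_mult \<kappa> Y) p f"
    using D_mult2[OF frame_cutoff(1)[OF p frame] X Y] frame_cutoff(3)[OF p frame] 1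
    by (simp add: vf_mult_def vf_add_def)
  also have "\<dots> = (\<Sum>b\<in>Basis. X p (\<lambda>q. \<kappa> q * Y q (x b)) * E b p f + \<kappa> p * Y p (x b) * D X (E b) p f)"
    unfolding frame_expand_field[OF p frame Y]
    by (subst D_sum2) (auto simp: X smooth_fun_cut[OF Y] frame_field[OF p frame])
  finally show ?thesis by (simp add: frame_cutoff(3)[OF p frame] 2)
qed

end

text \<open>Tensoriality in the first argument: a direction may be replaced by any field with the
  same value at the point, in particular by \<open>\<rho>\<close> of a fixed algebra
  element.\<close>

lemma D_cong1:
  assumes "vector_field A X" "vector_field A X'" "vector_field A Y" "p \<in> points A" "X p = X' p"
  shows "D X Y p = D X' Y p"
proof -
  obtain x E \<kappa> where fr: "frame p x E \<kappa>" using frame_exists[OF assms(4)] .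
  show ?thesis
    by (intro ext) (simp add: D_expand1[OF assms(4) fr] assms)
qed

lemma D_cong_lincomb:
  assumes "vector_field A X" "vector_field A X1" "vector_field A X2" "vector_field A Y" "p \<in> points A"
    and "X p = (\<lambda>f. s * X1 p f + t * X2 p f)"
  shows "D X Y p f = s * D X1 Y p f + t * D X2 Y p f"
proof -
  obtain x E \<kappa> where fr: "frame p x E \<kappa>" using frame_exists[OF assms(5)] .
  show ?thesis
    by (simp add: D_expand1[OF assms(5) fr] assms sum_distrib_left sum.distrib algebra_simps)
qed

text \<open>If \<open>X\<^sub>p \<noteq> 0\<close>, an arbitrary extension of \<open>v\<close> is corrected by a multiple \<open>h W\<close> with \<open>h(p) = 0\<close> and
  \<open>X\<^sub>p h = -1\<close>.\<close>

lemma parallel_extension: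
  assumes v: "v \<in> tangent p" and X: "vector_field A X"
  obtains \<sigma> where "vector_field A \<sigma>" "\<sigma> p = v" "D X \<sigma> p = (\<lambda>_. 0)"
proof -
  have p: "p \<in> points A" using v by (rule tangent_points)
  note Xp = vector_field_tangent[OF X p]
  obtain V where V: "vector_field A V" "V p = v" using extend_tangent[OF v] .
  show ?thesis
  proof (cases "X p = (\<lambda>_. 0)")
    case True
    then have "D X V p = (\<lambda>_. 0)"
      using D_cong1[OF X vector_field_zero V(1) p] D_zero(1)[OF V(1)] by simp
    then show ?thesis using that V by blast
  next
    case False
    then obtain f where f: "X p f \<noteq> 0" by auto
    then have "f \<in> sm p" using tangent_outside[OF Xp] by blast
    then obtain g where g: "smooth_fun A g" "eventually (\<lambda>q. g q = f q) (near p)" by (rule extend_function)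
    define k where "k = X p g"
    have k: "k \<noteq> 0" using f tangent_cong[OF Xp g(2)] by (simp add: k_def)
    \<comment> \<open>\<open>W\<close> extends the vector to be cancelled: with
      \<open>h p = 0\<close> and \<open>X p h = - 1\<close> the Leibniz rule for \<open>h\<close>
      times \<open>W\<close> contributes exactly minus \<open>D X V p\<close>.\<close>
    obtain W where W: "vector_field A W" "W p = D X V p"
      using extend_tangent[OF vector_field_tangent[OF D_field[OF X V(1)] p]] .
    define h where "h = (\<lambda>q. (- 1 / k) * (g q - g p))"
    have h: "smooth_fun A h"
      unfolding smooth_fun_def h_def
      by (intro ballI, rule sm_mult[OF sm_const sm_diff[OF smooth_fun_sm[OF g(1)] sm_const]])
    have gp: "g \<in> sm p" using g(1) p by (rule smooth_fun_sm)
    have "X p (\<lambda>q. g q - g p) = k"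
      using tangent_diff[OF Xp gp sm_const[OF p]] tangent_const[OF Xp] by (simp add: k_def)
    then have Xh: "X p h = - 1"
      unfolding h_def tangent_cmult[OF Xp sm_diff[OF gp sm_const[OF p]]] using k by simp
    have hp: "h p = 0" by (simp add: h_def)
    let ?\<sigma> = "vf_add V (vf_mult h W)"
    have "D X ?\<sigma> p = (\<lambda>_. 0)"
      by (simp add: D_add2[OF X V(1) vector_field_mult[OF h W(1)]] D_mult2[OF h X W(1)])
        (simp add: vf_add_def vf_mult_def Xh hp W(2))
    moreover have "?\<sigma> p = v" by (simp add: vf_add_def vf_mult_def hp V(2))
    ultimately show ?thesis
      using that vector_field_add[OF V(1) vector_field_mult[OF h W(1)]] by blast
  qed
qed

text \<open>The defining expression differentiates \<open>Y\<close>, so existence of the covector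
  means that the expression depends on \<open>Y p\<close> alone. In a frame, the derivatives of the
  components of \<open>Y\<close> occur in both of its terms and cancel. Uniqueness holds because
  every tangent vector at \<open>p\<close> extends to a field.\<close>

lemma nabla_form:
  assumes \<beta>: "one_form A \<beta>" and X: "vector_field A X" and p: "p \<in> points A"
  shows "nabla_form A D X \<beta> p \<in> cotangent p"
    and "vector_field A Y \<Longrightarrow> nabla_form A D X \<beta> p (Y p) = X p (\<lambda>q. \<beta> q (Y q)) - \<beta> p (D X Y p)"
proof -
  note Xp = vector_field_tangent[OF X p]
  obtain x E \<kappa> where fr: "frame p x E \<kappa>" using frame_exists[OF p] .
  define G where "G = (\<lambda>Y. X p (\<lambda>q. \<beta> q (Y q)) - \<beta> p (D X Y p))"
  define a where "a = (\<lambda>v. if v \<in> tangent p then \<Sum>b\<in>Basis. v (x b) * G (E b) else 0)"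
  have a: "a \<in> cotangent p"
    unfolding cotangent_space_def a_def
    by (auto simp: tangent_lincomb sum.distrib sum_distrib_left algebra_simps)
  have aY: "a (Y p) = G Y" if Y: "vector_field A Y" for Y
  proof -
    have xs: "x b \<in> sm q" if "q \<in> points A" for b q
      using frame_coord[OF p fr] that by (rule smooth_fun_sm)
    have Es: "vector_field A (E b)" for b by (rule frame_field[OF p fr])
    have "X p (\<lambda>q. \<beta> q (Y q)) = X p (\<lambda>q. \<Sum>b\<in>Basis. Y q (x b) * \<beta> q (E b q))"
    proof (rule tangent_cong[OF Xp])
      show "eventually (\<lambda>q. \<beta> q (Y q) = (\<Sum>b\<in>Basis. Y q (x b) * \<beta> q (E b q))) (near p)"
        using frame_expand_near[OF p fr] eventually_near_points
      proof eventually_elim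
        case (elim q)
        have "Y q = (\<lambda>f. \<Sum>b\<in>Basis. Y q (x b) * E b q f)"
          using elim vector_field_tangent[OF Y] by blast
        then have "\<beta> q (Y q) = \<beta> q (\<lambda>f. \<Sum>b\<in>Basis. Y q (x b) * E b q f)" by (rule arg_cong)
        also have "\<dots> = (\<Sum>b\<in>Basis. Y q (x b) * \<beta> q (E b q))"
          by (rule cotangent_sum[OF one_form_cotangent[OF \<beta> elim(2)] elim(2) vector_field_tangent[OF Es elim(2)]])
        finally show ?case .
      qed
    qed
    also have "\<dots> = (\<Sum>b\<in>Basis. Y p (x b) * X p (\<lambda>q. \<beta> q (E b q)) + X p (\<lambda>q. Y q (x b)) * \<beta> p (E b p))"
      by (simp add: tangent_sum[OF Xp] tangent_mult[OF Xp] sm_mult one_form_sm[OF \<beta> Es p] vector_field_sm[OF Y xs[OF p]])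
    finally have 1: "X p (\<lambda>q. \<beta> q (Y q)) = (\<Sum>b\<in>Basis. Y p (x b) * X p (\<lambda>q. \<beta> q (E b q)))
      + (\<Sum>b\<in>Basis. X p (\<lambda>q. Y q (x b)) * \<beta> p (E b p))" by (simp add: sum.distrib)
    have "D X Y p = (\<lambda>f. 1 * (\<Sum>b\<in>Basis. X p (\<lambda>q. Y q (x b)) * E b p f) + 1 * (\<Sum>b\<in>Basis. Y p (x b) * D X (E b) p f))"
      by (simp add: D_expand2[OF p fr X Y, abs_def] sum.distrib)
    then have "\<beta> p (D X Y p) = 1 * \<beta> p (\<lambda>f. \<Sum>b\<in>Basis. X p (\<lambda>q. Y q (x b)) * E b p f)
        + 1 * \<beta> p (\<lambda>f. \<Sum>b\<in>Basis. Y p (x b) * D X (E b) p f)"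
      by (simp only: cotangent_lincomb[OF one_form_cotangent[OF \<beta> p] tangent_sumI tangent_sumI]
          vector_field_tangent[OF Es] vector_field_tangent[OF D_field[OF X Es]] p)
    also have "\<dots> = (\<Sum>b\<in>Basis. X p (\<lambda>q. Y q (x b)) * \<beta> p (E b p)) + (\<Sum>b\<in>Basis. Y p (x b) * \<beta> p (D X (E b) p))"
      by (simp add: cotangent_sum[OF one_form_cotangent[OF \<beta> p] p] vector_field_tangent[OF Es]
          vector_field_tangent[OF D_field[OF X Es]] p)
    finally show ?thesis
      using vector_field_tangent[OF Y p] 1
      by (simp add: a_def G_def right_diff_distrib sum_subtractf)
  qed
  have uniq: "a' = a" if "a' \<in> cotangent p" "\<And>Y. vector_field A Y \<Longrightarrow> a' (Y p) = G Y" for a'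
  proof (rule cotangent_eqI[OF that(1) a])
    fix v assume "v \<in> tangent p"
    then obtain V where "vector_field A V" "V p = v" by (rule extend_tangent)
    then show "a' v = a v" using that(2) aY by metis
  qed
  have "nabla_form A D X \<beta> p = a"
    unfolding nabla_form_def
  proof (rule the_equality)
    show "a \<in> cotangent p \<and> (\<forall>Y. vector_field A Y \<longrightarrow>
        a (Y p) = X p (\<lambda>q. \<beta> q (Y q)) - \<beta> p (D X Y p))"
      using a aY unfolding G_def by blast
  next
    fix a' assume *: "a' \<in> cotangent p \<and> (\<forall>Y. vector_field A Y \<longrightarrow>
        a' (Y p) = X p (\<lambda>q. \<beta> q (Y q)) - \<beta> p (D X Y p))"
    show "a' = a" by (rule uniq) (use * in \<open>simp_all add: G_def\<close>)
  qed
  then show "nabla_form A D X \<beta> p \<in> cotangent p"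
    and "vector_field A Y \<Longrightarrow> nabla_form A D X \<beta> p (Y p) = X p (\<lambda>q. \<beta> q (Y q)) - \<beta> p (D X Y p)"
    using a aY by (auto simp: G_def)
qed

end


section \<open>The tangent bundle\<close>

context atlas
begin

text \<open>Inverse of \<open>chart_tvec A (U, \<phi>) p\<close> on the tangent space at a point of
  the chart domain.\<close>

definition vrep :: "('m \<Rightarrow> 'e) \<Rightarrow> 'm tvec \<Rightarrow> 'e" where
  "vrep \<phi> v = (\<Sum>b\<in>Basis. v (\<lambda>q. \<phi> q \<bullet> b) *\<^sub>R b)"

definition tmap :: "('m \<Rightarrow> 'e) \<Rightarrow> 'm \<times> 'm tvec \<Rightarrow> 'e \<times> 'e" where
  "tmap \<phi> z = (\<phi> (fst z), vrep \<phi> (snd z))"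

lemma tangent_bundle_eq: "tangent_bundle A = (\<lambda>(U, \<phi>). (Sigma U tangent, tmap \<phi>)) ` A"
  unfolding tangent_bundle_def tmap_def[abs_def] vrep_def by (simp add: case_prod_unfold)

lemma tangent_bundle_chart: "(U, \<phi>) \<in> A \<Longrightarrow> (Sigma U tangent, tmap \<phi>) \<in> tangent_bundle A"
  by (force simp: tangent_bundle_eq)

lemma tangent_bundleE:
  assumes "c \<in> tangent_bundle A"
  obtains U \<phi> where "(U, \<phi>) \<in> A" "c = (Sigma U tangent, tmap \<phi>)"
proof -
  obtain U \<phi> where "(U, \<phi>) \<in> A" "c = (case (U, \<phi>) of (U, \<phi>) \<Rightarrow> (Sigma U tangent, tmap \<phi>))"
    using assms unfolding tangent_bundle_eq by (metis (no_types, lifting) imageE surj_pair)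
  then show ?thesis using that by simp
qed

lemma points_tangent_bundle: "(p, v) \<in> points (tangent_bundle A) \<longleftrightarrow> v \<in> tangent p"
proof
  assume v: "v \<in> tangent p"
  obtain U \<phi> where c: "(U, \<phi>) \<in> A" "p \<in> U" using tangent_points[OF v] by (rule points_chart)
  show "(p, v) \<in> points (tangent_bundle A)"
    unfolding points_def using c(2) v by (intro UN_I[OF tangent_bundle_chart[OF c(1)]]) simp
next
  assume "(p, v) \<in> points (tangent_bundle A)"
  then obtain c where "c \<in> tangent_bundle A" "(p, v) \<in> fst c" unfolding points_def by blast
  then show "v \<in> tangent p"
    unfolding tangent_bundle_eq by (elim imageE) (simp add: case_prod_unfold)
qed

lemma vrep_chart_tvec [simp]: "(U, \<phi>) \<in> A \<Longrightarrow> p \<in> U \<Longrightarrow> vrep \<phi> (chart_tvec A (U, \<phi>) p w) = w"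
  by (simp add: vrep_def chart_tvec_coord euclidean_representation)

lemma chart_tvec_vrep:
  assumes "(U, \<phi>) \<in> A" "p \<in> U" "v \<in> tangent p"
  shows "chart_tvec A (U, \<phi>) p (vrep \<phi> v) = v"
proof -
  obtain w where "v = chart_tvec A (U, \<phi>) p w" using tangentE[OF assms(3,1,2)] .
  then show ?thesis using assms(1,2) by simp
qed

lemma tmap_image:
  assumes "(U, \<phi>) \<in> A" "V \<subseteq> U"
  shows "tmap \<phi> ` Sigma V tangent = (\<phi> ` V) \<times> UNIV"
proof
  show "(\<phi> ` V) \<times> UNIV \<subseteq> tmap \<phi> ` Sigma V tangent"
  proof clarify
    fix p y assume p: "p \<in> V"
    then have "p \<in> U" using assms by auto
    then have "(\<phi> p, y) = tmap \<phi> (p, chart_tvec A (U, \<phi>) p y)"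
      using assms by (simp add: tmap_def)
    then show "(\<phi> p, y) \<in> tmap \<phi> ` Sigma V tangent"
      using p \<open>p \<in> U\<close> chart_tvec_in_tangent[OF assms(1)] by blast
  qed
qed (auto simp: tmap_def)

lemma tmap_inj:
  assumes c: "(U, \<phi>) \<in> A"
  shows "inj_on (tmap \<phi>) (Sigma U tangent)"
proof (rule inj_onI, clarify)
  fix p v q w assume *: "p \<in> U" "v \<in> tangent p" "q \<in> U" "w \<in> tangent q" "tmap \<phi> (p, v) = tmap \<phi> (q, w)"
  then have "p = q" using inj_onD[OF chart_inj[OF c]] by (simp add: tmap_def)
  moreover have "v = w"
    using * \<open>p = q\<close> chart_tvec_vrep[OF c, of p v] chart_tvec_vrep[OF c, of p w] by (simp add: tmap_def)
  ultimately show "p = q \<and> v = w" by simp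
qed

lemma tmap_inv:
  assumes c: "(U, \<phi>) \<in> A" and x: "x \<in> \<phi> ` U"
  shows "inv_into (Sigma U tangent) (tmap \<phi>) (x, y) = (inv_into U \<phi> x, chart_tvec A (U, \<phi>) (inv_into U \<phi> x) y)"
proof -
  have "inv_into U \<phi> x \<in> U" "\<phi> (inv_into U \<phi> x) = x" using x by (auto simp: inv_into_into f_inv_into_f)
  then show ?thesis
    using c by (intro inv_into_f_eq[OF tmap_inj[OF c]]) (auto simp: tmap_def chart_tvec_in_tangent)
qed

lemma eventually_nhds_fst: "eventually P (nhds x) \<Longrightarrow> eventually (\<lambda>z. P (fst z)) (nhds (x, y))"
  unfolding eventually_nhds
proof (elim exE conjE)
  fix S assume "open S" "x \<in> S" "\<forall>x\<in>S. P x"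
  then show "\<exists>S. open S \<and> (x, y) \<in> S \<and> (\<forall>z\<in>S. P (fst z))"
    by (intro exI[of _ "S \<times> UNIV"]) (auto intro: open_Times)
qed

text \<open>A transition map of the bundle sends (x, y) to (h(x), dh(x) y), where h is a transition
  map of \<open>A\<close>. The derivative is written through its values on basis vectors, since
  smoothness is known for derivatives in fixed directions.\<close>

lemma smooth_atlas_tangent_bundle: "smooth_atlas (tangent_bundle A)"
proof -
  have 1: "inj_on (tmap \<phi>) (Sigma U tangent) \<and> open (tmap \<phi> ` Sigma U tangent)" if c: "(U, \<phi>) \<in> A" for U \<phi>
    using tmap_inj[OF c] chart_open[OF c] by (auto simp: tmap_image[OF c] intro: open_Times)
  have 2: "open (tmap \<phi> ` (Sigma U tangent \<inter> Sigma V tangent)) \<and>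
      smooth_on (tmap \<phi> ` (Sigma U tangent \<inter> Sigma V tangent)) (tmap \<psi> \<circ> inv_into (Sigma U tangent) (tmap \<phi>))"
    if c: "(U, \<phi>) \<in> A" and d: "(V, \<psi>) \<in> A" for U \<phi> V \<psi>
  proof -
    have im: "tmap \<phi> ` (Sigma U tangent \<inter> Sigma V tangent) = \<phi> ` (U \<inter> V) \<times> UNIV"
      using tmap_image[OF c, of "U \<inter> V"] by (simp add: Sigma_Int_distrib1)
    have "smooth_on (\<phi> ` (U \<inter> V) \<times> UNIV) (tmap \<psi> \<circ> inv_into (Sigma U tangent) (tmap \<phi>))"
    proof (rule smooth_onI, clarify)
      fix p and y :: 'e assume p: "p \<in> U" "p \<in> V"
      let ?h = "\<lambda>x. \<psi> (inv_into U \<phi> x)"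
      let ?H = "\<lambda>z. (?h (fst z), \<Sum>b\<in>Basis. (\<Sum>a\<in>Basis.
        (snd z \<bullet> a) * frechet_derivative (\<lambda>x. ?h x \<bullet> b) (at (fst z)) a) *\<^sub>R b)"
      have h: "smooth_at ?h (\<phi> p)" by (rule transition_smooth_at[OF c d p])
      have sm: "smooth_at ?H (\<phi> p, y)"
        by (intro smooth_at_Pair smooth_at_sum smooth_at_scaleR smooth_at_mult smooth_at_inner smooth_at_snd
            smooth_at_const smooth_at_compose[OF smooth_at_fst])
          (use h in \<open>auto intro!: smooth_at_frechet_derivative\<close>)
      have "eventually (\<lambda>x. inv_into U \<phi> x \<in> V \<and> inv_into U \<phi> x \<in> U \<and> \<phi> (inv_into U \<phi> x) = x) (nhds (\<phi> p))"
        using eventually_near_dom[OF d p(2)] eventually_nhds_chart[OF c p(1)]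
        by (simp add: eventually_near_chart[OF c p(1)] eventually_conj_iff)
      then have "eventually (\<lambda>z. ?H z = (tmap \<psi> \<circ> inv_into (Sigma U tangent) (tmap \<phi>)) z) (nhds (\<phi> p, y))"
      proof (rule eventually_mono[OF eventually_nhds_fst])
        fix z :: "'e \<times> 'e" assume *: "inv_into U \<phi> (fst z) \<in> V \<and> inv_into U \<phi> (fst z) \<in> U \<and> \<phi> (inv_into U \<phi> (fst z)) = fst z"
        obtain x w where z: "z = (x, w)" by (cases z)
        have x: "inv_into U \<phi> x \<in> V" "inv_into U \<phi> x \<in> U" "\<phi> (inv_into U \<phi> x) = x" using * by (auto simp: z)
        let ?q = "inv_into U \<phi> x"
        have "x \<in> \<phi> ` U" using x by (metis image_eqI)
        have hx: "smooth_at (\<lambda>x. ?h x \<bullet> b) x" for b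
          using transition_smooth_at[OF c d x(2,1)] x(3) by auto
        have "chart_tvec A (U, \<phi>) ?q w (\<lambda>q. \<psi> q \<bullet> b)
            = (\<Sum>a\<in>Basis. (w \<bullet> a) * frechet_derivative (\<lambda>x. ?h x \<bullet> b) (at x) a)" for b
          unfolding chart_tvec_eq[OF sm_coord[OF d x(1)]] x(3)
          by (rule linear_expand_Basis[OF linear_frechet_derivative[OF smooth_at_differentiable[OF hx]],
                unfolded real_scaleR_def])
        then show "?H z = (tmap \<psi> \<circ> inv_into (Sigma U tangent) (tmap \<phi>)) z"
          by (simp add: z tmap_inv[OF c \<open>x \<in> \<phi> ` U\<close>] tmap_def vrep_def)
      qed
      with sm show "smooth_at (tmap \<psi> \<circ> inv_into (Sigma U tangent) (tmap \<phi>)) (\<phi> p, y)"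
        by (rule smooth_at_cong)
    qed
    then show ?thesis using overlap_open[OF c d] by (simp add: im open_Times)
  qed
  show ?thesis
    unfolding smooth_atlas_def
  proof (intro conjI ballI)
    fix c assume "c \<in> tangent_bundle A"
    then obtain U \<phi> where c: "(U, \<phi>) \<in> A" "c = (Sigma U tangent, tmap \<phi>)"
      by (rule tangent_bundleE)
    show "case c of (U, \<phi>) \<Rightarrow> inj_on \<phi> U \<and> open (\<phi> ` U)" using 1[OF c(1)] by (simp add: c(2))
    show "case c of (U, \<phi>) \<Rightarrow> \<forall>(V, \<psi>)\<in>tangent_bundle A.
        open (\<phi> ` (U \<inter> V)) \<and> smooth_on (\<phi> ` (U \<inter> V)) (\<psi> \<circ> inv_into U \<phi>)"
      unfolding c(2) prod.case
    proof
      fix d assume "d \<in> tangent_bundle A"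
      then obtain V \<psi> where d: "(V, \<psi>) \<in> A" "d = (Sigma V tangent, tmap \<psi>)"
        by (rule tangent_bundleE)
      show "case d of (V, \<psi>) \<Rightarrow> open (tmap \<phi> ` (Sigma U tangent \<inter> V)) \<and>
          smooth_on (tmap \<phi> ` (Sigma U tangent \<inter> V)) (\<psi> \<circ> inv_into (Sigma U tangent) (tmap \<phi>))"
        using 2[OF c(1) d(1)] by (simp add: d(2))
    qed
  qed
qed

end

sublocale affine \<subseteq> T: atlas "tangent_bundle A"
  by unfold_locales (rule smooth_atlas_tangent_bundle)

context affine
begin

lemma eventually_nhds_tchart:
  assumes c: "(U, \<phi>) \<in> A" "p \<in> U"
  shows "eventually (\<lambda>z. fst z \<in> \<phi> ` U \<and> \<phi> (inv_into U \<phi> (fst z)) = fst z \<and> inv_into (Sigma U tangent) (tmap \<phi>) z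
      = (inv_into U \<phi> (fst z), chart_tvec A (U, \<phi>) (inv_into U \<phi> (fst z)) (snd z))) (nhds (\<phi> p, y))"
proof -
  have "eventually (\<lambda>x. x \<in> \<phi> ` U \<and> \<phi> (inv_into U \<phi> x) = x) (nhds (\<phi> p))"
    using eventually_nhds_chart[OF c] by eventually_elim (metis image_eqI)
  from eventually_nhds_fst[OF this, of y] show ?thesis
  proof eventually_elim
    case (elim z)
    then show ?case using tmap_inv[OF c(1), of "fst z" "snd z"] by simp
  qed
qed

lemma near_fst:
  assumes v: "v \<in> tangent p" and P: "eventually P (near p)"
  shows "eventually (\<lambda>z. P (fst z)) (T.near (p, v))"
proof -
  obtain U \<phi> where c: "(U, \<phi>) \<in> A" "p \<in> U" using tangent_points[OF v] by (rule points_chart)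
  have z: "(p, v) \<in> Sigma U tangent" using c v by simp
  have "eventually (\<lambda>z. P (inv_into U \<phi> (fst z))) (nhds (\<phi> p, vrep \<phi> v))"
    using P unfolding eventually_near_chart[OF c] by (rule eventually_nhds_fst)
  with eventually_nhds_tchart[OF c]
  show ?thesis
    unfolding T.eventually_near_chart[OF tangent_bundle_chart[OF c(1)] z]
    unfolding tmap_def fst_conv snd_conv
    by eventually_elim (simp add: tmap_def[symmetric, abs_def])
qed

lemma fst_sm:
  assumes v: "v \<in> tangent p" and f: "f \<in> sm p"
  shows "(\<lambda>z. f (fst z)) \<in> T.sm (p, v)"
proof -
  obtain U \<phi> where c: "(U, \<phi>) \<in> A" "p \<in> U" using tangent_points[OF v] by (rule points_chart)
  have z: "(p, v) \<in> Sigma U tangent" using c v by simp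
  have *: "smooth_at (\<lambda>x. f (inv_into U \<phi> x)) (\<phi> p)" using f sm_iff[OF c] by blast
  have "smooth_at (\<lambda>z. f (inv_into U \<phi> (fst z))) (\<phi> p, vrep \<phi> v)"
    by (rule smooth_at_compose[OF smooth_at_fst]) (use * in simp)
  then have "smooth_at (\<lambda>z. f (fst (inv_into (Sigma U tangent) (tmap \<phi>) z))) (\<phi> p, vrep \<phi> v)"
    by (rule smooth_at_cong) (use eventually_nhds_tchart[OF c] in \<open>eventually_elim, simp\<close>)
  then show ?thesis
    unfolding T.sm_iff[OF tangent_bundle_chart[OF c(1)] z] by (simp add: tmap_def)
qed

text \<open>In the bundle chart this function is (x, y) to dF(x) y, again expanded over basis
  directions.\<close>

lemma linear_sm:
  assumes v: "v \<in> tangent p" and f: "f \<in> sm p"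
  shows "(\<lambda>z. snd z f) \<in> T.sm (p, v)"
proof -
  obtain U \<phi> where c: "(U, \<phi>) \<in> A" "p \<in> U" using tangent_points[OF v] by (rule points_chart)
  have z: "(p, v) \<in> Sigma U tangent" using c v by simp
  let ?F = "\<lambda>x. f (inv_into U \<phi> x)"
  have F: "smooth_at ?F (\<phi> p)" using f sm_iff[OF c] by blast
  have *: "smooth_at (\<lambda>z. \<Sum>b\<in>Basis. (snd z \<bullet> b) * frechet_derivative ?F (at (fst z)) b) (\<phi> p, vrep \<phi> v)"
    by (intro smooth_at_sum smooth_at_mult smooth_at_inner smooth_at_snd smooth_at_const
        smooth_at_compose[OF smooth_at_fst]) (use F in \<open>auto intro!: smooth_at_frechet_derivative\<close>)
  have e: "eventually (\<lambda>z. smooth_at ?F (fst z) \<and> f \<in> sm (inv_into U \<phi> (fst z))) (nhds (\<phi> p, vrep \<phi> v))"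
    using sm_eventually[OF f] smooth_at_eventually[OF F]
    by (intro eventually_nhds_fst) (simp add: eventually_near_chart[OF c] eventually_conj_iff)
  have "smooth_at (\<lambda>z. snd (inv_into (Sigma U tangent) (tmap \<phi>) z) f) (\<phi> p, vrep \<phi> v)"
  proof (rule smooth_at_cong[OF *])
    show "eventually (\<lambda>z. (\<Sum>b\<in>Basis. (snd z \<bullet> b) * frechet_derivative ?F (at (fst z)) b)
        = snd (inv_into (Sigma U tangent) (tmap \<phi>) z) f) (nhds (\<phi> p, vrep \<phi> v))"
      using eventually_nhds_tchart[OF c] e
    proof eventually_elim
      case (elim z)
      then show ?case
        using linear_expand_Basis[OF linear_frechet_derivative[OF smooth_at_differentiable], of ?F "fst z" "snd z"]
        by (simp add: chart_tvec_eq)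
    qed
  qed
  then show ?thesis
    unfolding T.sm_iff[OF tangent_bundle_chart[OF c(1)] z] by (simp add: tmap_def)
qed

text \<open>The coordinates of a bundle chart are themselves of the two test types, pulled back and
  fibrewise linear. This is why equality of tangent vectors and smoothness of fields on
  \<open>TM\<close> need checking only on these.\<close>

lemma tmap_coord:
  "(\<lambda>z. tmap \<phi> z \<bullet> (b, 0)) = (\<lambda>z. \<phi> (fst z) \<bullet> b)"
  "b \<in> Basis \<Longrightarrow> (\<lambda>z. tmap \<phi> z \<bullet> (0, b)) = (\<lambda>z. snd z (\<lambda>q. \<phi> q \<bullet> b))"
  by (auto simp: tmap_def vrep_def inner_sum_left inner_Basis if_distrib cong: if_cong)

lemma T_tangent_eqI:
  assumes w: "w \<in> T.tangent (p, v)" "w' \<in> T.tangent (p, v)"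
    and 1: "\<And>f. f \<in> sm p \<Longrightarrow> w (\<lambda>z. f (fst z)) = w' (\<lambda>z. f (fst z))"
    and 2: "\<And>f. f \<in> sm p \<Longrightarrow> w (\<lambda>z. snd z f) = w' (\<lambda>z. snd z f)"
  shows "w = w'"
proof -
  have v: "v \<in> tangent p" using T.tangent_points[OF w(1)] by (simp add: points_tangent_bundle)
  obtain U \<phi> where c: "(U, \<phi>) \<in> A" "p \<in> U" using tangent_points[OF v] by (rule points_chart)
  have z: "(p, v) \<in> Sigma U tangent" using c v by simp
  show ?thesis
  proof (rule T.tangent_eqI[OF w tangent_bundle_chart[OF c(1)] z])
    fix b :: "'e \<times> 'e" assume "b \<in> Basis"
    then consider a where "b = (a, 0)" "a \<in> Basis" | a where "b = (0, a)" "a \<in> Basis"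
      by (auto simp: Basis_prod_def)
    then show "w (\<lambda>z. tmap \<phi> z \<bullet> b) = w' (\<lambda>z. tmap \<phi> z \<bullet> b)"
      by cases (simp_all add: tmap_coord 1[OF sm_coord[OF c]] 2[OF sm_coord[OF c]])
  qed
qed

lemma T_vector_fieldI:
  assumes tan: "\<And>p v. v \<in> tangent p \<Longrightarrow> L (p, v) \<in> T.tangent (p, v)"
    and out: "\<And>z. z \<notin> points (tangent_bundle A) \<Longrightarrow> L z = (\<lambda>_. 0)"
    and 1: "\<And>p v f. v \<in> tangent p \<Longrightarrow> f \<in> sm p \<Longrightarrow> (\<lambda>z. L z (\<lambda>z. f (fst z))) \<in> T.sm (p, v)"
    and 2: "\<And>p v f. v \<in> tangent p \<Longrightarrow> f \<in> sm p \<Longrightarrow> (\<lambda>z. L z (\<lambda>z. snd z f)) \<in> T.sm (p, v)"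
  shows "vector_field (tangent_bundle A) L"
proof (rule T.vector_fieldI)
  fix z assume "z \<in> points (tangent_bundle A)"
  then obtain p v where z: "z = (p, v)" and v: "v \<in> tangent p" by (cases z) (simp add: points_tangent_bundle)
  then show "L z \<in> T.tangent z" using tan by simp
  obtain U \<phi> where c: "(U, \<phi>) \<in> A" "p \<in> U" using tangent_points[OF v] by (rule points_chart)
  have "(\<lambda>z. L z (\<lambda>z. tmap \<phi> z \<bullet> b)) \<in> T.sm z" if b: "b \<in> Basis" for b :: "'e \<times> 'e"
  proof -
    consider a where "b = (a, 0)" "a \<in> Basis" | a where "b = (0, a)" "a \<in> Basis"
      using b by (auto simp: Basis_prod_def)
    then show ?thesis
      by cases (simp_all add: tmap_coord z 1[OF v sm_coord[OF c]] 2[OF v sm_coord[OF c]])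
  qed
  then show "\<exists>TU T\<phi>. (TU, T\<phi>) \<in> tangent_bundle A \<and> z \<in> TU \<and> (\<forall>b\<in>Basis. (\<lambda>z. L z (\<lambda>z. T\<phi> z \<bullet> b)) \<in> T.sm z)"
    using tangent_bundle_chart[OF c(1)] c(2) v z by blast
qed (rule out)

text \<open>In charts the section is the smooth map \<open>s\<close>, and the chain rule exhibits
  the image of \<open>y\<close> as the vector with components ds(w).\<close>

lemma section_tangent_map:
  assumes \<sigma>: "vector_field A \<sigma>" and p: "p \<in> points A" and y: "y \<in> tangent p"
  shows "F \<in> T.sm (p, \<sigma> p) \<Longrightarrow> (\<lambda>q. F (q, \<sigma> q)) \<in> sm p"
    and "tangent_map (tangent_bundle A) (\<lambda>q. (q, \<sigma> q)) p y \<in> T.tangent (p, \<sigma> p)"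
    and "F \<in> T.sm (p, \<sigma> p) \<Longrightarrow> tangent_map (tangent_bundle A) (\<lambda>q. (q, \<sigma> q)) p y F = y (\<lambda>q. F (q, \<sigma> q))"
proof -
  obtain U \<phi> where c: "(U, \<phi>) \<in> A" "p \<in> U" using p by (rule points_chart)
  obtain w where w: "y = chart_tvec A (U, \<phi>) p w" using tangentE[OF y c] .
  have z: "(p, \<sigma> p) \<in> Sigma U tangent" using c vector_field_tangent[OF \<sigma> p] by simp
  define s where "s = (\<lambda>x. (x, \<Sum>b\<in>Basis. \<sigma> (inv_into U \<phi> x) (\<lambda>q. \<phi> q \<bullet> b) *\<^sub>R b))"
  have "smooth_at (\<lambda>x. \<sigma> (inv_into U \<phi> x) (\<lambda>q. \<phi> q \<bullet> b)) (\<phi> p)" for b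
    using vector_field_sm[OF \<sigma> sm_coord[OF c, of b]] by (simp add: sm_iff[OF c])
  then have s: "smooth_at s (\<phi> p)"
    unfolding s_def by (intro smooth_at_Pair smooth_at_sum smooth_at_scaleR smooth_at_const smooth_at_ident)
  have sp: "s (\<phi> p) = tmap \<phi> (p, \<sigma> p)" using c by (simp add: s_def tmap_def vrep_def)
  have inv: "eventually (\<lambda>x. inv_into (Sigma U tangent) (tmap \<phi>) (s x) = (inv_into U \<phi> x, \<sigma> (inv_into U \<phi> x))) (nhds (\<phi> p))"
    using eventually_nhds_chart[OF c]
  proof eventually_elim
    case (elim x)
    then have x: "x \<in> \<phi> ` U" by (metis image_eqI)
    show ?case
      using chart_tvec_vrep[OF c(1) _ vector_field_tangent[OF \<sigma> chart_points[OF c(1)]]] elim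
      by (simp add: s_def tmap_inv[OF c(1) x] vrep_def)
  qed
  have main: "smooth_at (\<lambda>x. F (inv_into U \<phi> x, \<sigma> (inv_into U \<phi> x))) (\<phi> p) \<and>
      frechet_derivative (\<lambda>x. F (inv_into U \<phi> x, \<sigma> (inv_into U \<phi> x))) (at (\<phi> p)) w
      = frechet_derivative (\<lambda>x. F (inv_into (Sigma U tangent) (tmap \<phi>) x)) (at (tmap \<phi> (p, \<sigma> p)))
          (frechet_derivative s (at (\<phi> p)) w)"
    if "F \<in> T.sm (p, \<sigma> p)" for F
  proof -
    let ?F = "\<lambda>x. F (inv_into (Sigma U tangent) (tmap \<phi>) x)"
    have F: "smooth_at ?F (s (\<phi> p))"
      using that T.sm_iff[OF tangent_bundle_chart[OF c(1)] z] sp by simp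
    have e: "eventually (\<lambda>x. ?F (s x) = F (inv_into U \<phi> x, \<sigma> (inv_into U \<phi> x))) (nhds (\<phi> p))"
      using inv by eventually_elim simp
    have "smooth_at (\<lambda>x. ?F (s x)) (\<phi> p)" by (rule smooth_at_compose[OF s F])
    then show ?thesis
      using smooth_at_cong[OF _ e] frechet_derivative_cong[OF _ e] frechet_derivative_compose_at[OF s F] sp by simp
  qed
  show 1: "(\<lambda>q. F (q, \<sigma> q)) \<in> sm p" if "F \<in> T.sm (p, \<sigma> p)" for F
    using main[OF that] by (simp add: sm_iff[OF c])
  show "tangent_map (tangent_bundle A) (\<lambda>q. (q, \<sigma> q)) p y F = y (\<lambda>q. F (q, \<sigma> q))" if "F \<in> T.sm (p, \<sigma> p)" for F
    using that by (simp add: tangent_map_def comp_def)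
  have "tangent_map (tangent_bundle A) (\<lambda>q. (q, \<sigma> q)) p y
      = chart_tvec (tangent_bundle A) (Sigma U tangent, tmap \<phi>) (p, \<sigma> p) (frechet_derivative s (at (\<phi> p)) w)"
  proof
    fix F
    show "tangent_map (tangent_bundle A) (\<lambda>q. (q, \<sigma> q)) p y F
      = chart_tvec (tangent_bundle A) (Sigma U tangent, tmap \<phi>) (p, \<sigma> p) (frechet_derivative s (at (\<phi> p)) w) F"
    proof (cases "F \<in> T.sm (p, \<sigma> p)")
      case True
      then show ?thesis
        using main[OF True] by (simp add: tangent_map_def comp_def w chart_tvec_eq[OF 1] T.chart_tvec_eq)
    qed (simp add: tangent_map_def T.chart_tvec_outside)
  qed
  then show "tangent_map (tangent_bundle A) (\<lambda>q. (q, \<sigma> q)) p y \<in> T.tangent (p, \<sigma> p)"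
    using T.chart_tvec_in_tangent[OF tangent_bundle_chart[OF c(1)] z] by simp
qed

section \<open>Vertical lifts\<close>

lemma vlift_apply:
  assumes "v \<in> tangent p"
  shows "F \<in> T.sm (p, v) \<Longrightarrow> vlift A X (p, v) F = deriv (\<lambda>t. F (p, \<lambda>f. v f + t * X p f)) 0"
  using assms by (simp add: vlift_def points_tangent_bundle)

lemma vlift_outside: "z \<notin> points (tangent_bundle A) \<Longrightarrow> vlift A X z = (\<lambda>_. 0)"
  by (cases z) (simp add: vlift_def)

lemma vlift_fst:
  "v \<in> tangent p \<Longrightarrow> f \<in> sm p \<Longrightarrow> vlift A X (p, v) (\<lambda>z. f (fst z)) = 0"
  by (simp add: vlift_apply fst_sm)

lemma vlift_linear:
  assumes "v \<in> tangent p" "f \<in> sm p"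
  shows "vlift A X (p, v) (\<lambda>z. snd z f) = X p f"
proof -
  have "((\<lambda>t. v f + t * X p f) has_real_derivative X p f) (at 0)"
    by (auto intro!: derivative_eq_intros)
  then show ?thesis by (simp add: vlift_apply linear_sm assms DERIV_imp_deriv)
qed

text \<open>In the bundle chart the curve that defines the lift is the straight line t to
  (\<phi>(p), y + t w), so the lift is the chart vector \<open>(0, w)\<close>.\<close>

lemma vlift_tangent:
  assumes X: "vector_field A X" and v: "v \<in> tangent p"
  shows "vlift A X (p, v) \<in> T.tangent (p, v)"
proof -
  obtain U \<phi> where c: "(U, \<phi>) \<in> A" "p \<in> U" using tangent_points[OF v] by (rule points_chart)
  have z: "(p, v) \<in> Sigma U tangent" using c v by simp
  obtain y where y: "v = chart_tvec A (U, \<phi>) p y" using tangentE[OF v c] .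
  obtain w where w: "X p = chart_tvec A (U, \<phi>) p w"
    using tangentE[OF vector_field_tangent[OF X tangent_points[OF v]] c] .
  have tz: "tmap \<phi> (p, v) = (\<phi> p, y)" using c by (simp add: tmap_def y)
  have "vlift A X (p, v) = chart_tvec (tangent_bundle A) (Sigma U tangent, tmap \<phi>) (p, v) (0, w)"
  proof
    fix F
    show "vlift A X (p, v) F = chart_tvec (tangent_bundle A) (Sigma U tangent, tmap \<phi>) (p, v) (0, w) F"
    proof (cases "F \<in> T.sm (p, v)")
      case True
      let ?F = "\<lambda>x. F (inv_into (Sigma U tangent) (tmap \<phi>) x)"
      have "smooth_at ?F (\<phi> p, y)"
        using True T.sm_iff[OF tangent_bundle_chart[OF c(1)] z] tz by simp
      then have "((\<lambda>t. ?F ((\<phi> p, y) + t *\<^sub>R (0, w))) has_real_derivative frechet_derivative ?F (at (\<phi> p, y)) (0, w)) (at 0)"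
        using frechet_derivative_line[of ?F "(\<phi> p, y)" 0 "(0, w)"] by simp
      moreover have "?F ((\<phi> p, y) + t *\<^sub>R (0, w)) = F (p, \<lambda>f. v f + t * X p f)" for t
      proof -
        have "(\<lambda>f. v f + t * X p f) = chart_tvec A (U, \<phi>) p (y + t *\<^sub>R w)"
          by (intro ext) (simp add: y w linear_add[OF linear_chart_tvec[OF c]] linear_cmul[OF linear_chart_tvec[OF c]])
        then show ?thesis using c tmap_inv[OF c(1), of "\<phi> p" "y + t *\<^sub>R w"] by simp
      qed
      ultimately show ?thesis
        using True v by (simp add: vlift_apply DERIV_imp_deriv T.chart_tvec_eq tz)
    qed (use v in \<open>simp add: vlift_def T.chart_tvec_outside\<close>)
  qed
  then show ?thesis using T.chart_tvec_in_tangent[OF tangent_bundle_chart[OF c(1)] z] by simp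
qed

lemma vlift_field:
  assumes X: "vector_field A X"
  shows "vector_field (tangent_bundle A) (vlift A X)"
proof (rule T_vector_fieldI)
  fix p v f assume v: "v \<in> tangent p" and f: "f \<in> sm p"
  have e: "eventually (\<lambda>z. f \<in> sm (fst z) \<and> z \<in> points (tangent_bundle A)) (T.near (p, v))"
    using near_fst[OF v sm_eventually[OF f]] T.eventually_near_points by (rule eventually_conj)
  show "(\<lambda>z. vlift A X z (\<lambda>z. f (fst z))) \<in> T.sm (p, v)"
  proof (rule T.sm_cong[OF T.sm_const])
    show "eventually (\<lambda>z. 0 = vlift A X z (\<lambda>z. f (fst z))) (T.near (p, v))"
      using e by eventually_elim (auto simp: points_tangent_bundle vlift_fst)
  qed (simp add: points_tangent_bundle v)
  show "(\<lambda>z. vlift A X z (\<lambda>z. snd z f)) \<in> T.sm (p, v)"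
  proof (rule T.sm_cong[OF fst_sm[OF v vector_field_sm[OF X f]]])
    show "eventually (\<lambda>z. X (fst z) f = vlift A X z (\<lambda>z. snd z f)) (T.near (p, v))"
      using e by eventually_elim (auto simp: points_tangent_bundle vlift_linear)
  qed
qed (auto intro: vlift_tangent X vlift_outside)

end


section \<open>Horizontal lifts\<close>

context affine
begin

lemma D_diff2:
  assumes X: "vector_field A X" and Y: "vector_field A Y" and Z: "vector_field A Z"
  shows "D X (vf_diff Y Z) = vf_diff (D X Y) (D X Z)"
proof -
  have "vf_diff Y Z = vf_add Y (vf_mult (\<lambda>_. - 1) Z)" for Y Z :: "'m vfield"
    by (simp add: vf_diff_def vf_add_def vf_mult_def)
  moreover have "D X (vf_mult (\<lambda>_. - 1) Z) = vf_mult (\<lambda>_. - 1) (D X Z)"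
  proof (intro ext)
    fix p f
    have "X p (\<lambda>_. - 1) = 0"
      using tangent_const[OF vector_field_tangent[OF X]] vector_field_outside[OF X] by metis
    then show "D X (vf_mult (\<lambda>_. - 1) Z) p f = vf_mult (\<lambda>_. - 1) (D X Z) p f"
      unfolding D_mult2[OF smooth_fun_const X Z] by (simp add: vf_mult_def vf_add_def)
  qed
  ultimately show ?thesis
    using D_add2[OF X Y vector_field_mult[OF smooth_fun_const Z]] by simp
qed

text \<open>Smoothness is read off from vanishing torsion, which writes the bracket as a difference
  of covariant derivatives.\<close>

lemma lie_bracket_field:
  "vector_field A X \<Longrightarrow> vector_field A Y \<Longrightarrow> vector_field A (lie_bracket A X Y)"
  by (simp add: torsion vector_field_diff D_field)

text \<open>The description in \<open>hlift\<close> ranges over all fields Y and sections \<tau>.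
  The projection forces Y(p) = X(p), but \<tau> and \<sigma> may still differ to first order. On
  fibrewise linear functions torsion-freeness replaces X(\<tau> f) by \<tau>(X f) - (D \<tau> X) f,
  which depends only on their common value at \<open>p\<close>.\<close>

lemma hlift_eq:
  assumes X: "vector_field A X" and \<sigma>: "vector_field A \<sigma>" and par: "D X \<sigma> p = (\<lambda>_. 0)" and p: "p \<in> points A"
  shows "hlift A D X (p, \<sigma> p) = tangent_map (tangent_bundle A) (\<lambda>q. (q, \<sigma> q)) p (X p)"
proof -
  note Xp = vector_field_tangent[OF X p]
  have z: "(p, \<sigma> p) \<in> points (tangent_bundle A)"
    using vector_field_tangent[OF \<sigma> p] by (simp add: points_tangent_bundle)
  have fst_app: "tangent_map (tangent_bundle A) (\<lambda>q. (q, \<tau> q)) p (Y p) (\<lambda>z. f (fst z)) = Y p f"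
    if "vector_field A Y" "vector_field A \<tau>" "f \<in> sm p" for Y \<tau> f
    using section_tangent_map(3)[OF that(2) p vector_field_tangent[OF that(1) p]
        fst_sm[OF vector_field_tangent[OF that(2) p] that(3)]] by simp
  have linear_app: "tangent_map (tangent_bundle A) (\<lambda>q. (q, \<tau> q)) p (X p) (\<lambda>z. snd z f)
      = \<tau> p (\<lambda>q. X q f) - D \<tau> X p f"
    if \<tau>: "vector_field A \<tau>" "D X \<tau> p = (\<lambda>_. 0)" and f: "f \<in> sm p" for \<tau> f
    using section_tangent_map(3)[OF \<tau>(1) p Xp linear_sm[OF vector_field_tangent[OF \<tau>(1) p] f]]
      torsion_apply[OF X \<tau>(1) f] by (simp add: \<tau>(2))
  show ?thesis
    unfolding hlift_def if_P[OF z]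
  proof (rule the_equality, intro conjI)
    show "tangent_map (tangent_bundle A) (\<lambda>q. (q, \<sigma> q)) p (X p) \<in> horizontal_space A D (p, \<sigma> p)"
      unfolding horizontal_space_def using X \<sigma> par by auto
    show "tangent_map A fst (p, \<sigma> p) (tangent_map (tangent_bundle A) (\<lambda>q. (q, \<sigma> q)) p (X p)) = X (fst (p, \<sigma> p))"
      using fst_app[OF X \<sigma>] tangent_outside[OF Xp] by (auto simp: tangent_map_def[of A] comp_def fun_eq_iff)
  next
    fix w assume "w \<in> horizontal_space A D (p, \<sigma> p) \<and> tangent_map A fst (p, \<sigma> p) w = X (fst (p, \<sigma> p))"
    then obtain Y \<tau> where Y: "vector_field A Y" and \<tau>: "vector_field A \<tau>" "\<tau> p = \<sigma> p" "D Y \<tau> p = (\<lambda>_. 0)"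
      and w: "w = tangent_map (tangent_bundle A) (\<lambda>q. (q, \<tau> q)) p (Y p)"
      and Xw: "X p = tangent_map A fst (p, \<sigma> p) w"
      by (auto simp: horizontal_space_def)
    have YX: "Y p = X p"
    proof
      fix f show "Y p f = X p f"
        using fst_app[OF Y \<tau>(1), of f] tangent_outside[OF vector_field_tangent[OF Y p], of f]
        by (cases "f \<in> sm p") (simp_all add: Xw w tangent_map_def[of A] comp_def)
    qed
    have par\<tau>: "D X \<tau> p = (\<lambda>_. 0)"
      using D_cong1[OF Y X \<tau>(1) p YX] \<tau>(3) by simp
    show "w = tangent_map (tangent_bundle A) (\<lambda>q. (q, \<sigma> q)) p (X p)"
    proof (rule T_tangent_eqI)
      show "w \<in> T.tangent (p, \<sigma> p)"
        using section_tangent_map(2)[OF \<tau>(1) p vector_field_tangent[OF Y p]] by (simp add: w \<tau>(2))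
      show "tangent_map (tangent_bundle A) (\<lambda>q. (q, \<sigma> q)) p (X p) \<in> T.tangent (p, \<sigma> p)"
        by (rule section_tangent_map(2)[OF \<sigma> p Xp])
    next
      fix f assume f: "f \<in> sm p"
      show "w (\<lambda>z. f (fst z)) = tangent_map (tangent_bundle A) (\<lambda>q. (q, \<sigma> q)) p (X p) (\<lambda>z. f (fst z))"
        unfolding w fst_app[OF Y \<tau>(1) f] fst_app[OF X \<sigma> f] by (simp add: YX)
      have "D \<tau> X p = D \<sigma> X p" by (rule D_cong1[OF \<tau>(1) \<sigma> X p \<tau>(2)])
      then show "w (\<lambda>z. snd z f) = tangent_map (tangent_bundle A) (\<lambda>q. (q, \<sigma> q)) p (X p) (\<lambda>z. snd z f)"
        by (simp add: w YX linear_app[OF \<tau>(1) par\<tau> f] linear_app[OF \<sigma> par f] \<tau>(2))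
    qed
  qed
qed

lemma hlift_cong: "X p = Y p \<Longrightarrow> hlift A D X (p, v) = hlift A D Y (p, v)"
  by (simp add: hlift_def)

lemma hlift_outside: "z \<notin> points (tangent_bundle A) \<Longrightarrow> hlift A D X z = (\<lambda>_. 0)"
  by (simp add: hlift_def)

lemma hlift_section:
  assumes "vector_field A X" "vector_field A \<sigma>" "D X \<sigma> p = (\<lambda>_. 0)" "p \<in> points A" "F \<in> T.sm (p, \<sigma> p)"
  shows "hlift A D X (p, \<sigma> p) F = X p (\<lambda>q. F (q, \<sigma> q))"
  using section_tangent_map(3)[OF assms(2,4) vector_field_tangent[OF assms(1,4)] assms(5)]
  by (simp add: hlift_eq assms)

context
  fixes X p v
  assumes X: "vector_field A X" and v: "v \<in> tangent p"
begin

lemma hlift_tangent: "hlift A D X (p, v) \<in> T.tangent (p, v)"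
proof -
  obtain \<sigma> where "vector_field A \<sigma>" "\<sigma> p = v" "D X \<sigma> p = (\<lambda>_. 0)" using parallel_extension[OF v X] .
  then show ?thesis
    using hlift_eq[OF X, of \<sigma> p] section_tangent_map(2)[of \<sigma> p "X p"] vector_field_tangent[OF X] tangent_points[OF v]
    by simp
qed

lemma hlift_fst:
  assumes "f \<in> sm p"
  shows "hlift A D X (p, v) (\<lambda>z. f (fst z)) = X p f"
proof -
  obtain \<sigma> where "vector_field A \<sigma>" "\<sigma> p = v" "D X \<sigma> p = (\<lambda>_. 0)" using parallel_extension[OF v X] .
  then show ?thesis
    using hlift_section[OF X, of \<sigma> p "\<lambda>z. f (fst z)"] fst_sm[OF v assms] tangent_points[OF v] by simp
qed

text \<open>\<open>V\<close> may be any extension of \<open>v\<close>; it only serves to name the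
  covariant derivative of \<open>X\<close> along \<open>v\<close>.\<close>

lemma hlift_linear:
  assumes f: "f \<in> sm p" and V: "vector_field A V" "V p = v"
  shows "hlift A D X (p, v) (\<lambda>z. snd z f) = v (\<lambda>q. X q f) - D V X p f"
proof -
  obtain \<sigma> where \<sigma>: "vector_field A \<sigma>" "\<sigma> p = v" "D X \<sigma> p = (\<lambda>_. 0)" using parallel_extension[OF v X] .
  have "hlift A D X (p, v) (\<lambda>z. snd z f) = X p (\<lambda>q. \<sigma> q f)"
    using hlift_section[OF X \<sigma>(1,3) tangent_points[OF v], of "\<lambda>z. snd z f"] linear_sm[OF v f] by (simp add: \<sigma>(2))
  also have "\<dots> = v (\<lambda>q. X q f) - D \<sigma> X p f"
    using torsion_apply[OF X \<sigma>(1) f] by (simp add: \<sigma>)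
  also have "D \<sigma> X p = D V X p"
    using D_cong1[OF \<sigma>(1) V(1) X tangent_points[OF v]] \<sigma>(2) V(2) by simp
  finally show ?thesis .
qed

end

lemma hlift_field:
  assumes X: "vector_field A X"
  shows "vector_field (tangent_bundle A) (hlift A D X)"
proof (rule T_vector_fieldI)
  fix p v f assume v: "v \<in> tangent p" and f: "f \<in> sm p"
  note p = tangent_points[OF v]
  have e: "eventually (\<lambda>z. f \<in> sm (fst z) \<and> z \<in> points (tangent_bundle A)) (T.near (p, v))"
    using near_fst[OF v sm_eventually[OF f]] T.eventually_near_points by (rule eventually_conj)
  show "(\<lambda>z. hlift A D X z (\<lambda>z. f (fst z))) \<in> T.sm (p, v)"
  proof (rule T.sm_cong[OF fst_sm[OF v vector_field_sm[OF X f]]])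
    show "eventually (\<lambda>z. X (fst z) f = hlift A D X z (\<lambda>z. f (fst z))) (T.near (p, v))"
      using e by eventually_elim (auto simp: points_tangent_bundle hlift_fst X)
  qed
  obtain x E \<kappa> where fr: "frame p x E \<kappa>" using frame_exists[OF p] .
  note E = frame_field[OF p fr]
  have x: "x b \<in> sm p" for b using frame_coord[OF p fr] p by (rule smooth_fun_sm)
  \<comment> \<open>On a fibrewise linear function the lift is again linear in the fibre variable;
    in a frame its coefficients are smooth functions pulled back from \<open>M\<close>.\<close>
  let ?F = "\<lambda>z. \<Sum>b\<in>Basis. snd z (x b) * (E b (fst z) (\<lambda>q. X q f) - D (E b) X (fst z) f)"
  have "(\<lambda>q. E b q (\<lambda>q. X q f) - D (E b) X q f) \<in> sm p" for b
    by (intro sm_diff vector_field_sm[OF E] vector_field_sm[OF X] vector_field_sm[OF D_field[OF E X]] f)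
  from fst_sm[OF v this] have "?F \<in> T.sm (p, v)"
    by (intro T.sm_sum T.sm_mult linear_sm[OF v x]) (simp_all add: points_tangent_bundle v)
  then show "(\<lambda>z. hlift A D X z (\<lambda>z. snd z f)) \<in> T.sm (p, v)"
  proof (rule T.sm_cong)
    show "eventually (\<lambda>z. ?F z = hlift A D X z (\<lambda>z. snd z f)) (T.near (p, v))"
      using e near_fst[OF v frame_expand_near[OF p fr]]
    proof eventually_elim
      case (elim z)
      obtain q u where z: "z = (q, u)" by (cases z)
      have u: "u \<in> tangent q" and fq: "f \<in> sm q" using elim by (auto simp: z points_tangent_bundle)
      \<comment> \<open>An extension of \<open>u\<close> with constant coefficients in the frame,
        which belongs to the fixed point \<open>p\<close> but is valid at every nearby
        \<open>q\<close>.\<close>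
      define W where "W = (\<lambda>r g. \<Sum>b\<in>Basis. (\<lambda>_. u (x b)) r * E b r g)"
      have W: "vector_field A W"
        unfolding W_def by (rule vector_field_sum[OF smooth_fun_const E])
      have Wq: "W q = u" using elim u by (auto simp: z W_def)
      have "D W X q f = (\<Sum>b\<in>Basis. u (x b) * D (E b) X q f)"
        unfolding W_def by (subst D_sum1[OF finite_Basis X smooth_fun_const E]) simp
      moreover have "u (\<lambda>q. X q f) = (\<Sum>b\<in>Basis. u (x b) * E b q (\<lambda>q. X q f))"
        using fun_cong[OF Wq] by (simp add: W_def)
      ultimately show ?case
        using hlift_linear[OF X u fq W Wq] by (simp add: z right_diff_distrib sum_subtractf)
    qed
  qed
qed (auto intro: hlift_tangent[OF X] hlift_outside)

text \<open>Arranged so that all terms except V(X(Y f)) and the one with \<open>D V (D X Y)\<close>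
  are jointly symmetric in \<open>X\<close> and \<open>Y\<close>; antisymmetrising leaves V([X, Y]
  f) minus the derivative of [X, Y] along V, applied to f. Flatness enters where the derivatives
  along \<open>X\<close> and along the section are exchanged.\<close>

lemma hlift_hlift_linear:
  assumes X: "vector_field A X" and Y: "vector_field A Y" and V: "vector_field A V"
    and p: "p \<in> points A" and f: "f \<in> sm p"
  shows "hlift A D X (p, V p) (\<lambda>z. hlift A D Y z (\<lambda>z. snd z f))
    = V p (\<lambda>q. X q (\<lambda>r. Y r f)) - D V X p (\<lambda>q. Y q f) - D V Y p (\<lambda>q. X q f)
      - D V (D X Y) p f + D (D V X) Y p f + D (D V Y) X p f"
proof -
  note Vp = vector_field_tangent[OF V p]
  note Xp = vector_field_tangent[OF X p]
  obtain \<sigma> where \<sigma>: "vector_field A \<sigma>" "\<sigma> p = V p" "D X \<sigma> p = (\<lambda>_. 0)" using parallel_extension[OF Vp X] .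
  have cong: "D \<sigma> Z p = D V Z p" if "vector_field A Z" for Z
    using D_cong1[OF \<sigma>(1) V that p \<sigma>(2)] .
  have cong2: "D (D \<sigma> Z) W p = D (D V Z) W p" if "vector_field A Z" "vector_field A W" for Z W
    using D_cong1[OF D_field[OF \<sigma>(1) that(1)] D_field[OF V that(1)] that(2) p cong[OF that(1)]] .
  have Yf: "(\<lambda>q. Y q f) \<in> sm p" by (rule vector_field_sm[OF Y f])
  have "(\<lambda>z. hlift A D Y z (\<lambda>z. snd z f)) \<in> T.sm (p, V p)"
    by (rule T.vector_field_sm[OF hlift_field[OF Y] linear_sm[OF Vp f]])
  then have "hlift A D X (p, V p) (\<lambda>z. hlift A D Y z (\<lambda>z. snd z f))
      = X p (\<lambda>q. hlift A D Y (q, \<sigma> q) (\<lambda>z. snd z f))"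
    using hlift_section[OF X \<sigma>(1,3) p] \<sigma>(2) by simp
  also have "\<dots> = X p (\<lambda>q. \<sigma> q (\<lambda>r. Y r f) - D \<sigma> Y q f)"
  proof (rule tangent_cong[OF Xp])
    show "eventually (\<lambda>q. hlift A D Y (q, \<sigma> q) (\<lambda>z. snd z f) = \<sigma> q (\<lambda>r. Y r f) - D \<sigma> Y q f) (near p)"
      using sm_eventually[OF f] eventually_near_points
      by eventually_elim (rule hlift_linear[OF Y vector_field_tangent[OF \<sigma>(1)] _ \<sigma>(1) refl])
  qed
  also have "\<dots> = X p (\<lambda>q. \<sigma> q (\<lambda>r. Y r f)) - X p (\<lambda>q. D \<sigma> Y q f)"
    by (rule tangent_diff[OF Xp vector_field_sm[OF \<sigma>(1) Yf] vector_field_sm[OF D_field[OF \<sigma>(1) Y] f]])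
  also have "X p (\<lambda>q. \<sigma> q (\<lambda>r. Y r f)) = V p (\<lambda>q. X q (\<lambda>r. Y r f)) - D V X p (\<lambda>q. Y q f)"
    using torsion_apply[OF X \<sigma>(1) Yf] by (simp add: \<sigma> cong[OF X])
  also have "X p (\<lambda>q. D \<sigma> Y q f) = D V Y p (\<lambda>q. X q f) + D X (D \<sigma> Y) p f - D (D V Y) X p f"
    using torsion_apply[OF X D_field[OF \<sigma>(1) Y] f] by (simp add: cong[OF Y] cong2[OF Y X])
  also have "D X (D \<sigma> Y) p f = D V (D X Y) p f + D (lie_bracket A X \<sigma>) Y p f"
    using flat[OF X \<sigma>(1) Y] by (simp add: cong[OF D_field[OF X Y]])
  \<comment> \<open>\<open>D X \<sigma>\<close> vanishes at \<open>p\<close>, so the bracket there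
    is minus \<open>D \<sigma> X\<close>; the zero coefficient only fills the second slot of the
    rule.\<close>
  also have "D (lie_bracket A X \<sigma>) Y p f = (- 1) * D (D \<sigma> X) Y p f + 0 * D (D \<sigma> X) Y p f"
    by (rule D_cong_lincomb[OF lie_bracket_field[OF X \<sigma>(1)] D_field[OF \<sigma>(1) X] D_field[OF \<sigma>(1) X] Y p])
      (simp add: torsion[OF X \<sigma>(1)] vf_diff_def \<sigma>(3))
  finally show ?thesis by (simp add: cong2[OF X Y])
qed

text \<open>The commutator of two fields on \<open>TM\<close> is a tangent vector at each point,
  hence determined on the two test types; this carries commutator relations from there to every
  smooth germ \<open>F\<close>.\<close>

lemma T_bracket_eqI:
  assumes L: "vector_field (tangent_bundle A) L" and L': "vector_field (tangent_bundle A) L'"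
    and v: "v \<in> tangent p" and w: "w \<in> T.tangent (p, v)" and F: "F \<in> T.sm (p, v)"
    and 1: "\<And>f. f \<in> sm p \<Longrightarrow> L (p, v) (\<lambda>z. L' z (\<lambda>z. f (fst z))) - L' (p, v) (\<lambda>z. L z (\<lambda>z. f (fst z))) = w (\<lambda>z. f (fst z))"
    and 2: "\<And>f. f \<in> sm p \<Longrightarrow> L (p, v) (\<lambda>z. L' z (\<lambda>z. snd z f)) - L' (p, v) (\<lambda>z. L z (\<lambda>z. snd z f)) = w (\<lambda>z. snd z f)"
  shows "L (p, v) (\<lambda>z. L' z F) - L' (p, v) (\<lambda>z. L z F) = w F"
proof -
  have "lie_bracket (tangent_bundle A) L L' (p, v) = w"
  proof (rule T_tangent_eqI[OF T.lie_bracket_tangent[OF L L'] w])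
    show "(p, v) \<in> points (tangent_bundle A)" using v by (simp add: points_tangent_bundle)
  qed (simp_all add: lie_bracket_def fst_sm[OF v] linear_sm[OF v] 1 2)
  then show ?thesis using F by (simp add: lie_bracket_def fun_eq_iff) metis
qed

text \<open>Allows a pointwise formula for an inner lift to be inserted under an outer derivative,
  which sees its argument only near \<open>(p, v)\<close>.\<close>

lemma T_near_lift:
  assumes v: "v \<in> tangent p" and f: "f \<in> sm p"
    and "\<And>q u. u \<in> tangent q \<Longrightarrow> f \<in> sm q \<Longrightarrow> G (q, u) = H (q, u)"
    and "w \<in> T.tangent (p, v)"
  shows "w G = w H"
proof (rule T.tangent_cong[OF assms(4)])
  show "eventually (\<lambda>z. G z = H z) (T.near (p, v))"
    using near_fst[OF v sm_eventually[OF f]] T.eventually_near_points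
    by eventually_elim (use assms(3) in \<open>auto simp: points_tangent_bundle\<close>)
qed

context
  fixes X Y p v F
  assumes X: "vector_field A X" and Y: "vector_field A Y" and v: "v \<in> tangent p" and F: "F \<in> T.sm (p, v)"
begin

lemma hlift_hlift_commutator:
  "hlift A D X (p, v) (\<lambda>z. hlift A D Y z F) - hlift A D Y (p, v) (\<lambda>z. hlift A D X z F)
    = hlift A D (lie_bracket A X Y) (p, v) F"
proof (rule T_bracket_eqI[OF hlift_field[OF X] hlift_field[OF Y] v hlift_tangent[OF lie_bracket_field[OF X Y] v] F])
  fix f assume f: "f \<in> sm p"
  note p = sm_points[OF f]
  have *: "hlift A D Z (p, v) (\<lambda>z. hlift A D W z (\<lambda>z. f (fst z))) = Z p (\<lambda>q. W q f)"
    if Z: "vector_field A Z" and W: "vector_field A W" for Z W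
  proof -
    have "hlift A D Z (p, v) (\<lambda>z. hlift A D W z (\<lambda>z. f (fst z))) = hlift A D Z (p, v) (\<lambda>z. W (fst z) f)"
      by (rule T_near_lift[OF v f]) (simp_all add: hlift_fst[OF W] hlift_tangent[OF Z v])
    then show ?thesis using hlift_fst[OF Z v vector_field_sm[OF W f]] by simp
  qed
  show "hlift A D X (p, v) (\<lambda>z. hlift A D Y z (\<lambda>z. f (fst z)))
      - hlift A D Y (p, v) (\<lambda>z. hlift A D X z (\<lambda>z. f (fst z)))
      = hlift A D (lie_bracket A X Y) (p, v) (\<lambda>z. f (fst z))"
    by (simp add: *[OF X Y] *[OF Y X] hlift_fst[OF lie_bracket_field[OF X Y] v f]) (simp add: lie_bracket_def f)
  obtain V where V: "vector_field A V" "V p = v" using extend_tangent[OF v] .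
  have DV: "D V (lie_bracket A X Y) p f = D V (D X Y) p f - D V (D Y X) p f"
    unfolding torsion[OF X Y] D_diff2[OF V(1) D_field[OF X Y] D_field[OF Y X]] by (simp add: vf_diff_def)
  have "v (\<lambda>q. lie_bracket A X Y q f) = v (\<lambda>q. X q (\<lambda>r. Y r f) - Y q (\<lambda>r. X r f))"
    by (rule tangent_cong[OF v]) (use sm_eventually[OF f] in \<open>eventually_elim, simp add: lie_bracket_def\<close>)
  also have "\<dots> = v (\<lambda>q. X q (\<lambda>r. Y r f)) - v (\<lambda>q. Y q (\<lambda>r. X r f))"
    by (intro tangent_diff[OF v] vector_field_sm[OF X] vector_field_sm[OF Y] f)
  finally show "hlift A D X (p, v) (\<lambda>z. hlift A D Y z (\<lambda>z. snd z f))
      - hlift A D Y (p, v) (\<lambda>z. hlift A D X z (\<lambda>z. snd z f))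
      = hlift A D (lie_bracket A X Y) (p, v) (\<lambda>z. snd z f)"
    using hlift_hlift_linear[OF X Y V(1) p f] hlift_hlift_linear[OF Y X V(1) p f]
      hlift_linear[OF lie_bracket_field[OF X Y] v f V] DV
    by (simp add: V(2))
qed

text \<open>Let l be the fibrewise linear function of f. Then X^h (Y^v l) is X(Y f), while X^h l is
  itself linear in the fibre, so its vertical derivative is Y(X f) - (D Y X) f. Torsion-freeness
  turns the difference into (D X Y) f.\<close>

lemma hlift_vlift_commutator:
  "hlift A D X (p, v) (\<lambda>z. vlift A Y z F) - vlift A Y (p, v) (\<lambda>z. hlift A D X z F) = vlift A (D X Y) (p, v) F"
proof (rule T_bracket_eqI[OF hlift_field[OF X] vlift_field[OF Y] v vlift_tangent[OF D_field[OF X Y] v] F])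
  fix f assume f: "f \<in> sm p"
  note p = sm_points[OF f]
  note hX = hlift_tangent[OF X v] and vY = vlift_tangent[OF Y v]
  have "hlift A D X (p, v) (\<lambda>z. vlift A Y z (\<lambda>z. f (fst z))) = hlift A D X (p, v) (\<lambda>z. 0)"
    by (rule T_near_lift[OF v f _ hX]) (simp add: vlift_fst)
  moreover have "vlift A Y (p, v) (\<lambda>z. hlift A D X z (\<lambda>z. f (fst z))) = vlift A Y (p, v) (\<lambda>z. X (fst z) f)"
    by (rule T_near_lift[OF v f _ vY]) (simp add: hlift_fst[OF X])
  ultimately show "hlift A D X (p, v) (\<lambda>z. vlift A Y z (\<lambda>z. f (fst z)))
      - vlift A Y (p, v) (\<lambda>z. hlift A D X z (\<lambda>z. f (fst z))) = vlift A (D X Y) (p, v) (\<lambda>z. f (fst z))"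
    using vlift_fst[OF v vector_field_sm[OF X f]] by (simp add: T.tangent_const[OF hX] vlift_fst[OF v f])
  have "hlift A D X (p, v) (\<lambda>z. vlift A Y z (\<lambda>z. snd z f)) = hlift A D X (p, v) (\<lambda>z. Y (fst z) f)"
    by (rule T_near_lift[OF v f _ hX]) (simp add: vlift_linear)
  then have 1: "hlift A D X (p, v) (\<lambda>z. vlift A Y z (\<lambda>z. snd z f)) = X p (\<lambda>q. Y q f)"
    using hlift_fst[OF X v vector_field_sm[OF Y f]] by simp
  obtain V where V: "vector_field A V" "V p = v" using extend_tangent[OF v] .
  have Yp: "Y p \<in> tangent p" by (rule vector_field_tangent[OF Y p])
  have "hlift A D X (p, \<lambda>g. v g + t * Y p g) (\<lambda>z. snd z f)
      = (v (\<lambda>q. X q f) - D V X p f) + t * (Y p (\<lambda>q. X q f) - D Y X p f)" for t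
  proof -
    let ?W = "vf_add V (vf_mult (\<lambda>_. t) Y)"
    have W: "vector_field A ?W" "?W p = (\<lambda>g. v g + t * Y p g)"
      using vector_field_add[OF V(1) vector_field_mult[OF smooth_fun_const Y]]
      by (simp_all add: vf_add_def vf_mult_def V(2))
    have "D ?W X p f = 1 * D V X p f + t * D Y X p f"
      by (rule D_cong_lincomb[OF W(1) V(1) Y X p]) (simp add: vf_add_def vf_mult_def)
    then show ?thesis
      using hlift_linear[OF X tangent_lincomb[OF v Yp, of 1 t] f W(1)] W(2) by (simp add: algebra_simps)
  qed
  moreover have "((\<lambda>t. (v (\<lambda>q. X q f) - D V X p f) + t * (Y p (\<lambda>q. X q f) - D Y X p f))
      has_real_derivative Y p (\<lambda>q. X q f) - D Y X p f) (at 0)"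
    by (auto intro!: derivative_eq_intros)
  ultimately have "vlift A Y (p, v) (\<lambda>z. hlift A D X z (\<lambda>z. snd z f)) = Y p (\<lambda>q. X q f) - D Y X p f"
    using T.vector_field_sm[OF hlift_field[OF X] linear_sm[OF v f]]
    by (simp add: vlift_apply[OF v] DERIV_imp_deriv)
  then show "hlift A D X (p, v) (\<lambda>z. vlift A Y z (\<lambda>z. snd z f))
      - vlift A Y (p, v) (\<lambda>z. hlift A D X z (\<lambda>z. snd z f)) = vlift A (D X Y) (p, v) (\<lambda>z. snd z f)"
    using torsion_apply[OF X Y f] by (simp add: 1 vlift_linear[OF v f])
qed

text \<open>A vertical lift sends fibrewise linear functions to pulled-back ones and annihilates the
  latter, so both iterated derivatives vanish on test functions.\<close>

lemma vlift_vlift_commutator: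
  "vlift A X (p, v) (\<lambda>z. vlift A Y z F) = vlift A Y (p, v) (\<lambda>z. vlift A X z F)"
proof -
  have z: "(p, v) \<in> points (tangent_bundle A)" using v by (simp add: points_tangent_bundle)
  have "vlift A X (p, v) (\<lambda>z. vlift A Y z F) - vlift A Y (p, v) (\<lambda>z. vlift A X z F) = (\<lambda>_. 0) F"
  proof (rule T_bracket_eqI[OF vlift_field[OF X] vlift_field[OF Y] v T.tangent_zero[OF z] F])
    fix f assume f: "f \<in> sm p"
    have 1: "vlift A Z (p, v) (\<lambda>z. vlift A W z (\<lambda>z. f (fst z))) = 0"
      if Z: "vector_field A Z" for Z W
    proof -
      have "vlift A Z (p, v) (\<lambda>z. vlift A W z (\<lambda>z. f (fst z))) = vlift A Z (p, v) (\<lambda>z. 0)"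
        by (rule T_near_lift[OF v f _ vlift_tangent[OF Z v]]) (simp add: vlift_fst)
      then show ?thesis by (simp add: T.tangent_const[OF vlift_tangent[OF Z v]])
    qed
    have 2: "vlift A Z (p, v) (\<lambda>z. vlift A W z (\<lambda>z. snd z f)) = 0"
      if Z: "vector_field A Z" and W: "vector_field A W" for Z W
    proof -
      have "vlift A Z (p, v) (\<lambda>z. vlift A W z (\<lambda>z. snd z f)) = vlift A Z (p, v) (\<lambda>z. W (fst z) f)"
        by (rule T_near_lift[OF v f _ vlift_tangent[OF Z v]]) (simp add: vlift_linear)
      then show ?thesis using vlift_fst[OF v vector_field_sm[OF W f]] by simp
    qed
    show "vlift A X (p, v) (\<lambda>z. vlift A Y z (\<lambda>z. f (fst z))) - vlift A Y (p, v) (\<lambda>z. vlift A X z (\<lambda>z. f (fst z))) = 0"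
      by (simp add: 1 X Y)
    show "vlift A X (p, v) (\<lambda>z. vlift A Y z (\<lambda>z. snd z f)) - vlift A Y (p, v) (\<lambda>z. vlift A X z (\<lambda>z. snd z f)) = 0"
      by (simp add: 2 X Y)
  qed
  then show ?thesis by simp
qed

end

section \<open>Linearity of the lifts and the splitting of the tangent spaces of TM\<close>

lemma vlift_lincomb:
  assumes X: "vector_field A X" and Y: "vector_field A Y" and Z: "vector_field A Z" and v: "v \<in> tangent p"
    and eq: "Z p = (\<lambda>f. s * X p f + t * Y p f)"
  shows "vlift A Z (p, v) = (\<lambda>F. s * vlift A X (p, v) F + t * vlift A Y (p, v) F)"
  by (rule T_tangent_eqI[OF vlift_tangent[OF Z v] T.tangent_lincomb[OF vlift_tangent[OF X v] vlift_tangent[OF Y v]]])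
    (simp_all add: vlift_fst[OF v] vlift_linear[OF v] eq)

lemma vector_field_lincomb:
  assumes "vector_field A X" "vector_field A Y"
  shows "vector_field A (\<lambda>q f. s * X q f + t * Y q f)"
  using vector_field_add[OF vector_field_mult[OF smooth_fun_const assms(1)] vector_field_mult[OF smooth_fun_const assms(2)]]
  by (simp add: vf_add_def vf_mult_def)

lemma D_lincomb2:
  assumes V: "vector_field A V" and X: "vector_field A X" and Y: "vector_field A Y" and p: "p \<in> points A"
  shows "D V (\<lambda>q f. s * X q f + t * Y q f) p f = s * D V X p f + t * D V Y p f"
proof -
  have "D V (\<lambda>q f. s * X q f + t * Y q f) p f = D V (vf_add (vf_mult (\<lambda>_. s) X) (vf_mult (\<lambda>_. t) Y)) p f"
    by (simp add: vf_add_def vf_mult_def)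
  also have "\<dots> = s * D V X p f + t * D V Y p f"
    unfolding D_add2[OF V vector_field_mult[OF smooth_fun_const X] vector_field_mult[OF smooth_fun_const Y]]
      D_mult2[OF smooth_fun_const V X] D_mult2[OF smooth_fun_const V Y]
    by (simp add: vf_add_def vf_mult_def tangent_const[OF vector_field_tangent[OF V p]])
  finally show ?thesis .
qed

lemma hlift_lincomb:
  assumes X: "vector_field A X" and Y: "vector_field A Y" and v: "v \<in> tangent p"
    and eq: "Z p = (\<lambda>f. s * X p f + t * Y p f)"
  shows "hlift A D Z (p, v) = (\<lambda>F. s * hlift A D X (p, v) F + t * hlift A D Y (p, v) F)"
proof -
  let ?Z = "\<lambda>q f. s * X q f + t * Y q f"
  have Z: "vector_field A ?Z" by (rule vector_field_lincomb[OF X Y])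
  obtain V where V: "vector_field A V" "V p = v" using extend_tangent[OF v] .
  have "hlift A D ?Z (p, v) = (\<lambda>F. s * hlift A D X (p, v) F + t * hlift A D Y (p, v) F)"
  proof (rule T_tangent_eqI[OF hlift_tangent[OF Z v] T.tangent_lincomb[OF hlift_tangent[OF X v] hlift_tangent[OF Y v]]])
    fix f assume f: "f \<in> sm p"
    show "hlift A D ?Z (p, v) (\<lambda>z. f (fst z))
        = s * hlift A D X (p, v) (\<lambda>z. f (fst z)) + t * hlift A D Y (p, v) (\<lambda>z. f (fst z))"
      by (simp add: hlift_fst[OF Z v f] hlift_fst[OF X v f] hlift_fst[OF Y v f])
    have Xf: "(\<lambda>q. s * X q f) \<in> sm p" "(\<lambda>q. t * Y q f) \<in> sm p"
      using sm_mult[OF sm_const vector_field_sm[OF X f]] sm_mult[OF sm_const vector_field_sm[OF Y f]] sm_points[OF f]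
      by auto
    have "v (\<lambda>q. s * X q f + t * Y q f) = s * v (\<lambda>q. X q f) + t * v (\<lambda>q. Y q f)"
      by (simp add: tangent_add[OF v Xf] tangent_cmult[OF v vector_field_sm[OF X f]]
          tangent_cmult[OF v vector_field_sm[OF Y f]])
    then show "hlift A D ?Z (p, v) (\<lambda>z. snd z f)
        = s * hlift A D X (p, v) (\<lambda>z. snd z f) + t * hlift A D Y (p, v) (\<lambda>z. snd z f)"
      by (simp add: hlift_linear[OF Z v f V] hlift_linear[OF X v f V] hlift_linear[OF Y v f V]
          D_lincomb2[OF V(1) X Y sm_points[OF f]] algebra_simps)
  qed
  moreover have "hlift A D Z (p, v) = hlift A D ?Z (p, v)" by (rule hlift_cong) (simp add: eq)
  ultimately show ?thesis by simp
qed

text \<open>\<open>X\<close> is chosen to match \<open>w\<close> on pulled-back coordinates, where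
  vertical lifts vanish; \<open>Y\<close> then accounts for what the lift of \<open>X\<close> leaves
  over on the fibrewise linear ones.\<close>

lemma lift_decompose:
  assumes w: "w \<in> T.tangent (p, v)"
  obtains X Y where "vector_field A X" "vector_field A Y"
    "w = (\<lambda>F. hlift A D X (p, v) F + vlift A Y (p, v) F)"
proof -
  have v: "v \<in> tangent p" using T.tangent_points[OF w] by (simp add: points_tangent_bundle)
  obtain U \<phi> where c: "(U, \<phi>) \<in> A" "p \<in> U" using tangent_points[OF v] by (rule points_chart)
  have z: "(p, v) \<in> Sigma U tangent" using c v by simp
  obtain X where X: "vector_field A X"
    "X p = chart_tvec A (U, \<phi>) p (\<Sum>b\<in>Basis. w (\<lambda>z. \<phi> (fst z) \<bullet> b) *\<^sub>R b)"
    using extend_tangent[OF chart_tvec_in_tangent[OF c]] by blast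
  obtain Y where Y: "vector_field A Y"
    "Y p = chart_tvec A (U, \<phi>) p (\<Sum>b\<in>Basis. (w (\<lambda>z. snd z (\<lambda>q. \<phi> q \<bullet> b))
      - hlift A D X (p, v) (\<lambda>z. snd z (\<lambda>q. \<phi> q \<bullet> b))) *\<^sub>R b)"
    using extend_tangent[OF chart_tvec_in_tangent[OF c]] by blast
  have mem: "(\<lambda>F. hlift A D X (p, v) F + vlift A Y (p, v) F) \<in> T.tangent (p, v)"
    using T.tangent_lincomb[OF hlift_tangent[OF X(1) v] vlift_tangent[OF Y(1) v], of 1 1] by simp
  have comp: "(\<Sum>b\<in>Basis. g b *\<^sub>R b) \<bullet> a = g a" if "a \<in> Basis" for g and a :: 'e
    using that by (simp add: inner_sum_left inner_Basis if_distrib cong: if_cong)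
  have "w = (\<lambda>F. hlift A D X (p, v) F + vlift A Y (p, v) F)"
  proof (rule T.tangent_eqI[OF w mem tangent_bundle_chart[OF c(1)] z])
    fix b :: "'e \<times> 'e" assume "b \<in> Basis"
    then consider a where "b = (a, 0)" "a \<in> Basis" | a where "b = (0, a)" "a \<in> Basis"
      by (auto simp: Basis_prod_def)
    then show "w (\<lambda>z. tmap \<phi> z \<bullet> b) = hlift A D X (p, v) (\<lambda>z. tmap \<phi> z \<bullet> b) + vlift A Y (p, v) (\<lambda>z. tmap \<phi> z \<bullet> b)"
    proof cases
      case (1 a)
      then show ?thesis
        using hlift_fst[OF X(1) v sm_coord[OF c, of a]] vlift_fst[OF v sm_coord[OF c, of a]]
        by (simp add: tmap_coord X(2) chart_tvec_coord[OF c] comp)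
    next
      case (2 a)
      then show ?thesis
        using vlift_linear[OF v sm_coord[OF c, of a]]
        by (simp add: tmap_coord Y(2) chart_tvec_coord[OF c] comp)
    qed
  qed
  then show ?thesis using that X(1) Y(1) by blast
qed

lemma lift_unique:
  assumes X: "vector_field A X" and Y: "vector_field A Y" and X': "vector_field A X'" and Y': "vector_field A Y'"
    and v: "v \<in> tangent p"
    and eq: "(\<lambda>F. hlift A D X (p, v) F + vlift A Y (p, v) F) = (\<lambda>F. hlift A D X' (p, v) F + vlift A Y' (p, v) F)"
  shows "X p = X' p \<and> Y p = Y' p"
proof -
  note p = tangent_points[OF v]
  have 1: "X p = X' p"
  proof
    fix f show "X p f = X' p f"
    proof (cases "f \<in> sm p")
      case True
      then show ?thesis
        using fun_cong[OF eq, of "\<lambda>z. f (fst z)"]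
        by (simp add: hlift_fst[OF X v] hlift_fst[OF X' v] vlift_fst[OF v])
    qed (simp add: tangent_outside[OF vector_field_tangent[OF X p]] tangent_outside[OF vector_field_tangent[OF X' p]])
  qed
  have "Y p = Y' p"
  proof
    fix f show "Y p f = Y' p f"
    proof (cases "f \<in> sm p")
      case True
      then show ?thesis
        using fun_cong[OF eq, of "\<lambda>z. snd z f"] hlift_cong[of X p X' v, OF 1] by (simp add: vlift_linear[OF v])
    qed (simp add: tangent_outside[OF vector_field_tangent[OF Y p]] tangent_outside[OF vector_field_tangent[OF Y' p]])
  qed
  with 1 show ?thesis by simp
qed

text \<open>The lifts split the tangent space, so a covector can be prescribed independently on the
  two parts. Taking \<open>a\<close> or \<open>b\<close> to be zero makes the descriptions in
  \<open>vlift_form\<close> and \<open>hlift_form\<close> well defined.\<close>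

lemma lift_covector:
  assumes a: "a \<in> cotangent p" and b: "b \<in> cotangent p" and v: "v \<in> tangent p"
  shows "\<exists>!c. c \<in> T.cotangent (p, v) \<and>
    (\<forall>X. vector_field A X \<longrightarrow> c (hlift A D X (p, v)) = a (X p) \<and> c (vlift A X (p, v)) = b (X p))"
proof (rule ex1I)
  note p = tangent_points[OF v]
  define R where "R = (\<lambda>w XY. vector_field A (fst XY) \<and> vector_field A (snd XY) \<and>
    w = (\<lambda>F. hlift A D (fst XY) (p, v) F + vlift A (snd XY) (p, v) F))"
  \<comment> \<open>The chosen pair of fields is not unique, but by \<open>lift_unique\<close> its
    values at \<open>p\<close> are, and only these enter.\<close>
  define c where "c = (\<lambda>w. if w \<in> T.tangent (p, v) then a (fst (SOME XY. R w XY) p) + b (snd (SOME XY. R w XY) p) else 0)"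
  have mem: "(\<lambda>F. hlift A D X (p, v) F + vlift A Y (p, v) F) \<in> T.tangent (p, v)"
    if "vector_field A X" "vector_field A Y" for X Y
    using T.tangent_lincomb[OF hlift_tangent[OF that(1) v] vlift_tangent[OF that(2) v], of 1 1] by simp
  have c: "c (\<lambda>F. hlift A D X (p, v) F + vlift A Y (p, v) F) = a (X p) + b (Y p)"
    if X: "vector_field A X" and Y: "vector_field A Y" for X Y
  proof -
    let ?w = "\<lambda>F. hlift A D X (p, v) F + vlift A Y (p, v) F"
    have "R ?w (X, Y)" using X Y by (simp add: R_def)
    define Z where "Z = (SOME XY. R ?w XY)"
    have "R ?w Z" unfolding Z_def using \<open>R ?w (X, Y)\<close> by (rule someI)
    then have Z: "vector_field A (fst Z)" "vector_field A (snd Z)"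
      "?w = (\<lambda>F. hlift A D (fst Z) (p, v) F + vlift A (snd Z) (p, v) F)" unfolding R_def by blast+
    have "X p = fst Z p \<and> Y p = snd Z p" by (rule lift_unique[OF X Y Z(1,2) v Z(3)])
    then show ?thesis using mem[OF X Y] by (simp add: c_def Z_def)
  qed
  have lin: "c (\<lambda>F. s * w F + t * w' F) = s * c w + t * c w'"
    if w: "w \<in> T.tangent (p, v)" "w' \<in> T.tangent (p, v)" for w w' s t
  proof -
    obtain X Y where XY: "vector_field A X" "vector_field A Y"
      "w = (\<lambda>F. hlift A D X (p, v) F + vlift A Y (p, v) F)" using lift_decompose[OF w(1)] .
    obtain X' Y' where XY': "vector_field A X'" "vector_field A Y'"
      "w' = (\<lambda>F. hlift A D X' (p, v) F + vlift A Y' (p, v) F)" using lift_decompose[OF w(2)] .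
    let ?X = "\<lambda>q f. s * X q f + t * X' q f" and ?Y = "\<lambda>q f. s * Y q f + t * Y' q f"
    have X: "vector_field A ?X" and Y: "vector_field A ?Y"
      by (simp_all add: vector_field_lincomb XY XY')
    have "(\<lambda>F. s * w F + t * w' F) = (\<lambda>F. hlift A D ?X (p, v) F + vlift A ?Y (p, v) F)"
      using hlift_lincomb[OF XY(1) XY'(1) v, of ?X s t] vlift_lincomb[OF XY(2) XY'(2) Y v]
      by (simp add: XY(3) XY'(3) algebra_simps)
    then show ?thesis
      using c[OF X Y] c[OF XY(1,2)] c[OF XY'(1,2)]
        cotangent_lincomb[OF a vector_field_tangent[OF XY(1) p] vector_field_tangent[OF XY'(1) p], of s t]
        cotangent_lincomb[OF b vector_field_tangent[OF XY(2) p] vector_field_tangent[OF XY'(2) p], of s t]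
      by (simp add: XY(3) XY'(3) algebra_simps)
  qed
  have zero: "hlift A D (\<lambda>_ _. 0) (p, v) = (\<lambda>_. 0)" "vlift A (\<lambda>_ _. 0) (p, v) = (\<lambda>_. 0)"
    using hlift_lincomb[OF vector_field_zero vector_field_zero v, of "\<lambda>_ _. 0" 0 0]
      vlift_lincomb[OF vector_field_zero vector_field_zero vector_field_zero v, of 0 0] by simp_all
  have zero': "a (\<lambda>_. 0) = 0" "b (\<lambda>_. 0) = 0"
    using cotangent_sum[OF a p, of "{}"] cotangent_sum[OF b p, of "{}"] by simp_all
  show "c \<in> T.cotangent (p, v) \<and>
    (\<forall>X. vector_field A X \<longrightarrow> c (hlift A D X (p, v)) = a (X p) \<and> c (vlift A X (p, v)) = b (X p))"
  proof (intro conjI allI impI)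
    show "c \<in> T.cotangent (p, v)" using lin by (simp add: cotangent_space_def c_def)
    fix X assume X: "vector_field A X"
    show "c (hlift A D X (p, v)) = a (X p)" using c[OF X vector_field_zero] by (simp add: zero zero')
    show "c (vlift A X (p, v)) = b (X p)" using c[OF vector_field_zero X] by (simp add: zero zero')
  qed
  fix c' assume c': "c' \<in> T.cotangent (p, v) \<and>
    (\<forall>X. vector_field A X \<longrightarrow> c' (hlift A D X (p, v)) = a (X p) \<and> c' (vlift A X (p, v)) = b (X p))"
  have "c \<in> T.cotangent (p, v)" using lin by (simp add: cotangent_space_def c_def)
  then show "c' = c"
  proof (rule T.cotangent_eqI[rotated])
    show "c' \<in> T.cotangent (p, v)" using c' by simp
    fix w assume w: "w \<in> T.tangent (p, v)"
    obtain X Y where XY: "vector_field A X" "vector_field A Y"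
      "w = (\<lambda>F. hlift A D X (p, v) F + vlift A Y (p, v) F)" using lift_decompose[OF w] .
    have "c' w = 1 * c' (hlift A D X (p, v)) + 1 * c' (vlift A Y (p, v))"
      using T.cotangent_lincomb[OF conjunct1[OF c'] hlift_tangent[OF XY(1) v] vlift_tangent[OF XY(2) v], of 1 1]
      by (simp add: XY(3))
    then show "c' w = c w" using c' XY c[OF XY(1,2)] by simp
  qed
qed

end


section \<open>Tensors on a finite-dimensional vector space\<close>

text \<open>\<open>symmetric_tensor\<close> demands linearity in the first argument only, and
  \<open>double_tensor r\<close> is skew; this common notion covers both. Nothing is asked on
  arguments that are not linear.\<close>

definition dual_bilinear :: "'g::real_vector dual_form \<Rightarrow> bool" where
  "dual_bilinear T \<longleftrightarrow> (\<forall>\<alpha> \<beta> \<gamma> s t. linear \<alpha> \<longrightarrow> linear \<beta> \<longrightarrow> linear \<gamma> \<longrightarrow>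
     T (\<lambda>u. s * \<alpha> u + t * \<beta> u) \<gamma> = s * T \<alpha> \<gamma> + t * T \<beta> \<gamma> \<and>
     T \<gamma> (\<lambda>u. s * \<alpha> u + t * \<beta> u) = s * T \<gamma> \<alpha> + t * T \<gamma> \<beta>)"

lemma dual_bilinearD:
  assumes "dual_bilinear T" "linear \<alpha>" "linear \<beta>" "linear \<gamma>"
  shows "T (\<lambda>u. s * \<alpha> u + t * \<beta> u) \<gamma> = s * T \<alpha> \<gamma> + t * T \<beta> \<gamma>"
    and "T \<gamma> (\<lambda>u. s * \<alpha> u + t * \<beta> u) = s * T \<gamma> \<alpha> + t * T \<gamma> \<beta>"
  using assms unfolding dual_bilinear_def by blast+

lemma linear_lincomb:
  fixes \<alpha> \<beta> :: "'g::real_vector \<Rightarrow> real"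
  assumes "linear \<alpha>" "linear \<beta>"
  shows "linear (\<lambda>u. s * \<alpha> u + t * \<beta> u)"
  using linear_compose_add[OF linear_compose_scale_right[OF assms(1), of s] linear_compose_scale_right[OF assms(2), of t]]
  by simp

lemma linear_zero_form: "linear (\<lambda>u::'g::real_vector. 0::real)"
  by (rule linear_zero)

lemma linear_sum_form:
  fixes f :: "'i \<Rightarrow> 'g::real_vector \<Rightarrow> real"
  assumes "\<And>i. i \<in> I \<Longrightarrow> linear (f i)"
  shows "linear (\<lambda>u. \<Sum>i\<in>I. c i * f i u)"
  using linear_compose_sum[of I "\<lambda>i u. c i *\<^sub>R f i u"] linear_compose_scale_right[OF assms] by simp

lemma dual_bilinear_zero:
  assumes "dual_bilinear T" "linear \<gamma>"
  shows "T (\<lambda>u. 0) \<gamma> = 0" "T \<gamma> (\<lambda>u. 0) = 0"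
  using dual_bilinearD[OF assms(1) linear_zero_form linear_zero_form assms(2), of 0 0] by simp_all

lemma dual_bilinear_sum:
  assumes T: "dual_bilinear T" and \<gamma>: "linear \<gamma>" and f: "\<And>i. i \<in> I \<Longrightarrow> linear (f i)"
  shows "T (\<lambda>u. \<Sum>i\<in>I. c i * f i u) \<gamma> = (\<Sum>i\<in>I. c i * T (f i) \<gamma>)"
    and "T \<gamma> (\<lambda>u. \<Sum>i\<in>I. c i * f i u) = (\<Sum>i\<in>I. c i * T \<gamma> (f i))"
proof -
  have "T (\<lambda>u. \<Sum>i\<in>I. c i * f i u) \<gamma> = (\<Sum>i\<in>I. c i * T (f i) \<gamma>) \<and>
      T \<gamma> (\<lambda>u. \<Sum>i\<in>I. c i * f i u) = (\<Sum>i\<in>I. c i * T \<gamma> (f i))"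
  proof (cases "finite I")
    case True
    then show ?thesis using f
    proof (induction I)
      case (insert i I)
      have "linear (f i)" "linear (\<lambda>u. \<Sum>i\<in>I. c i * f i u)"
        using insert by (auto intro: linear_sum_form)
      then show ?case
        using dual_bilinearD[OF T _ _ \<gamma>, of "f i" "\<lambda>u. \<Sum>i\<in>I. c i * f i u" "c i" 1] insert by simp
    qed (simp add: dual_bilinear_zero[OF T \<gamma>])
  qed (simp add: dual_bilinear_zero[OF T \<gamma>])
  then show "T (\<lambda>u. \<Sum>i\<in>I. c i * f i u) \<gamma> = (\<Sum>i\<in>I. c i * T (f i) \<gamma>)"
    and "T \<gamma> (\<lambda>u. \<Sum>i\<in>I. c i * f i u) = (\<Sum>i\<in>I. c i * T \<gamma> (f i))" by auto
qed

lemma linear_inner_form: "linear (\<lambda>u::'g::euclidean_space. u \<bullet> i)"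
  by (rule bounded_linear.linear[OF bounded_linear_inner_left])

lemma linear_form_expand:
  fixes a :: "'g::euclidean_space \<Rightarrow> real"
  assumes "linear a"
  shows "a = (\<lambda>u. \<Sum>i\<in>Basis. a i * (u \<bullet> i))"
  by (rule ext, subst linear_expand_Basis[OF assms]) (simp add: mult.commute)

text \<open>Contraction with a basis and its dual returns the bilinear form, so
  \<open>push_tensor\<close> is independent of the basis. It is applied also to functionals that are
  not pairings with a covector, such as u to w(\<rho>(u) f) for a tangent vector w.\<close>

lemma tensor_eval:
  fixes T :: "'g::euclidean_space dual_form"
  assumes T: "dual_bilinear T" and a: "linear a" and b: "linear b"
  shows "(\<Sum>i\<in>Basis. \<Sum>j\<in>Basis. T (\<lambda>u. u \<bullet> i) (\<lambda>u. u \<bullet> j) * (a i * b j)) = T a b"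
proof -
  have "T a b = (\<Sum>i\<in>Basis. a i * T (\<lambda>u. u \<bullet> i) b)"
    by (subst linear_form_expand[OF a], rule dual_bilinear_sum(1)[OF T b linear_inner_form])
  also have "\<dots> = (\<Sum>i\<in>Basis. a i * (\<Sum>j\<in>Basis. b j * T (\<lambda>u. u \<bullet> i) (\<lambda>u. u \<bullet> j)))"
    by (subst linear_form_expand[OF b], subst dual_bilinear_sum(2)[OF T linear_inner_form linear_inner_form]) (rule refl)
  finally show ?thesis by (simp add: sum_distrib_left ac_simps)
qed

lemma symmetric_tensor_bilinear:
  assumes "symmetric_tensor r"
  shows "dual_bilinear r"
proof -
  have sym: "r \<alpha> \<beta> = r \<beta> \<alpha>" if "linear \<alpha>" "linear \<beta>" for \<alpha> \<beta>
    using assms that unfolding symmetric_tensor_def by blast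
  have lin: "r (\<lambda>u. s * \<alpha> u + t * \<beta> u) \<gamma> = s * r \<alpha> \<gamma> + t * r \<beta> \<gamma>"
    if "linear \<alpha>" "linear \<beta>" "linear \<gamma>" for \<alpha> \<beta> \<gamma> s t
    using assms that unfolding symmetric_tensor_def by blast
  show ?thesis
    unfolding dual_bilinear_def
  proof (intro allI impI conjI)
    fix \<alpha> \<beta> \<gamma> :: "'a \<Rightarrow> real" and s t assume l: "linear \<alpha>" "linear \<beta>" "linear \<gamma>"
    show "r (\<lambda>u. s * \<alpha> u + t * \<beta> u) \<gamma> = s * r \<alpha> \<gamma> + t * r \<beta> \<gamma>" by (rule lin[OF l])
    show "r \<gamma> (\<lambda>u. s * \<alpha> u + t * \<beta> u) = s * r \<gamma> \<alpha> + t * r \<gamma> \<beta>"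
      using lin[OF l] sym[OF l(3) linear_lincomb[OF l(1,2)]] sym[OF l(3) l(1)] sym[OF l(3) l(2)] by simp
  qed
qed

lemma linear_components:
  fixes a :: "'g::real_vector \<times> 'g \<Rightarrow> real"
  assumes "linear a"
  shows "linear (\<lambda>u. a (u, 0))" "linear (\<lambda>v. a (0, v))"
proof -
  have "linear (\<lambda>u::'g. (u, 0::'g))" "linear (\<lambda>v::'g. (0::'g, v))" by (auto simp: linear_iff)
  then show "linear (\<lambda>u. a (u, 0))" "linear (\<lambda>v. a (0, v))"
    using linear_compose[OF _ assms] by (auto simp: comp_def)
qed

lemma double_tensor_bilinear:
  assumes "dual_bilinear r"
  shows "dual_bilinear (double_tensor r)"
  unfolding dual_bilinear_def double_tensor_def
  by (simp add: dual_bilinearD[OF assms] linear_components algebra_simps)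

text \<open>The components of the witness are the values of \<open>r \<alpha>\<close> on the dual
  basis; any other candidate agrees with it under all coordinate functionals.\<close>

lemma tensor_sharp:
  fixes r :: "'g::euclidean_space dual_form"
  assumes r: "dual_bilinear r" and \<alpha>: "linear \<alpha>" and \<beta>: "linear \<beta>"
  shows "\<beta> (tensor_sharp r \<alpha>) = r \<alpha> \<beta>"
proof -
  let ?u = "\<Sum>j\<in>Basis. r \<alpha> (\<lambda>u. u \<bullet> j) *\<^sub>R j"
  have u: "\<gamma> ?u = r \<alpha> \<gamma>" if \<gamma>: "linear \<gamma>" for \<gamma>
  proof -
    have "r \<alpha> \<gamma> = (\<Sum>j\<in>Basis. \<gamma> j * r \<alpha> (\<lambda>u. u \<bullet> j))"
      by (subst linear_form_expand[OF \<gamma>], rule dual_bilinear_sum(2)[OF r \<alpha> linear_inner_form])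
    then show ?thesis by (simp add: linear_sum[OF \<gamma>] linear_cmul[OF \<gamma>] mult.commute)
  qed
  have "tensor_sharp r \<alpha> = ?u"
    unfolding tensor_sharp_def
  proof (rule the_equality)
    show "\<forall>\<beta>. linear \<beta> \<longrightarrow> \<beta> ?u = r \<alpha> \<beta>" using u by blast
    fix w assume w: "\<forall>\<beta>. linear \<beta> \<longrightarrow> \<beta> w = r \<alpha> \<beta>"
    show "w = ?u"
    proof (rule euclidean_eqI)
      fix j :: 'g
      show "w \<bullet> j = ?u \<bullet> j"
        using w[rule_format, OF linear_inner_form] u[OF linear_inner_form] by simp
    qed
  qed
  then show ?thesis using u[OF \<beta>] by simp
qed


section \<open>Push-forward of tensors along a linear family of vector fields\<close>

context atlas
begin

text \<open>The pointwise form of linearity shared by \<open>\<rho>\<close> and its horizontal,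
  vertical and combined lifts. Stated over an arbitrary atlas, it lets the same facts on
  push-forwards serve on both \<open>M\<close> and \<open>TM\<close>.\<close>

definition linear_fields :: "('g::real_vector \<Rightarrow> 'm vfield) \<Rightarrow> bool" where
  "linear_fields \<rho> \<longleftrightarrow> (\<forall>u. vector_field A (\<rho> u)) \<and>
     (\<forall>p\<in>points A. \<forall>u v s t. \<rho> (s *\<^sub>R u + t *\<^sub>R v) p = (\<lambda>f. s * \<rho> u p f + t * \<rho> v p f))"

context
  fixes \<rho> :: "'g::euclidean_space \<Rightarrow> 'm vfield"
  assumes \<rho>: "linear_fields \<rho>"
begin

lemma linear_fields_field: "vector_field A (\<rho> u)"
  using \<rho> by (simp add: linear_fields_def)

lemma linear_fields_apply: "p \<in> points A \<Longrightarrow> \<rho> (s *\<^sub>R u + t *\<^sub>R v) p = (\<lambda>f. s * \<rho> u p f + t * \<rho> v p f)"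
  using \<rho> by (simp add: linear_fields_def)

lemma linear_fields_covector:
  assumes "p \<in> points A" "a \<in> cotangent p"
  shows "linear (\<lambda>u. a (\<rho> u p))"
proof (rule linearI)
  note tan = vector_field_tangent[OF linear_fields_field assms(1)]
  show "a (\<rho> (u + v) p) = a (\<rho> u p) + a (\<rho> v p)" for u v
    using linear_fields_apply[OF assms(1), of 1 u 1 v] cotangent_lincomb[OF assms(2) tan tan, of 1 u 1 v] by simp
  show "a (\<rho> (k *\<^sub>R u) p) = k *\<^sub>R a (\<rho> u p)" for k u
    using linear_fields_apply[OF assms(1), of k u 0 u] cotangent_lincomb[OF assms(2) tan tan, of k u 0 u] by simp
qed

lemma linear_fields_value: "p \<in> points A \<Longrightarrow> linear (\<lambda>u. \<rho> u p f)"
  using linear_fields_apply[of p 1 _ 1] linear_fields_apply[of p _ _ 0]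
  by (auto intro!: linearI simp: fun_eq_iff)

lemma linear_fields_derivative:
  assumes v: "v \<in> tangent p" and f: "f \<in> sm p"
  shows "linear (\<lambda>u. v (\<lambda>q. \<rho> u q f))"
proof -
  have sm: "(\<lambda>q. \<rho> u q f) \<in> sm p" for u by (rule vector_field_sm[OF linear_fields_field f])
  have *: "v (\<lambda>q. \<rho> (s *\<^sub>R u + t *\<^sub>R u') q f) = s * v (\<lambda>q. \<rho> u q f) + t * v (\<lambda>q. \<rho> u' q f)" for s t u u'
  proof -
    have "v (\<lambda>q. \<rho> (s *\<^sub>R u + t *\<^sub>R u') q f) = v (\<lambda>q. s * \<rho> u q f + t * \<rho> u' q f)"
      by (rule tangent_cong[OF v]) (use eventually_near_points in \<open>eventually_elim, simp add: linear_fields_apply\<close>)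
    also have "\<dots> = v (\<lambda>q. s * \<rho> u q f) + v (\<lambda>q. t * \<rho> u' q f)"
      by (intro tangent_add[OF v] sm_mult sm_const tangent_points[OF v] sm)
    finally show ?thesis by (simp add: tangent_cmult[OF v sm])
  qed
  show ?thesis
    using *[of 1 _ 1] *[of _ _ 0] by (auto intro!: linearI)
qed

lemma push_tensor_eval:
  assumes T: "dual_bilinear T" and "p \<in> points A" "a \<in> cotangent p" "b \<in> cotangent p"
  shows "push_tensor \<rho> T p a b = T (\<lambda>u. a (\<rho> u p)) (\<lambda>u. b (\<rho> u p))"
  unfolding push_tensor_def
  by (rule tensor_eval[OF T linear_fields_covector[OF assms(2,3)] linear_fields_covector[OF assms(2,4)]])

lemma tensor2_field_push_tensor: "tensor2_field A (push_tensor \<rho> T)"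
proof -
  have "smooth_fun A (\<lambda>p. push_tensor \<rho> T p (\<alpha> p) (\<beta> p))" if "one_form A \<alpha>" "one_form A \<beta>" for \<alpha> \<beta>
    unfolding smooth_fun_def push_tensor_def
    by (intro ballI sm_sum, assumption+, rule sm_mult[OF sm_const sm_mult], assumption)
      (rule one_form_sm[OF that(1) linear_fields_field], assumption,
       rule one_form_sm[OF that(2) linear_fields_field], assumption)
  moreover have "push_tensor \<rho> T p (\<lambda>v. s * a v + t * b v) c = s * push_tensor \<rho> T p a c + t * push_tensor \<rho> T p b c"
    "push_tensor \<rho> T p c (\<lambda>v. s * a v + t * b v) = s * push_tensor \<rho> T p c a + t * push_tensor \<rho> T p c b"
    for p a b c s t
    by (simp_all add: push_tensor_def sum_distrib_left sum.distrib[symmetric] algebra_simps)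
  ultimately show ?thesis by (simp add: tensor2_field_def)
qed

text \<open>A tangent vector has a value on every function, and this value is linear in the vector,
  so \<open>f\<close> and \<open>g\<close> may be arbitrary. An inner bracket can thus be an
  argument of the outer one without a separate proof that it is smooth.\<close>

lemma poisson_bracket_push_tensor:
  assumes T: "dual_bilinear T" and p: "p \<in> points A"
  shows "poisson_bracket A (push_tensor \<rho> T) f g p = T (\<lambda>u. \<rho> u p f) (\<lambda>u. \<rho> u p g)"
  using tensor_eval[OF T linear_fields_value[OF p, of f] linear_fields_value[OF p, of g]]
    vector_field_tangent[OF linear_fields_field p]
  by (simp add: poisson_bracket_def push_tensor_def differential_def)

end

end


section \<open>Pushing forward a solution of the classical Yang--Baxter equation\<close>

locale yang_baxter = affine A D
  for A :: "('m, 'e::euclidean_space) atlas" and D :: "'m conn" +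
  fixes m :: "'g::euclidean_space \<Rightarrow> 'g \<Rightarrow> 'g" and \<rho> :: "'g \<Rightarrow> 'm vfield" and r :: "'g dual_form"
  assumes m: "bilinear m"
    and rho: "linear_into_fields A \<rho>"
    and rho_m: "\<And>u v. \<rho> (m u v) = D (\<rho> u) (\<rho> v)"
    and sym: "symmetric_tensor r"
    and bracket: "\<And>\<alpha> \<beta> \<gamma>. linear \<alpha> \<Longrightarrow> linear \<beta> \<Longrightarrow> linear \<gamma> \<Longrightarrow> tensor_bracket m r \<alpha> \<beta> \<gamma> = 0"
begin

lemma r_bilinear: "dual_bilinear r"
  by (rule symmetric_tensor_bilinear[OF sym])

lemma r_sym: "linear \<alpha> \<Longrightarrow> linear \<beta> \<Longrightarrow> r \<alpha> \<beta> = r \<beta> \<alpha>"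
  using sym unfolding symmetric_tensor_def by blast

abbreviation sh :: "('g \<Rightarrow> real) \<Rightarrow> 'g" where
  "sh \<equiv> tensor_sharp r"

lemma r_eq_sharp: "linear \<alpha> \<Longrightarrow> linear \<beta> \<Longrightarrow> r \<alpha> \<beta> = \<beta> (sh \<alpha>)"
  using tensor_sharp[OF r_bilinear] by simp

lemma linear_left: "linear \<beta> \<Longrightarrow> linear (\<lambda>v. \<beta> (m u v))"
  using m linear_compose[of "m u" \<beta>] by (simp add: bilinear_def comp_def)

text \<open>Symmetry of \<open>r\<close> moves the sharp across: \<gamma> at the sharp of a
  functional is that functional at the sharp of \<gamma>. The bracket condition then involves only
  products of sharps, the form in which both the Jacobi identity and the pseudo-Hessian condition
  use it.\<close>

lemma yang_baxter:
  assumes \<alpha>: "linear \<alpha>" and \<beta>: "linear \<beta>" and \<gamma>: "linear \<gamma>"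
  shows "\<gamma> (m (sh \<alpha>) (sh \<beta>)) - \<gamma> (m (sh \<beta>) (sh \<alpha>)) = \<alpha> (m (sh \<beta>) (sh \<gamma>)) - \<beta> (m (sh \<alpha>) (sh \<gamma>))"
proof -
  let ?\<delta> = "\<lambda>v. (- 1) * \<beta> (m (sh \<alpha>) v) + 1 * \<alpha> (m (sh \<beta>) v)"
  have \<delta>: "linear ?\<delta>" by (intro linear_lincomb linear_left \<alpha> \<beta>)
  have "?\<delta> = (\<lambda>v. left_coaction m (sh \<alpha>) \<beta> v - left_coaction m (sh \<beta>) \<alpha> v)"
    by (simp add: left_coaction_def)
  then have "\<gamma> (sh ?\<delta> - (m (sh \<alpha>) (sh \<beta>) - m (sh \<beta>) (sh \<alpha>))) = 0"
    using bracket[OF \<alpha> \<beta> \<gamma>] unfolding tensor_bracket_def Let_def by simp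
  then have "\<gamma> (sh ?\<delta>) = \<gamma> (m (sh \<alpha>) (sh \<beta>)) - \<gamma> (m (sh \<beta>) (sh \<alpha>))"
    by (simp add: linear_diff[OF \<gamma>])
  moreover have "\<gamma> (sh ?\<delta>) = ?\<delta> (sh \<gamma>)"
    using r_eq_sharp[OF \<delta> \<gamma>] r_eq_sharp[OF \<gamma> \<delta>] r_sym[OF \<delta> \<gamma>] by simp
  ultimately show ?thesis by simp
qed

lemma rho_field: "vector_field A (\<rho> u)"
  using rho by (simp add: linear_into_fields_def)

lemma rho_linear: "linear_fields \<rho>"
proof -
  have "\<rho> (s *\<^sub>R u + t *\<^sub>R v) = vf_add (vf_mult (\<lambda>_. s) (\<rho> u)) (vf_mult (\<lambda>_. t) (\<rho> v))" for s t u v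
    using rho by (simp add: linear_into_fields_def)
  then show ?thesis by (simp add: linear_fields_def rho_field vf_add_def vf_mult_def)
qed

section \<open>The tensor \<rho>(r) on M\<close>

abbreviation h :: "'m tensor2" where
  "h \<equiv> push_tensor \<rho> r"

lemmas h_eval = push_tensor_eval[OF rho_linear r_bilinear]
lemmas rho_covector = linear_fields_covector[OF rho_linear]
lemmas rho_apply = linear_fields_apply[OF rho_linear]

lemma symmetric_h: "symmetric_bivector_field A h"
  using tensor2_field_push_tensor[OF rho_linear]
  by (auto simp: symmetric_bivector_field_def h_eval intro!: r_sym rho_covector)

text \<open>Differentials of smooth germs already separate tangent vectors, and on all other
  functions every tangent vector is 0.\<close>

lemma tangent_separated:
  assumes "v \<in> tangent p" "w \<in> tangent p" "\<And>b. b \<in> cotangent p \<Longrightarrow> b v = b w"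
  shows "v = w"
proof
  fix f show "v f = w f"
    using assms(3)[OF differential_cotangent, of f] assms(1,2)
      tangent_outside[OF assms(1), of f] tangent_outside[OF assms(2), of f]
    by (cases "f \<in> sm p") (auto simp: differential_def)
qed

lemma sharp_eqI:
  assumes p: "p \<in> points A" and v: "v \<in> tangent p" "\<And>b. b \<in> cotangent p \<Longrightarrow> b v = h p (\<alpha> p) b"
  shows "sharp A h \<alpha> p = v"
  unfolding sharp_def if_P[OF p]
proof (rule the_equality)
  fix w assume "w \<in> tangent p \<and> (\<forall>b\<in>cotangent p. b w = h p (\<alpha> p) b)"
  then show "w = v" using v by (intro tangent_separated) auto
qed (use v in blast)

text \<open>The sharp serves as a direction of covariant differentiation, so it must be a smooth
  field. It is a combination of the fields \<rho>(e_j) whose coefficients, sums of r_ij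
  \<alpha>(\<rho>(e_i)), are globally smooth.\<close>

lemma sharp_field:
  assumes \<alpha>: "one_form A \<alpha>"
  shows "vector_field A (sharp A h \<alpha>)"
proof -
  define g where "g = (\<lambda>j q. \<Sum>i\<in>Basis. r (\<lambda>u. u \<bullet> i) (\<lambda>u. u \<bullet> j) * \<alpha> q (\<rho> i q))"
  let ?X = "\<lambda>q f. \<Sum>j\<in>Basis. g j q * \<rho> j q f"
  have "smooth_fun A (g j)" for j
    unfolding smooth_fun_def g_def
    by (intro ballI sm_sum, assumption, rule sm_mult[OF sm_const], assumption)
      (rule one_form_sm[OF \<alpha> rho_field], assumption)
  then have X: "vector_field A ?X" by (intro vector_field_sum rho_field)
  have "sharp A h \<alpha> q = ?X q" for q
  proof (cases "q \<in> points A")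
    case True
    show ?thesis
    proof (rule sharp_eqI[OF True vector_field_tangent[OF X True]])
      fix b assume "b \<in> cotangent q"
      from cotangent_sum[OF this True vector_field_tangent[OF rho_field True]]
      have "b (?X q) = (\<Sum>j\<in>Basis. g j q * b (\<rho> j q))" .
      also have "\<dots> = h q (\<alpha> q) b"
        unfolding g_def push_tensor_def by (subst sum.swap) (simp add: sum_distrib_right mult.assoc)
      finally show "b (?X q) = h q (\<alpha> q) b" .
    qed
  next
    case False
    then show ?thesis using vector_field_outside[OF X] by (simp add: sharp_def)
  qed
  then show ?thesis using X by (simp add: ext[of "sharp A h \<alpha>" ?X])
qed

text \<open>At a single point the sharp of \<alpha> equals \<rho> of one algebra element, which
  varies with the point. As \<open>D\<close> is tensorial in its first argument, this suffices to
  bring in the product \<open>m\<close>.\<close>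

lemma sharp_rho:
  assumes \<alpha>: "one_form A \<alpha>" and p: "p \<in> points A"
  shows "sharp A h \<alpha> p = \<rho> (sh (\<lambda>u. \<alpha> p (\<rho> u p))) p"
proof (rule sharp_eqI[OF p vector_field_tangent[OF rho_field p]])
  fix b assume b: "b \<in> cotangent p"
  note a = one_form_cotangent[OF \<alpha> p]
  show "b (\<rho> (sh (\<lambda>u. \<alpha> p (\<rho> u p))) p) = h p (\<alpha> p) b"
    using r_eq_sharp[OF rho_covector[OF p a] rho_covector[OF p b]] h_eval[OF p a b] by simp
qed

text \<open>The coefficients of \<open>r\<close> are constant, so the derivatives of the functions
  \<beta>(\<rho>(e_i)) and \<gamma>(\<rho>(e_j)) cancel. What remains comes from differentiating the
  fields \<rho>(e_i), which is left multiplication by \<open>sh a\<close> in the algebra.\<close>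

lemma nabla_h:
  assumes \<alpha>: "one_form A \<alpha>" and \<beta>: "one_form A \<beta>" and \<gamma>: "one_form A \<gamma>" and p: "p \<in> points A"
  defines "a \<equiv> \<lambda>u. \<alpha> p (\<rho> u p)" and "b \<equiv> \<lambda>u. \<beta> p (\<rho> u p)" and "c \<equiv> \<lambda>u. \<gamma> p (\<rho> u p)"
  shows "nabla_tensor2 A D (sharp A h \<alpha>) h \<beta> \<gamma> p = b (m (sh a) (sh c)) + c (m (sh a) (sh b))"
proof -
  define X where "X = sharp A h \<alpha>"
  let ?r = "\<lambda>i j. r (\<lambda>u. u \<bullet> i) (\<lambda>u. u \<bullet> j)"
  have X: "vector_field A X" unfolding X_def by (rule sharp_field[OF \<alpha>])
  note Xp = vector_field_tangent[OF X p]
  have b: "linear b" and c: "linear c"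
    unfolding b_def c_def by (intro rho_covector one_form_cotangent \<beta> \<gamma> p)+
  have DX: "D X (\<rho> u) p = \<rho> (m (sh a) u) p" for u
    using D_cong1[OF X rho_field rho_field p, of "sh a" u] sharp_rho[OF \<alpha> p] by (simp add: rho_m a_def X_def)
  have \<beta>i: "(\<lambda>q. \<beta> q (\<rho> u q)) \<in> sm p" and \<gamma>i: "(\<lambda>q. \<gamma> q (\<rho> u q)) \<in> sm p" for u
    by (rule one_form_sm[OF \<beta> rho_field p], rule one_form_sm[OF \<gamma> rho_field p])
  have prod: "(\<lambda>q. ?r i j * (\<beta> q (\<rho> i q) * \<gamma> q (\<rho> j q))) \<in> sm p" for i j
    by (intro sm_mult sm_const p \<beta>i \<gamma>i)
  have 1: "w (\<lambda>q. h q (\<beta> q) (\<gamma> q)) = (\<Sum>i\<in>Basis. \<Sum>j\<in>Basis.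
      ?r i j * (b i * w (\<lambda>q. \<gamma> q (\<rho> j q)) + w (\<lambda>q. \<beta> q (\<rho> i q)) * c j))"
    if w: "w \<in> tangent p" for w
    unfolding push_tensor_def b_def c_def
    by (simp add: tangent_sum[OF w] tangent_cmult[OF w sm_mult[OF \<beta>i \<gamma>i]] tangent_mult[OF w \<beta>i \<gamma>i]
        sm_sum[OF p] prod)
  have 2: "h p (nabla_form A D X \<beta> p) (\<gamma> p) = (\<Sum>i\<in>Basis. \<Sum>j\<in>Basis.
      ?r i j * ((X p (\<lambda>q. \<beta> q (\<rho> i q)) - b (m (sh a) i)) * c j))"
    by (simp add: push_tensor_def nabla_form(2)[OF \<beta> X p rho_field] DX b_def c_def)
  have 3: "h p (\<beta> p) (nabla_form A D X \<gamma> p) = (\<Sum>i\<in>Basis. \<Sum>j\<in>Basis.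
      ?r i j * (b i * (X p (\<lambda>q. \<gamma> q (\<rho> j q)) - c (m (sh a) j))))"
    by (simp add: push_tensor_def nabla_form(2)[OF \<gamma> X p rho_field] DX b_def c_def)
  have "nabla_tensor2 A D X h \<beta> \<gamma> p = (\<Sum>i\<in>Basis. \<Sum>j\<in>Basis. ?r i j * (b (m (sh a) i) * c j))
      + (\<Sum>i\<in>Basis. \<Sum>j\<in>Basis. ?r i j * (b i * c (m (sh a) j)))"
    unfolding nabla_tensor2_def 1[OF Xp] 2 3
    by (simp only: sum_subtractf[symmetric] sum.distrib[symmetric]) (simp add: algebra_simps)
  also have "\<dots> = r (\<lambda>u. b (m (sh a) u)) c + r b (\<lambda>u. c (m (sh a) u))"
    by (simp only: tensor_eval[OF r_bilinear linear_left[OF b] c] tensor_eval[OF r_bilinear b linear_left[OF c]])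
  also have "\<dots> = b (m (sh a) (sh c)) + c (m (sh a) (sh b))"
    using r_sym[OF linear_left[OF b] c] r_eq_sharp[OF c linear_left[OF b]] r_eq_sharp[OF b linear_left[OF c]] by simp
  finally show ?thesis by (simp add: X_def)
qed

lemma pseudo_hessian: "contravariant_pseudo_hessian A D h"
  unfolding contravariant_pseudo_hessian_def
proof (intro conjI allI impI ballI affine symmetric_h)
  fix \<alpha> \<beta> \<gamma> p assume f: "one_form A \<alpha>" "one_form A \<beta>" "one_form A \<gamma>" and p: "p \<in> points A"
  show "nabla_tensor2 A D (sharp A h \<alpha>) h \<beta> \<gamma> p = nabla_tensor2 A D (sharp A h \<beta>) h \<alpha> \<gamma> p"
    using yang_baxter[OF rho_covector rho_covector rho_covector, OF p one_form_cotangent[OF f(1) p]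
        p one_form_cotangent[OF f(2) p] p one_form_cotangent[OF f(3) p]]
    by (simp add: nabla_h f p)
qed


section \<open>The bivector field on the tangent bundle\<close>

abbreviation L :: "'g \<times> 'g \<Rightarrow> ('m \<times> 'm tvec) vfield" where
  "L \<equiv> lifted_map A D \<rho>"

abbreviation \<pi> :: "('m \<times> 'm tvec) tensor2" where
  "\<pi> \<equiv> push_tensor L (double_tensor r)"

lemma H_linear: "T.linear_fields (\<lambda>u. hlift A D (\<rho> u))"
  unfolding T.linear_fields_def
proof (intro conjI allI ballI hlift_field rho_field)
  fix z u u' s t assume "z \<in> points (tangent_bundle A)"
  then obtain p v where z: "z = (p, v)" and v: "v \<in> tangent p" by (cases z) (simp add: points_tangent_bundle)
  show "hlift A D (\<rho> (s *\<^sub>R u + t *\<^sub>R u')) z = (\<lambda>f. s * hlift A D (\<rho> u) z f + t * hlift A D (\<rho> u') z f)"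
    unfolding z by (rule hlift_lincomb[OF rho_field rho_field v]) (rule rho_apply[OF tangent_points[OF v]])
qed

lemma V_linear: "T.linear_fields (\<lambda>u. vlift A (\<rho> u))"
  unfolding T.linear_fields_def
proof (intro conjI allI ballI vlift_field rho_field)
  fix z u u' s t assume "z \<in> points (tangent_bundle A)"
  then obtain p v where z: "z = (p, v)" and v: "v \<in> tangent p" by (cases z) (simp add: points_tangent_bundle)
  show "vlift A (\<rho> (s *\<^sub>R u + t *\<^sub>R u')) z = (\<lambda>f. s * vlift A (\<rho> u) z f + t * vlift A (\<rho> u') z f)"
    unfolding z by (rule vlift_lincomb[OF rho_field rho_field rho_field v]) (rule rho_apply[OF tangent_points[OF v]])
qed

lemma L_linear: "T.linear_fields L"
  unfolding T.linear_fields_def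
proof (intro conjI allI ballI)
  fix w :: "'g \<times> 'g" show "vector_field (tangent_bundle A) (L w)"
    by (cases w) (simp add: lifted_map_def T.vector_field_add hlift_field vlift_field rho_field)
next
  fix z and w w' :: "'g \<times> 'g" and s t assume z: "z \<in> points (tangent_bundle A)"
  obtain u x u' x' where w: "w = (u, x)" "w' = (u', x')" by (cases w, cases w')
  show "L (s *\<^sub>R w + t *\<^sub>R w') z = (\<lambda>f. s * L w z f + t * L w' z f)"
    by (simp add: w lifted_map_def vf_add_def T.linear_fields_apply[OF H_linear z]
        T.linear_fields_apply[OF V_linear z] algebra_simps)
qed

lemmas Pi_eval = T.push_tensor_eval[OF L_linear double_tensor_bilinear[OF r_bilinear]]

lemma bivector_Pi: "bivector_field (tangent_bundle A) \<pi>"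
  using T.tensor2_field_push_tensor[OF L_linear]
  by (auto simp: bivector_field_def Pi_eval double_tensor_def)

context
  fixes p v
  assumes v: "v \<in> tangent p"
begin

lemma lift_point: "(p, v) \<in> points (tangent_bundle A)"
  using v by (simp add: points_tangent_bundle)

lemma rho_zero: "\<rho> 0 p = (\<lambda>_. 0)"
  using rho_apply[OF tangent_points[OF v], of 0 0 0 0] by simp

lemma lift_zero: "hlift A D (\<rho> 0) (p, v) = (\<lambda>_. 0)" "vlift A (\<rho> 0) (p, v) = (\<lambda>_. 0)"
  using hlift_lincomb[OF rho_field rho_field v, of "\<rho> 0" 0 0 0 0]
    vlift_lincomb[OF rho_field rho_field rho_field v, of 0 0 0 0 0] by (simp_all add: rho_zero)

lemma L_components: "L (u, 0) (p, v) = hlift A D (\<rho> u) (p, v)" "L (0, u) (p, v) = vlift A (\<rho> u) (p, v)"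
  by (simp_all add: lifted_map_def vf_add_def lift_zero)

lemma cotangent_zero: "(\<lambda>_. 0) \<in> cotangent p"
  by (simp add: cotangent_space_def)

context
  fixes \<alpha>
  assumes \<alpha>: "one_form A \<alpha>"
begin

lemma vlift_form:
  "vlift_form A D \<alpha> (p, v) \<in> T.cotangent (p, v)"
  "vector_field A X \<Longrightarrow> vlift_form A D \<alpha> (p, v) (hlift A D X (p, v)) = 0"
  "vector_field A X \<Longrightarrow> vlift_form A D \<alpha> (p, v) (vlift A X (p, v)) = \<alpha> p (X p)"
  using theI'[OF lift_covector[OF cotangent_zero one_form_cotangent[OF \<alpha> tangent_points[OF v]] v]]
  by (simp_all add: vlift_form_def conj_commute)

lemma hlift_form:
  "hlift_form A D \<alpha> (p, v) \<in> T.cotangent (p, v)"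
  "vector_field A X \<Longrightarrow> hlift_form A D \<alpha> (p, v) (hlift A D X (p, v)) = \<alpha> p (X p)"
  "vector_field A X \<Longrightarrow> hlift_form A D \<alpha> (p, v) (vlift A X (p, v)) = 0"
  using theI'[OF lift_covector[OF one_form_cotangent[OF \<alpha> tangent_points[OF v]] cotangent_zero v]]
  by (simp_all add: hlift_form_def)

end

text \<open>The double tensor pairs a horizontal component with a vertical one, and each lifted form
  has at most one nonzero component.\<close>

lemma associated_at:
  assumes \<alpha>: "one_form A \<alpha>" and \<beta>: "one_form A \<beta>"
  shows "\<pi> (p, v) (vlift_form A D \<alpha> (p, v)) (vlift_form A D \<beta> (p, v)) = 0"
    and "\<pi> (p, v) (hlift_form A D \<alpha> (p, v)) (hlift_form A D \<beta> (p, v)) = 0"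
    and "\<pi> (p, v) (hlift_form A D \<alpha> (p, v)) (vlift_form A D \<beta> (p, v)) = h p (\<alpha> p) (\<beta> p)"
    and "\<pi> (p, v) (vlift_form A D \<beta> (p, v)) (hlift_form A D \<alpha> (p, v)) = - h p (\<alpha> p) (\<beta> p)"
proof -
  note p = tangent_points[OF v]
  note lin = rho_covector[OF p one_form_cotangent[OF \<alpha> p]] rho_covector[OF p one_form_cotangent[OF \<beta> p]]
  show "\<pi> (p, v) (vlift_form A D \<alpha> (p, v)) (vlift_form A D \<beta> (p, v)) = 0"
    and "\<pi> (p, v) (hlift_form A D \<alpha> (p, v)) (hlift_form A D \<beta> (p, v)) = 0"
    and "\<pi> (p, v) (hlift_form A D \<alpha> (p, v)) (vlift_form A D \<beta> (p, v)) = h p (\<alpha> p) (\<beta> p)"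
    and "\<pi> (p, v) (vlift_form A D \<beta> (p, v)) (hlift_form A D \<alpha> (p, v)) = - h p (\<alpha> p) (\<beta> p)"
    by (simp_all add: Pi_eval[OF lift_point] vlift_form \<alpha> \<beta> hlift_form double_tensor_def L_components rho_field
        h_eval[OF p] one_form_cotangent[OF _ p] dual_bilinear_zero[OF r_bilinear] lin linear_zero_form)
qed

end

lemma associated: "associated_bivector A D h \<pi>"
  unfolding associated_bivector_def
proof (intro conjI bivector_Pi allI impI ballI)
  fix \<alpha> \<beta> z assume f: "one_form A \<alpha>" "one_form A \<beta>" and "z \<in> points (tangent_bundle A)"
  then obtain p v where z: "z = (p, v)" and v: "v \<in> tangent p" by (cases z) (simp add: points_tangent_bundle)
  show "\<pi> z (vlift_form A D \<alpha> z) (vlift_form A D \<beta> z) = 0"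
    and "\<pi> z (hlift_form A D \<alpha> z) (hlift_form A D \<beta> z) = 0"
    and "\<pi> z (hlift_form A D \<alpha> z) (vlift_form A D \<beta> z) = h (fst z) (\<alpha> (fst z)) (\<beta> (fst z))"
    and "\<pi> z (vlift_form A D \<beta> z) (hlift_form A D \<alpha> z) = - h (fst z) (\<alpha> (fst z)) (\<beta> (fst z))"
    using associated_at[OF v f] by (simp_all add: z)
qed


section \<open>The Jacobi identity\<close>

abbreviation H :: "'g \<Rightarrow> ('m \<times> 'm tvec) vfield" where "H u \<equiv> hlift A D (\<rho> u)"
abbreviation V :: "'g \<Rightarrow> ('m \<times> 'm tvec) vfield" where "V u \<equiv> vlift A (\<rho> u)"

abbreviation bracket_T :: "('m \<times> 'm tvec \<Rightarrow> real) \<Rightarrow> ('m \<times> 'm tvec \<Rightarrow> real) \<Rightarrow> 'm \<times> 'm tvec \<Rightarrow> real" where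
  "bracket_T \<equiv> poisson_bracket (tangent_bundle A) \<pi>"

lemma bracket_T_eval:
  assumes z: "z \<in> points (tangent_bundle A)"
  shows "bracket_T F G z = r (\<lambda>u. H u z F) (\<lambda>u. V u z G) - r (\<lambda>u. H u z G) (\<lambda>u. V u z F)"
proof -
  obtain p v where z': "z = (p, v)" and v: "v \<in> tangent p" using z by (cases z) (simp add: points_tangent_bundle)
  show ?thesis
    using T.poisson_bracket_push_tensor[OF L_linear double_tensor_bilinear[OF r_bilinear] z, of F G]
    by (simp add: double_tensor_def z' L_components[OF v])
qed

text \<open>With the constant coefficients written out, the dependence on \<open>z\<close> sits in
  products of two functions, to which the product rule of a tangent vector applies.\<close>

lemma bracket_T_expand:
  assumes z: "z \<in> points (tangent_bundle A)"
  shows "bracket_T F G z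
    = (\<Sum>i\<in>Basis. \<Sum>j\<in>Basis. r (\<lambda>u. u \<bullet> i) (\<lambda>u. u \<bullet> j) * (H i z F * V j z G))
    - (\<Sum>i\<in>Basis. \<Sum>j\<in>Basis. r (\<lambda>u. u \<bullet> i) (\<lambda>u. u \<bullet> j) * (H i z G * V j z F))"
  unfolding bracket_T_eval[OF z]
  by (simp only: tensor_eval[OF r_bilinear T.linear_fields_value[OF H_linear z] T.linear_fields_value[OF V_linear z]])

context
  fixes p v
  assumes v: "v \<in> tangent p"
begin

text \<open>After the product rule the undifferentiated factor is frozen at \<open>(p, v)\<close>,
  so contracting it with \<open>r\<close> yields a fixed algebra element; only the other lift still
  varies with \<open>z\<close> under \<open>w\<close>.\<close>

lemma derivative_bracket_T:
  assumes w: "w \<in> T.tangent (p, v)" and F: "F \<in> T.sm (p, v)" and G: "G \<in> T.sm (p, v)"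
  shows "w (bracket_T F G) =
      w (\<lambda>z. V (sh (\<lambda>u. H u (p, v) F)) z G) + w (\<lambda>z. H (sh (\<lambda>u. V u (p, v) G)) z F)
    - w (\<lambda>z. V (sh (\<lambda>u. H u (p, v) G)) z F) - w (\<lambda>z. H (sh (\<lambda>u. V u (p, v) F)) z G)"
proof -
  let ?r = "\<lambda>i j. r (\<lambda>u. u \<bullet> i) (\<lambda>u. u \<bullet> j)"
  have pv: "(p, v) \<in> points (tangent_bundle A)" by (rule lift_point[OF v])
  have sm: "(\<lambda>z. H u z K) \<in> T.sm (p, v)" "(\<lambda>z. V u z K) \<in> T.sm (p, v)" if "K \<in> T.sm (p, v)" for u K
    using T.vector_field_sm[OF hlift_field[OF rho_field] that] T.vector_field_sm[OF vlift_field[OF rho_field] that] by auto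
  have prod: "(\<lambda>z. ?r i j * (H i z K * V j z K')) \<in> T.sm (p, v)"
    if "K \<in> T.sm (p, v)" "K' \<in> T.sm (p, v)" for i j K K'
    by (intro T.sm_mult T.sm_const pv sm that)
  have half: "w (\<lambda>z. \<Sum>i\<in>Basis. \<Sum>j\<in>Basis. ?r i j * (H i z K * V j z K'))
      = w (\<lambda>z. V (sh (\<lambda>u. H u (p, v) K)) z K') + w (\<lambda>z. H (sh (\<lambda>u. V u (p, v) K')) z K)"
    if K: "K \<in> T.sm (p, v)" and K': "K' \<in> T.sm (p, v)" for K K'
  proof -
    note lH = T.linear_fields_value[OF H_linear pv, of K] and lV = T.linear_fields_value[OF V_linear pv, of K']
    note lwH = T.linear_fields_derivative[OF H_linear w K] and lwV = T.linear_fields_derivative[OF V_linear w K']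
    have "w (\<lambda>z. \<Sum>i\<in>Basis. \<Sum>j\<in>Basis. ?r i j * (H i z K * V j z K'))
        = (\<Sum>i\<in>Basis. \<Sum>j\<in>Basis. ?r i j * (H i (p, v) K * w (\<lambda>z. V j z K')))
        + (\<Sum>i\<in>Basis. \<Sum>j\<in>Basis. ?r i j * (w (\<lambda>z. H i z K) * V j (p, v) K'))"
      by (simp add: T.tangent_sum[OF w] T.sm_sum[OF pv] prod[OF K K'] T.tangent_cmult[OF w T.sm_mult[OF sm(1)[OF K] sm(2)[OF K']]]
          T.tangent_mult[OF w sm(1)[OF K] sm(2)[OF K']] distrib_left sum.distrib)
    also have "\<dots> = r (\<lambda>u. H u (p, v) K) (\<lambda>u. w (\<lambda>z. V u z K')) + r (\<lambda>u. w (\<lambda>z. H u z K)) (\<lambda>u. V u (p, v) K')"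
      by (simp only: tensor_eval[OF r_bilinear lH lwV] tensor_eval[OF r_bilinear lwH lV])
    finally show ?thesis
      by (simp add: r_eq_sharp[OF lH lwV] r_sym[OF lwH lV] r_eq_sharp[OF lV lwH])
  qed
  have "w (bracket_T F G) = w (\<lambda>z. (\<Sum>i\<in>Basis. \<Sum>j\<in>Basis. ?r i j * (H i z F * V j z G))
      - (\<Sum>i\<in>Basis. \<Sum>j\<in>Basis. ?r i j * (H i z G * V j z F)))"
    by (rule T.tangent_cong[OF w]) (use T.eventually_near_points in \<open>eventually_elim, simp add: bracket_T_expand\<close>)
  also have "\<dots> = w (\<lambda>z. \<Sum>i\<in>Basis. \<Sum>j\<in>Basis. ?r i j * (H i z F * V j z G))
      - w (\<lambda>z. \<Sum>i\<in>Basis. \<Sum>j\<in>Basis. ?r i j * (H i z G * V j z F))"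
    by (intro T.tangent_diff[OF w] T.sm_sum[OF pv] prod F G)
  finally show ?thesis by (simp add: half[OF F G] half[OF G F])
qed

lemma bracket_T_bracket_T:
  assumes F: "F \<in> T.sm (p, v)" and G: "G \<in> T.sm (p, v)" and K: "K \<in> T.sm (p, v)"
  defines "x \<equiv> \<lambda>F. sh (\<lambda>u. H u (p, v) F)" and "y \<equiv> \<lambda>F. sh (\<lambda>u. V u (p, v) F)"
  shows "bracket_T F (bracket_T G K) (p, v) =
      V (x F) (p, v) (\<lambda>z. V (x G) z K) + V (x F) (p, v) (\<lambda>z. H (y K) z G)
    - V (x F) (p, v) (\<lambda>z. V (x K) z G) - V (x F) (p, v) (\<lambda>z. H (y G) z K)
    - H (y F) (p, v) (\<lambda>z. V (x G) z K) - H (y F) (p, v) (\<lambda>z. H (y K) z G)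
    + H (y F) (p, v) (\<lambda>z. V (x K) z G) + H (y F) (p, v) (\<lambda>z. H (y G) z K)"
proof -
  note pv = lift_point[OF v]
  note lH = T.linear_fields_value[OF H_linear pv] and lV = T.linear_fields_value[OF V_linear pv]
  have "bracket_T F (bracket_T G K) (p, v) = V (x F) (p, v) (bracket_T G K) - H (y F) (p, v) (bracket_T G K)"
    unfolding bracket_T_eval[OF pv] x_def y_def
    by (simp only: r_eq_sharp[OF lH lV, of F "bracket_T G K"] r_sym[OF lH lV, of "bracket_T G K" F]
        r_eq_sharp[OF lV lH, of F "bracket_T G K"])
  then show ?thesis
    by (simp add: derivative_bracket_T[OF hlift_tangent[OF rho_field v] G K]
        derivative_bracket_T[OF vlift_tangent[OF rho_field v] G K] x_def y_def)
qed

lemma H_H_commutator: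
  assumes F: "F \<in> T.sm (p, v)"
  shows "H a (p, v) (\<lambda>z. H b z F) - H b (p, v) (\<lambda>z. H a z F) = H (m a b) (p, v) F - H (m b a) (p, v) F"
proof -
  have "hlift A D (lie_bracket A (\<rho> a) (\<rho> b)) (p, v)
      = (\<lambda>F. 1 * H (m a b) (p, v) F + (- 1) * H (m b a) (p, v) F)"
    by (rule hlift_lincomb[OF rho_field rho_field v])
      (simp add: torsion[OF rho_field rho_field] vf_diff_def rho_m)
  then show ?thesis using hlift_hlift_commutator[OF rho_field rho_field v F] by simp
qed

lemma H_V_commutator:
  assumes F: "F \<in> T.sm (p, v)"
  shows "H a (p, v) (\<lambda>z. V b z F) - V b (p, v) (\<lambda>z. H a z F) = V (m a b) (p, v) F"
  using hlift_vlift_commutator[OF rho_field rho_field v F] by (simp add: rho_m)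

lemma jacobi:
  assumes F: "F \<in> T.sm (p, v)" and G: "G \<in> T.sm (p, v)" and K: "K \<in> T.sm (p, v)"
  shows "bracket_T F (bracket_T G K) (p, v) + bracket_T G (bracket_T K F) (p, v) + bracket_T K (bracket_T F G) (p, v) = 0"
proof -
  define x where "x = (\<lambda>F. sh (\<lambda>u. H u (p, v) F))"
  define y where "y = (\<lambda>F. sh (\<lambda>u. V u (p, v) F))"
  have xy: "sh (\<lambda>u. H u (p, v) F) = x F" "sh (\<lambda>u. V u (p, v) F) = y F" for F
    by (simp_all add: x_def y_def)
  note J = bracket_T_bracket_T[unfolded xy]
  note pv = lift_point[OF v]
  note lH = T.linear_fields_value[OF H_linear pv] and lV = T.linear_fields_value[OF V_linear pv]
  have VV: "V (x F) (p, v) (\<lambda>z. V (x G) z K) = V (x G) (p, v) (\<lambda>z. V (x F) z K)" if "K \<in> T.sm (p, v)" for F G K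
    by (rule vlift_vlift_commutator[OF rho_field rho_field v that])
  \<comment> \<open>The bracket condition with the vertical functionals of \<open>F\<close> and
    \<open>G\<close> in the first two slots and the horizontal functional of \<open>K\<close> in the
    third.\<close>
  have YB: "H (m (y F) (y G)) (p, v) K - H (m (y G) (y F)) (p, v) K
      = V (m (y G) (x K)) (p, v) F - V (m (y F) (x K)) (p, v) G" for F G K
    using yang_baxter[OF lV lV lH, of F G K] by (simp add: x_def y_def)
  show ?thesis
    \<comment> \<open>Of the 24 second-order terms, the 6 purely vertical ones cancel in pairs; the
      others group into 3 horizontal and 6 mixed commutators. These leave first-order terms, which
      the three cyclic instances of \<open>YB\<close> cancel.\<close>
    using VV[OF K, of F G] VV[OF F, of G K] VV[OF G, of K F] YB[of F G K] YB[of G K F] YB[of K F G]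
      H_H_commutator[OF K, of "y F" "y G"] H_H_commutator[OF F, of "y G" "y K"] H_H_commutator[OF G, of "y K" "y F"]
      H_V_commutator[OF K, of "y F" "x G"] H_V_commutator[OF K, of "y G" "x F"]
      H_V_commutator[OF F, of "y G" "x K"] H_V_commutator[OF F, of "y K" "x G"]
      H_V_commutator[OF G, of "y K" "x F"] H_V_commutator[OF G, of "y F" "x K"]
    unfolding J[OF F G K] J[OF G K F] J[OF K F G] by linarith
qed

end

lemma poisson: "poisson_tensor (tangent_bundle A) \<pi>"
  unfolding poisson_tensor_def
proof (intro conjI bivector_Pi allI impI ballI)
  fix F G K z
  assume s: "smooth_fun (tangent_bundle A) F" "smooth_fun (tangent_bundle A) G" "smooth_fun (tangent_bundle A) K"
    and z: "z \<in> points (tangent_bundle A)"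
  obtain p v where z': "z = (p, v)" and v: "v \<in> tangent p" using z by (cases z) (simp add: points_tangent_bundle)
  show "bracket_T F (bracket_T G K) z + bracket_T G (bracket_T K F) z + bracket_T K (bracket_T F G) z = 0"
    unfolding z' using s z unfolding z' by (intro jacobi[OF v] T.smooth_fun_sm)
qed

end


theorem theorem6p8:
  fixes m :: "'g::euclidean_space \<Rightarrow> 'g \<Rightarrow> 'g"
    and A :: "('m, 'e::euclidean_space) atlas"
    and D :: "'m conn"
    and \<rho> :: "'g \<Rightarrow> 'm vfield"
    and r :: "'g dual_form"
  assumes "left_symmetric_algebra m"
    and "affine_manifold A D"
    and "linear_into_fields A \<rho>"
    and "\<And>u v. \<rho> (m u v) = D (\<rho> u) (\<rho> v)"
    and "symmetric_tensor r"
    and "\<And>\<alpha> \<beta> \<gamma>. linear \<alpha> \<Longrightarrow> linear \<beta> \<Longrightarrow> linear \<gamma> \<Longrightarrow> tensor_bracket m r \<alpha> \<beta> \<gamma> = 0"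
  shows "associated_bivector A D (push_tensor \<rho> r)
           (push_tensor (lifted_map A D \<rho>) (double_tensor r))
       \<and> poisson_tensor (tangent_bundle A)
           (push_tensor (lifted_map A D \<rho>) (double_tensor r))
       \<and> contravariant_pseudo_hessian A D (push_tensor \<rho> r)"
proof -
  interpret yang_baxter A D m \<rho> r
    using assms by unfold_locales
      (auto simp: affine_manifold_def smooth_manifold_def left_symmetric_algebra_def)
  show ?thesis using associated poisson pseudo_hessian by blast
qed

end
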